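(* Let $(M,[\nabla])$ be an $n$-dimensional manifold with a projective structure. A necessary condition for $[\nabla]$ to include a Levi-Civita connection of some (pseudo-Riemannian) metric is that all the endomorphisms $\mathcal T_{[ed]}:S^2M\to S^2M$ of the space of symmetric 2-tensors, $\kappa^{cb}\mapsto T_{[ed]}{}^{cb}{}_{af}\,\kappa^{af}$, built from the projective Weyl tensor $W^a_{~bcd}$ of $[\nabla]$ by $$T_{[ed]}{}^{cb}{}_{af}=\tfrac12\delta^c_{~(a}W^b_{~f)ed}+\tfrac12\delta^b_{~(a}W^c_{~f)ed}+\tfrac1nW^c_{~(af)[e}\delta^b_{~d]}+\tfrac1nW^b_{~(af)[e}\delta^c_{~d]},$$ have vanishing determinants: $\det(\mathcal T_{[ed]})=0$ for all $e,d\in\{1,\dots,n\}$. In dimension $n\ge3$ this gives in general $\frac{n(n-1)}2$ obstructions to metrisability, namely $\det(\mathcal T_{[ed]})$ for $e<d$.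
   Context: A projective structure $[\nabla]$ on an $n$-dimensional manifold $M$ ($n\ge2$) is an equivalence class of torsion-free affine connections, where $\hat\nabla\sim\nabla$ iff there is a 1-form $A$ with $\hat\nabla_XY=\nabla_XY+A(X)Y+A(Y)X$ for all vector fields $X,Y$. For a representative $\nabla$ with connection 1-forms $\Gamma^a_{~b}=\Gamma^a_{~bc}\theta^c$ in a coframe $(\theta^a)$ dual to $(X_a)$ ($\nabla_{X_a}X_b=\Gamma^c_{~ba}X_c$), put $\Omega^a_{~b}=d\Gamma^a_{~b}+\Gamma^a_{~c}\wedge\Gamma^c_{~b}=\frac12R^a_{~bcd}\theta^c\wedge\theta^d$, $R_{ab}=R^c_{~acb}$, $\mathsf P_{ab}=\frac1{n-1}R_{(ab)}-\frac1{n+1}R_{[ab]}$. The projective Weyl tensor is $W^a_{~bcd}=R^a_{~bcd}-\delta^a_{~c}\mathsf P_{db}+\delta^a_{~d}\mathsf P_{cb}+2\delta^a_{~b}\mathsf P_{[cd]}$; it is the same for all connections in $[\nabla]$. Round (square) brackets on indices denote symmetrization (antisymmetrization) over the two enclosed indices with factor $\frac12$; in $W^c_{~(af)[e}\delta^b_{~d]}$ one symmetrizes in $a,f$ and antisymmetrizes in $e,d$. Components are taken pointwise with respect to any local frame, and $\mathcal T_{[ed]}$ is defined for each fixed pair of frame indices $e,d$. *)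

theory Defs
  imports "HOL-Analysis.Analysis"
begin

section \<open>Smooth manifolds\<close>

text \<open>Both predicates are only meant for open \<open>S\<close>.\<close>

primrec Ck_on :: "nat \<Rightarrow> ('x::real_normed_vector \<Rightarrow> 'y::real_normed_vector) \<Rightarrow> 'x set \<Rightarrow> bool" where
  "Ck_on 0 f S \<longleftrightarrow> continuous_on S f"
| "Ck_on (Suc k) f S \<longleftrightarrow>
     (\<forall>x\<in>S. f differentiable (at x)) \<and> (\<forall>v. Ck_on k (\<lambda>x. frechet_derivative f (at x) v) S)"

definition smooth_on :: "('x::real_normed_vector \<Rightarrow> 'y::real_normed_vector) \<Rightarrow> 'x set \<Rightarrow> bool" where
  "smooth_on f S \<longleftrightarrow> (\<forall>k. Ck_on k f S)"

type_synonym ('a, 'n) chart = "'a set \<times> ('a \<Rightarrow> (real, 'n) vec)"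

definition chart_dom :: "('a, 'n::finite) chart \<Rightarrow> 'a set" where
  "chart_dom c = fst c"

definition coord :: "('a, 'n::finite) chart \<Rightarrow> 'a \<Rightarrow> real^'n" where
  "coord c = snd c"

definition inv_coord :: "('a, 'n::finite) chart \<Rightarrow> real^'n \<Rightarrow> 'a" where
  "inv_coord c = inv_into (chart_dom c) (coord c)"

definition is_chart :: "('a::topological_space, 'n::finite) chart \<Rightarrow> bool" where
  "is_chart c \<longleftrightarrow> open (chart_dom c) \<and> open (coord c ` chart_dom c) \<and>
     homeomorphism (chart_dom c) (coord c ` chart_dom c) (coord c) (inv_coord c)"

text \<open>
  A smooth \<open>n\<close>-manifold (without boundary) is given by a smooth atlas \<open>\<A>\<close> on a subset of a
  Hausdorff, second countable space; the underlying set is \<open>carrier \<A>\<close> and \<open>n = CARD('n)\<close>.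
  Everything below only depends on the smooth structure generated by \<open>\<A>\<close>, so \<open>\<A>\<close> need not be
  maximal.
\<close>

definition smooth_atlas :: "('a::{t2_space, second_countable_topology}, 'n::finite) chart set \<Rightarrow> bool" where
  "smooth_atlas \<A> \<longleftrightarrow> (\<forall>c\<in>\<A>. is_chart c) \<and>
     (\<forall>c\<in>\<A>. \<forall>d\<in>\<A>. smooth_on (coord d \<circ> inv_coord c) (coord c ` (chart_dom c \<inter> chart_dom d)))"

definition carrier :: "('a, 'n::finite) chart set \<Rightarrow> 'a set" where
  "carrier \<A> = (\<Union>c\<in>\<A>. chart_dom c)"

definition euclidean_atlas :: "(real^'n, 'n::finite) chart set" where
  "euclidean_atlas = {(UNIV, \<lambda>x. x)}"

definition open_in :: "('a::topological_space, 'n::finite) chart set \<Rightarrow> 'a set \<Rightarrow> bool" where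
  "open_in \<A> U \<longleftrightarrow> open U \<and> U \<subseteq> carrier \<A>"

definition smooth_fun :: "('a, 'n::finite) chart set \<Rightarrow> 'a set \<Rightarrow> ('a \<Rightarrow> real) \<Rightarrow> bool" where
  "smooth_fun \<A> U f \<longleftrightarrow> (\<forall>c\<in>\<A>. smooth_on (f \<circ> inv_coord c) (coord c ` (chart_dom c \<inter> U)))"


section \<open>Tangent vectors, vector fields, differential forms\<close>

text \<open>
  A tangent vector at \<open>p\<close> is a family of components, one column for each chart around \<open>p\<close>, related
  by the Jacobians of the coordinate changes. It is required to vanish at the other charts, so that
  equality of tangent vectors is equality of functions.
\<close>

type_synonym ('a, 'n) tangent = "('a, 'n) chart \<Rightarrow> (real, 'n) vec"

definition tangent_space :: "('a, 'n::finite) chart set \<Rightarrow> 'a \<Rightarrow> ('a, 'n) tangent set" where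
  "tangent_space \<A> p = {v.
     (\<forall>c. \<not> (c \<in> \<A> \<and> p \<in> chart_dom c) \<longrightarrow> v c = 0) \<and>
     (\<forall>c\<in>\<A>. \<forall>d\<in>\<A>. p \<in> chart_dom c \<inter> chart_dom d \<longrightarrow>
        v d = frechet_derivative (coord d \<circ> inv_coord c) (at (coord c p)) (v c))}"

definition chart_at :: "('a, 'n::finite) chart set \<Rightarrow> 'a \<Rightarrow> ('a, 'n) chart" where
  "chart_at \<A> p = (SOME c. c \<in> \<A> \<and> p \<in> chart_dom c)"

text \<open>The derivative \<open>v(f)\<close> of a function in the direction of a tangent vector \<open>v\<close> at \<open>p\<close>;
  by the chain rule the choice of the chart is immaterial.\<close>

definition dir_deriv ::
  "('a, 'n::finite) chart set \<Rightarrow> 'a \<Rightarrow> ('a, 'n) tangent \<Rightarrow> ('a \<Rightarrow> real) \<Rightarrow> real" where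
  "dir_deriv \<A> p v f =
     (let c = chart_at \<A> p in frechet_derivative (f \<circ> inv_coord c) (at (coord c p)) (v c))"

text \<open>Vector fields, functions and forms on an open \<open>U\<close> are total functions on \<open>'a\<close> whose values
  outside \<open>U\<close> are irrelevant.\<close>

type_synonym ('a, 'n) vfield = "'a \<Rightarrow> ('a, 'n) tangent"

definition vector_field :: "('a, 'n::finite) chart set \<Rightarrow> 'a set \<Rightarrow> ('a, 'n) vfield \<Rightarrow> bool" where
  "vector_field \<A> U X \<longleftrightarrow> (\<forall>p\<in>U. X p \<in> tangent_space \<A> p) \<and>
     (\<forall>c\<in>\<A>. smooth_on (\<lambda>x. X (inv_coord c x) c) (coord c ` (chart_dom c \<inter> U)))"

definition lie_bracket ::
  "('a, 'n::finite) chart set \<Rightarrow> ('a, 'n) vfield \<Rightarrow> ('a, 'n) vfield \<Rightarrow> ('a, 'n) vfield" where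
  "lie_bracket \<A> X Y p = (\<lambda>c.
     if c \<in> \<A> \<and> p \<in> chart_dom c
     then frechet_derivative (\<lambda>x. Y (inv_coord c x) c) (at (coord c p)) (X p c)
        - frechet_derivative (\<lambda>x. X (inv_coord c x) c) (at (coord c p)) (Y p c)
     else 0)"

definition tangent_linear ::
  "('a, 'n::finite) chart set \<Rightarrow> 'a \<Rightarrow> (('a, 'n) tangent \<Rightarrow> real) \<Rightarrow> bool" where
  "tangent_linear \<A> p L \<longleftrightarrow>
     (\<forall>v\<in>tangent_space \<A> p. \<forall>w\<in>tangent_space \<A> p. L (\<lambda>c. v c + w c) = L v + L w) \<and>
     (\<forall>r. \<forall>v\<in>tangent_space \<A> p. L (\<lambda>c. r *\<^sub>R v c) = r * L v)"

type_synonym ('a, 'n) form1 = "'a \<Rightarrow> ('a, 'n) tangent \<Rightarrow> real"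
type_synonym ('a, 'n) form2 = "'a \<Rightarrow> ('a, 'n) tangent \<Rightarrow> ('a, 'n) tangent \<Rightarrow> real"

definition one_form ::
  "('a::topological_space, 'n::finite) chart set \<Rightarrow> ('a, 'n) form1 \<Rightarrow> bool" where
  "one_form \<A> \<alpha> \<longleftrightarrow> (\<forall>p\<in>carrier \<A>. tangent_linear \<A> p (\<alpha> p)) \<and>
     (\<forall>U X. open_in \<A> U \<and> vector_field \<A> U X \<longrightarrow> smooth_fun \<A> U (\<lambda>p. \<alpha> p (X p)))"

definition wedge :: "('a, 'n) form1 \<Rightarrow> ('a, 'n) form1 \<Rightarrow> ('a, 'n::finite) form2" where
  "wedge \<alpha> \<beta> p v w = \<alpha> p v * \<beta> p w - \<alpha> p w * \<beta> p v"

text \<open>The vector field on the domain of \<open>c\<close> with constant components \<open>u\<close> in the chart \<open>c\<close>.\<close>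

definition const_field ::
  "('a, 'n::finite) chart set \<Rightarrow> ('a, 'n) chart \<Rightarrow> real^'n \<Rightarrow> ('a, 'n) vfield" where
  "const_field \<A> c u p = (\<lambda>d.
     if d \<in> \<A> \<and> p \<in> chart_dom d
     then frechet_derivative (coord d \<circ> inv_coord c) (at (coord c p)) u else 0)"

text \<open>In a chart, \<open>(d\<alpha>)\<^sub>i\<^sub>j = \<partial>\<^sub>i \<alpha>\<^sub>j - \<partial>\<^sub>j \<alpha>\<^sub>i\<close>, that is \<open>d\<alpha>(V,W) = V(\<alpha>(W)) - W(\<alpha>(V))\<close> for fields with
  constant components; the choice of the chart is immaterial.\<close>

definition ext_deriv ::
  "('a, 'n::finite) chart set \<Rightarrow> ('a, 'n) form1 \<Rightarrow> ('a, 'n) form2" where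
  "ext_deriv \<A> \<alpha> p v w =
     (let c = chart_at \<A> p in
        dir_deriv \<A> p v (\<lambda>q. \<alpha> q (const_field \<A> c (w c) q))
      - dir_deriv \<A> p w (\<lambda>q. \<alpha> q (const_field \<A> c (v c) q)))"


section \<open>Affine connections and projective structures\<close>

text \<open>
  \<open>D X Y\<close> is the covariant derivative of \<open>Y\<close> along \<open>X\<close>. Connections act on vector fields over arbitrary
  open sets \<open>U\<close>, so that they can be applied to local frames; the second clause says that this
  is compatible with restriction.
\<close>

type_synonym ('a, 'n) connection = "('a, 'n) vfield \<Rightarrow> ('a, 'n) vfield \<Rightarrow> ('a, 'n) vfield"

definition affine_connection ::
  "('a::topological_space, 'n::finite) chart set \<Rightarrow> ('a, 'n) connection \<Rightarrow> bool" where
  "affine_connection \<A> D \<longleftrightarrow> (\<forall>U. open_in \<A> U \<longrightarrow>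
     (\<forall>X Y. vector_field \<A> U X \<and> vector_field \<A> U Y \<longrightarrow> vector_field \<A> U (D X Y)) \<and>
     (\<forall>X Y X' Y'. vector_field \<A> U X \<and> vector_field \<A> U Y \<and>
        (\<forall>p\<in>U. X' p = X p) \<and> (\<forall>p\<in>U. Y' p = Y p) \<longrightarrow> (\<forall>p\<in>U. D X' Y' p = D X Y p)) \<and>
     (\<forall>X X' Y. vector_field \<A> U X \<and> vector_field \<A> U X' \<and> vector_field \<A> U Y \<longrightarrow>
        (\<forall>p\<in>U. D (\<lambda>q c. X q c + X' q c) Y p = (\<lambda>c. D X Y p c + D X' Y p c))) \<and>
     (\<forall>f X Y. smooth_fun \<A> U f \<and> vector_field \<A> U X \<and> vector_field \<A> U Y \<longrightarrow>
        (\<forall>p\<in>U. D (\<lambda>q c. f q *\<^sub>R X q c) Y p = (\<lambda>c. f p *\<^sub>R D X Y p c))) \<and>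
     (\<forall>X Y Y'. vector_field \<A> U X \<and> vector_field \<A> U Y \<and> vector_field \<A> U Y' \<longrightarrow>
        (\<forall>p\<in>U. D X (\<lambda>q c. Y q c + Y' q c) p = (\<lambda>c. D X Y p c + D X Y' p c))) \<and>
     (\<forall>f X Y. smooth_fun \<A> U f \<and> vector_field \<A> U X \<and> vector_field \<A> U Y \<longrightarrow>
        (\<forall>p\<in>U. D X (\<lambda>q c. f q *\<^sub>R Y q c) p =
           (\<lambda>c. dir_deriv \<A> p (X p) f *\<^sub>R Y p c + f p *\<^sub>R D X Y p c))))"

definition torsion_free_connection ::
  "('a::topological_space, 'n::finite) chart set \<Rightarrow> ('a, 'n) connection \<Rightarrow> bool" where
  "torsion_free_connection \<A> D \<longleftrightarrow> affine_connection \<A> D \<and>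
     (\<forall>U X Y. open_in \<A> U \<and> vector_field \<A> U X \<and> vector_field \<A> U Y \<longrightarrow>
        (\<forall>p\<in>U. (\<lambda>c. D X Y p c - D Y X p c) = lie_bracket \<A> X Y p))"

definition projectively_equivalent ::
  "('a::topological_space, 'n::finite) chart set \<Rightarrow> ('a, 'n) connection \<Rightarrow> ('a, 'n) connection \<Rightarrow> bool" where
  "projectively_equivalent \<A> D D' \<longleftrightarrow> (\<exists>\<alpha>. one_form \<A> \<alpha> \<and>
     (\<forall>U X Y. open_in \<A> U \<and> vector_field \<A> U X \<and> vector_field \<A> U Y \<longrightarrow>
        (\<forall>p\<in>U. D' X Y p = (\<lambda>c. D X Y p c + \<alpha> p (X p) *\<^sub>R Y p c + \<alpha> p (Y p) *\<^sub>R X p c))))"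

definition projective_structure ::
  "('a::topological_space, 'n::finite) chart set \<Rightarrow> ('a, 'n) connection set \<Rightarrow> bool" where
  "projective_structure \<A> S \<longleftrightarrow>
     S \<in> {D. torsion_free_connection \<A> D} //
         {(D, D'). torsion_free_connection \<A> D \<and> torsion_free_connection \<A> D' \<and>
                   projectively_equivalent \<A> D D'}"


section \<open>Levi-Civita connections\<close>

definition pseudo_riemannian_metric ::
  "('a::topological_space, 'n::finite) chart set \<Rightarrow> ('a, 'n) form2 \<Rightarrow> bool" where
  "pseudo_riemannian_metric \<A> g \<longleftrightarrow>
     (\<forall>p\<in>carrier \<A>.
        (\<forall>v\<in>tangent_space \<A> p. tangent_linear \<A> p (g p v)) \<and>
        (\<forall>v\<in>tangent_space \<A> p. \<forall>w\<in>tangent_space \<A> p. g p v w = g p w v) \<and>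
        (\<forall>v\<in>tangent_space \<A> p. (\<forall>w\<in>tangent_space \<A> p. g p v w = 0) \<longrightarrow> v = (\<lambda>c. 0))) \<and>
     (\<forall>U X Y. open_in \<A> U \<and> vector_field \<A> U X \<and> vector_field \<A> U Y \<longrightarrow>
        smooth_fun \<A> U (\<lambda>p. g p (X p) (Y p)))"

definition levi_civita ::
  "('a::topological_space, 'n::finite) chart set \<Rightarrow> ('a, 'n) form2 \<Rightarrow> ('a, 'n) connection \<Rightarrow> bool" where
  "levi_civita \<A> g D \<longleftrightarrow> torsion_free_connection \<A> D \<and>
     (\<forall>U X Y Z. open_in \<A> U \<and> vector_field \<A> U X \<and> vector_field \<A> U Y \<and> vector_field \<A> U Z \<longrightarrow>
        (\<forall>p\<in>U. dir_deriv \<A> p (X p) (\<lambda>q. g q (Y q) (Z q)) =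
                g p (D X Y p) (Z p) + g p (Y p) (D X Z p)))"

definition metrisable ::
  "('a::topological_space, 'n::finite) chart set \<Rightarrow> ('a, 'n) connection set \<Rightarrow> bool" where
  "metrisable \<A> S \<longleftrightarrow> (\<exists>D\<in>S. \<exists>g. pseudo_riemannian_metric \<A> g \<and> levi_civita \<A> g D)"


section \<open>Curvature in a local frame\<close>

definition local_frame ::
  "('a::topological_space, 'n::finite) chart set \<Rightarrow> 'a set \<Rightarrow> ('n \<Rightarrow> ('a, 'n) vfield) \<Rightarrow> bool" where
  "local_frame \<A> U X \<longleftrightarrow> open_in \<A> U \<and> (\<forall>a. vector_field \<A> U (X a)) \<and>
     (\<forall>p\<in>U. \<forall>v\<in>tangent_space \<A> p. \<exists>!k::real^'n. v = (\<lambda>c. \<Sum>a\<in>UNIV. (k $ a) *\<^sub>R X a p c))"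

definition coframe :: "('n::finite \<Rightarrow> ('a, 'n) vfield) \<Rightarrow> 'n \<Rightarrow> ('a, 'n) form1" where
  "coframe X a p v = (THE k::real^'n. v = (\<lambda>c. \<Sum>a\<in>UNIV. (k $ a) *\<^sub>R X a p c)) $ a"

text \<open>\<open>conn_coeff D X c b a\<close> is \<open>\<Gamma>\<^sup>c\<^sub>b\<^sub>a\<close>, where \<open>D X\<^sub>a X\<^sub>b = \<Gamma>\<^sup>c\<^sub>b\<^sub>a X\<^sub>c\<close>: the index of differentiation
  comes last.\<close>

definition conn_coeff ::
  "('a, 'n::finite) connection \<Rightarrow> ('n \<Rightarrow> ('a, 'n) vfield) \<Rightarrow> 'n \<Rightarrow> 'n \<Rightarrow> 'n \<Rightarrow> 'a \<Rightarrow> real" where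
  "conn_coeff D X c b a p = coframe X c p (D (X a) (X b) p)"

definition conn_form ::
  "('a, 'n::finite) connection \<Rightarrow> ('n \<Rightarrow> ('a, 'n) vfield) \<Rightarrow> 'n \<Rightarrow> 'n \<Rightarrow> ('a, 'n) form1" where
  "conn_form D X a b p v = (\<Sum>c\<in>UNIV. conn_coeff D X a b c p * coframe X c p v)"

definition curv_form ::
  "('a, 'n::finite) chart set \<Rightarrow> ('a, 'n) connection \<Rightarrow> ('n \<Rightarrow> ('a, 'n) vfield) \<Rightarrow> 'n \<Rightarrow> 'n \<Rightarrow> ('a, 'n) form2" where
  "curv_form \<A> D X a b p v w =
     ext_deriv \<A> (conn_form D X a b) p v w
     + (\<Sum>c\<in>UNIV. wedge (conn_form D X a c) (conn_form D X c b) p v w)"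

text \<open>\<open>\<Omega>\<^sup>a\<^sub>b = (1/2) R\<^sup>a\<^sub>b\<^sub>c\<^sub>d \<theta>\<^sup>c \<and> \<theta>\<^sup>d\<close> with \<open>R\<^sup>a\<^sub>b\<^sub>c\<^sub>d\<close> antisymmetric in \<open>c, d\<close> amounts to
  \<open>R\<^sup>a\<^sub>b\<^sub>c\<^sub>d = \<Omega>\<^sup>a\<^sub>b(X\<^sub>c, X\<^sub>d)\<close>.\<close>

definition riemann ::
  "('a, 'n::finite) chart set \<Rightarrow> ('a, 'n) connection \<Rightarrow> ('n \<Rightarrow> ('a, 'n) vfield) \<Rightarrow> 'a \<Rightarrow> 'n \<Rightarrow> 'n \<Rightarrow> 'n \<Rightarrow> 'n \<Rightarrow> real" where
  "riemann \<A> D X p a b c d = curv_form \<A> D X a b p (X c p) (X d p)"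


section \<open>The projective Weyl tensor and the endomorphisms \<open>\<T>\<^bsub>[ed]\<^esub>\<close>\<close>

definition symm :: "('i \<Rightarrow> 'i \<Rightarrow> real) \<Rightarrow> 'i \<Rightarrow> 'i \<Rightarrow> real" where
  "symm F a b = (F a b + F b a) / 2"

definition alt :: "('i \<Rightarrow> 'i \<Rightarrow> real) \<Rightarrow> 'i \<Rightarrow> 'i \<Rightarrow> real" where
  "alt F a b = (F a b - F b a) / 2"

definition delta :: "'i \<Rightarrow> 'i \<Rightarrow> real" where
  "delta a b = (if a = b then 1 else 0)"

definition ricci :: "('n::finite \<Rightarrow> 'n \<Rightarrow> 'n \<Rightarrow> 'n \<Rightarrow> real) \<Rightarrow> 'n \<Rightarrow> 'n \<Rightarrow> real" where
  "ricci R a b = (\<Sum>c\<in>UNIV. R c a c b)"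

definition schouten :: "('n::finite \<Rightarrow> 'n \<Rightarrow> 'n \<Rightarrow> 'n \<Rightarrow> real) \<Rightarrow> 'n \<Rightarrow> 'n \<Rightarrow> real" where
  "schouten R a b =
     1 / (real CARD('n) - 1) * symm (ricci R) a b - 1 / (real CARD('n) + 1) * alt (ricci R) a b"

definition weyl_of :: "('n::finite \<Rightarrow> 'n \<Rightarrow> 'n \<Rightarrow> 'n \<Rightarrow> real) \<Rightarrow> 'n \<Rightarrow> 'n \<Rightarrow> 'n \<Rightarrow> 'n \<Rightarrow> real" where
  "weyl_of R a b c d =
     R a b c d - delta a c * schouten R d b + delta a d * schouten R c b
     + 2 * delta a b * alt (schouten R) c d"

definition weyl ::
  "('a, 'n::finite) chart set \<Rightarrow> ('a, 'n) connection \<Rightarrow> ('n \<Rightarrow> ('a, 'n) vfield) \<Rightarrow> 'a \<Rightarrow> 'n \<Rightarrow> 'n \<Rightarrow> 'n \<Rightarrow> 'n \<Rightarrow> real" where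
  "weyl \<A> D X p = weyl_of (riemann \<A> D X p)"

definition T_comp ::
  "('n::finite \<Rightarrow> 'n \<Rightarrow> 'n \<Rightarrow> 'n \<Rightarrow> real) \<Rightarrow> 'n \<Rightarrow> 'n \<Rightarrow> 'n \<Rightarrow> 'n \<Rightarrow> 'n \<Rightarrow> 'n \<Rightarrow> real" where
  "T_comp W e d c b a f =
     1 / 2 * symm (\<lambda>a f. delta c a * W b f e d) a f
   + 1 / 2 * symm (\<lambda>a f. delta b a * W c f e d) a f
   + 1 / real CARD('n) * alt (\<lambda>e d. symm (\<lambda>a f. W c a f e) a f * delta b d) e d
   + 1 / real CARD('n) * alt (\<lambda>e d. symm (\<lambda>a f. W b a f e) a f * delta c d) e d"

text \<open>Components \<open>\<kappa>\<^sup>c\<^sup>b\<close> of tensors are stored as \<open>\<kappa> $ c $ b\<close>.\<close>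

definition sym_tensors :: "(real^'n^'n) set" where
  "sym_tensors = {\<kappa>. \<forall>c b. \<kappa> $ c $ b = \<kappa> $ b $ c}"

definition T_endo ::
  "('n::finite \<Rightarrow> 'n \<Rightarrow> 'n \<Rightarrow> 'n \<Rightarrow> real) \<Rightarrow> 'n \<Rightarrow> 'n \<Rightarrow> real^'n^'n \<Rightarrow> real^'n^'n" where
  "T_endo W e d \<kappa> = (\<chi> c b. \<Sum>a\<in>UNIV. \<Sum>f\<in>UNIV. T_comp W e d c b a f * \<kappa> $ a $ f)"

lemma T_endo_sym: "T_endo W e d \<kappa> \<in> sym_tensors"
proof -
  have "T_comp W e d c b a f = T_comp W e d b c a f" for c b a f
    unfolding T_comp_def by simp
  then show ?thesis
    unfolding sym_tensors_def T_endo_def by simp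
qed

text \<open>
  Determinant of an endomorphism of the space of symmetric tensors, whose dimension is
  \<open>n(n+1)/2\<close>: the determinant of its matrix with respect to the basis \<open>sym_unit (c, b)\<close>, \<open>c \<le> b\<close>,
  whose coordinates are the components \<open>\<kappa>\<^sup>c\<^sup>b\<close> with \<open>c \<le> b\<close>.
\<close>

typedef (overloaded) ('n::linorder) index_pair = "{(c::'n, b). c \<le> b}"
  by auto

instance index_pair :: ("{finite, linorder}") finite
proof
  have "finite (Rep_index_pair ` (UNIV :: 'a index_pair set))"
    by (rule finite_subset[OF subset_UNIV finite])
  then show "finite (UNIV :: 'a index_pair set)"
    by (rule finite_imageD) (simp add: inj_on_def Rep_index_pair_inject)
qed

definition sym_unit :: "('n::{finite, linorder}) index_pair \<Rightarrow> real^('n::{finite, linorder})^('n::{finite, linorder})" where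
  "sym_unit i = (\<chi> c b. if Rep_index_pair i \<in> {(c, b), (b, c)} then 1 else 0)"

definition sym_coords :: "real^('n::{finite, linorder})^('n::{finite, linorder}) \<Rightarrow> real^(('n::{finite, linorder}) index_pair)" where
  "sym_coords \<kappa> = (\<chi> i. case Rep_index_pair i of (c, b) \<Rightarrow> \<kappa> $ c $ b)"

definition sym_matrix ::
  "(real^('n::{finite, linorder})^('n::{finite, linorder}) \<Rightarrow> real^('n::{finite, linorder})^('n::{finite, linorder})) \<Rightarrow> real^(('n::{finite, linorder}) index_pair)^(('n::{finite, linorder}) index_pair)" where
  "sym_matrix L = (\<chi> i j. sym_coords (L (sym_unit j)) $ i)"

definition sym_det :: "(real^('n::{finite, linorder})^('n::{finite, linorder}) \<Rightarrow> real^('n::{finite, linorder})^('n::{finite, linorder})) \<Rightarrow> real" where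
  "sym_det L = det (sym_matrix L)"

lemma sym_tensor_expansion:
  fixes \<kappa> :: "real^('n::{finite, linorder})^('n::{finite, linorder})"
  assumes "\<kappa> \<in> sym_tensors"
  shows "\<kappa> = (\<Sum>i\<in>UNIV. sym_coords \<kappa> $ i *\<^sub>R sym_unit i)"
proof -
  have "(\<Sum>i\<in>UNIV. sym_coords \<kappa> $ i *\<^sub>R sym_unit i) $ c $ b = \<kappa> $ c $ b" for c b
  proof -
    define j where "j = Abs_index_pair (min c b, max c b)"
    have j: "Rep_index_pair j = (min c b, max c b)"
      unfolding j_def by (rule Abs_index_pair_inverse) (auto simp: min_def max_def)
    have iff: "Rep_index_pair i \<in> {(c, b), (b, c)} \<longleftrightarrow> i = j" for i
      using Rep_index_pair[of i] j Rep_index_pair_inject[of i j]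
      by (auto simp: min_def max_def split: if_splits)
    have "(\<Sum>i\<in>UNIV. sym_coords \<kappa> $ i *\<^sub>R sym_unit i) $ c $ b
        = (\<Sum>i\<in>UNIV. if i = j then sym_coords \<kappa> $ i else 0)"
      unfolding sum_component vector_scaleR_component
      by (rule sum.cong) (auto simp: sym_unit_def iff simp del: insert_iff)
    also have "\<dots> = \<kappa> $ min c b $ max c b"
      by (simp add: sym_coords_def j)
    also have "\<dots> = \<kappa> $ c $ b"
      using assms by (auto simp: sym_tensors_def min_def max_def)
    finally show ?thesis .
  qed
  then show ?thesis by (simp add: vec_eq_iff)
qed

lemma sym_matrix_works:
  fixes L :: "real^('n::{finite, linorder})^('n::{finite, linorder}) \<Rightarrow> real^('n::{finite, linorder})^('n::{finite, linorder})"
  assumes "linear L" "\<kappa> \<in> sym_tensors"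
  shows "sym_coords (L \<kappa>) = sym_matrix L *v sym_coords \<kappa>"
proof -
  have "L \<kappa> = (\<Sum>i\<in>UNIV. sym_coords \<kappa> $ i *\<^sub>R L (sym_unit i))"
    by (subst sym_tensor_expansion[OF assms(2)]) (simp add: linear_sum[OF assms(1)] linear_cmul[OF assms(1)])
  then show ?thesis
    by (simp add: vec_eq_iff sym_coords_def sym_matrix_def matrix_vector_mult_def case_prod_beta
        mult.commute)
qed

lemma Ck_on_const: "Ck_on k (\<lambda>x. v) S"
  by (induction k arbitrary: v) auto

lemma smooth_atlas_euclidean: "smooth_atlas (euclidean_atlas :: (real^'n, 'n::finite) chart set)"
proof -
  have inv: "inv_into UNIV (\<lambda>x::real^'n. x) = (\<lambda>x. x)"
    using inv_id by (simp add: id_def)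
  have "Ck_on k (\<lambda>x::real^'n. x) UNIV" for k
    by (cases k) (auto simp: Ck_on_const)
  then show ?thesis
    by (simp add: smooth_atlas_def euclidean_atlas_def is_chart_def inv_coord_def chart_dom_def coord_def
        inv smooth_on_def homeomorphism_def comp_def)
qed

end

theory Submission
  imports Defs
begin

text \<open>
  In a local frame with connection forms \<open>\<omega>\<close>, replacing \<open>D\<close> by a projectively equivalent connection
  changes the curvature by \<open>\<delta>\<^sup>a\<^sub>b (Q\<^sub>d\<^sub>c - Q\<^sub>c\<^sub>d) + \<delta>\<^sup>a\<^sub>d Q\<^sub>b\<^sub>c - \<delta>\<^sup>a\<^sub>c Q\<^sub>b\<^sub>d\<close> for some \<open>Q\<close>, which the Schouten
  terms cancel; so the Weyl tensor may be computed from a Levi-Civita connection in the class. There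
  \<open>d\<^sup>2 g = 0\<close> gives skewness of the curvature, \<open>d\<^sup>2 \<theta> = 0\<close> the first Bianchi identity and hence symmetry
  of the Ricci tensor, and with these the inverse metric is a nonzero element of the kernel of every
  \<open>\<T>\<^bsub>[ed]\<^esub>\<close>.

  The obstructions are not vacuous: for one pair \<open>p \<noteq> q\<close> there is a Weyl tensor for which \<open>\<T>\<^bsub>[pq]\<^esub>\<close> is
  diagonal and invertible, a generic combination of such tensors works for all pairs at once, and every
  algebraic curvature tensor is the curvature at the origin of a torsion-free connection on \<open>\<real>\<^sup>n\<close> with
  linear Christoffel symbols.
\<close>

section \<open>Smooth functions and the symmetry of second derivatives\<close>

text \<open>Let H be the inverse metric, P the Schouten tensor and n the dimension. Contracted with
  H, the curvature becomes skew in its two upper indices, so the half of \<open>T_comp\<close>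
  without 1/n keeps only Schouten terms. The contraction of the last two lower slots of the other
  half, \<open>W c a f e\<close> with H, is - n times P with one index raised, plus a multiple of
  the identity. The factor 1/n is thus exactly the one with which the two halves cancel, while the
  multiples of the identity drop out by antisymmetry in \<open>e\<close>, \<open>d\<close> together
  with symmetry in \<open>c\<close>, \<open>b\<close>. The definitions differentiate forms in one
  chart chosen by \<open>chart_at\<close>. Everything is therefore pulled back to that chart, where
  a form is a function of a constant direction and a point, and where dd = 0 is the symmetry of
  iterated directional derivatives. For the converse direction one point is enough: Christoffel
  symbols that vanish there make the curvature a linear expression in their first derivatives, so it
  can be prescribed.\<close>

lemma Ck_on_SucD: "Ck_on (Suc k) f S \<Longrightarrow> Ck_on k f S"
proof (induction k arbitrary: f)
  case 0
  then show ?case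
    by (auto intro!: differentiable_imp_continuous_on differentiable_at_imp_differentiable_on)
next
  case (Suc k)
  from Suc.prems have "\<forall>x\<in>S. f differentiable (at x)"
    and "\<And>v. Ck_on (Suc k) (\<lambda>x. frechet_derivative f (at x) v) S"
    unfolding Ck_on.simps(2)[of "Suc k"] by blast+
  then show ?case using Suc.IH by (simp only: Ck_on.simps(2)) blast
qed

text \<open>A Frechet derivative depends on the values near the point, hence the open
  \<open>S\<close>. The rules below replace a derivative by a formula valid only on
  \<open>S\<close>; this lemma carries such a replacement through the induction on the
  order.\<close>

lemma Ck_on_cong:
  assumes "open S" "\<And>x. x \<in> S \<Longrightarrow> f x = g x" "Ck_on k f S"
  shows "Ck_on k g S"
  using assms(2,3)
proof (induction k arbitrary: f g)
  case 0
  then show ?case using continuous_on_cong[of S S f g] by simp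
next
  case (Suc k)
  have d: "f differentiable at x" if "x \<in> S" for x
    using Suc.prems that by auto
  have e: "frechet_derivative f (at x) = frechet_derivative g (at x)" if "x \<in> S" for x
    by (rule frechet_derivative_transform_within_open[OF d[OF that] assms(1) that Suc.prems(1)])
  have "g differentiable at x" if x: "x \<in> S" for x
  proof -
    have "(f has_derivative frechet_derivative f (at x)) (at x)"
      using d[OF x] by (simp add: frechet_derivative_works[symmetric])
    from has_derivative_transform_within_open[OF this assms(1) x Suc.prems(1)]
    show ?thesis by (rule differentiableI)
  qed
  moreover have "Ck_on k (\<lambda>x. frechet_derivative g (at x) v) S" for v
    by (rule Suc.IH[of "\<lambda>x. frechet_derivative f (at x) v"]) (use e Suc.prems(2) in auto)
  ultimately show ?case by simp
qed

lemma Ck_on_add: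
  assumes "open S"
  shows "Ck_on k f S \<Longrightarrow> Ck_on k g S \<Longrightarrow> Ck_on k (\<lambda>x. f x + g x) S"
proof (induction k arbitrary: f g)
  case 0
  then show ?case by (auto intro: continuous_on_add)
next
  case (Suc k)
  have "frechet_derivative (\<lambda>x. f x + g x) (at x) v
      = frechet_derivative f (at x) v + frechet_derivative g (at x) v" if "x \<in> S" for x v
    using Suc.prems that
    by (subst frechet_derivative_at[symmetric, OF has_derivative_add[OF
          frechet_derivative_works[THEN iffD1] frechet_derivative_works[THEN iffD1]]]) auto
  moreover have "Ck_on k (\<lambda>x. frechet_derivative f (at x) v + frechet_derivative g (at x) v) S" for v
    using Suc by auto
  ultimately have "Ck_on k (\<lambda>x. frechet_derivative (\<lambda>x. f x + g x) (at x) v) S" for v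
    using Ck_on_cong[OF assms, of "\<lambda>x. frechet_derivative f (at x) v + frechet_derivative g (at x) v"]
    by (metis (no_types, lifting))
  then show ?case using Suc.prems by (auto intro: differentiable_add)
qed

lemma (in bounded_bilinear) frechet_derivative:
  assumes "f differentiable at x" "g differentiable at x"
  shows "frechet_derivative (\<lambda>x. prod (f x) (g x)) (at x) v
    = prod (f x) (frechet_derivative g (at x) v) + prod (frechet_derivative f (at x) v) (g x)"
  by (subst frechet_derivative_at[symmetric, OF FDERIV[OF assms[unfolded frechet_derivative_works]]]) auto

text \<open>One induction serves both products of functions and scalings of vectors. The derivative
  contains each factor once undifferentiated, so \<open>Ck_on_SucD\<close> has to lower the order of
  that factor.\<close>

lemma (in bounded_bilinear) Ck_on:
  assumes "open S"
  shows "Ck_on k f S \<Longrightarrow> Ck_on k g S \<Longrightarrow> Ck_on k (\<lambda>x. prod (f x) (g x)) S"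
proof (induction k arbitrary: f g)
  case 0
  then show ?case by (auto intro: continuous_on)
next
  case (Suc k)
  have "Ck_on k (\<lambda>x. frechet_derivative (\<lambda>x. prod (f x) (g x)) (at x) v) S" for v
  proof (rule Ck_on_cong[OF assms])
    show "prod (f x) (frechet_derivative g (at x) v) + prod (frechet_derivative f (at x) v) (g x)
        = frechet_derivative (\<lambda>x. prod (f x) (g x)) (at x) v" if "x \<in> S" for x
      using frechet_derivative[of f x g v] Suc.prems that by simp
    have "Ck_on k f S" "Ck_on k g S" using Ck_on_SucD Suc.prems by blast+
    then show "Ck_on k (\<lambda>x. prod (f x) (frechet_derivative g (at x) v)
        + prod (frechet_derivative f (at x) v) (g x)) S"
      using Suc by (intro Ck_on_add[OF assms]) auto
  qed
  moreover have "(\<lambda>x. prod (f x) (g x)) differentiable at x" if "x \<in> S" for x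
  proof -
    have "(f has_derivative frechet_derivative f (at x)) (at x)"
      "(g has_derivative frechet_derivative g (at x)) (at x)"
      using Suc.prems that by (simp_all add: frechet_derivative_works[symmetric])
    from FDERIV[OF this] show ?thesis by (rule differentiableI)
  qed
  ultimately show ?case by auto
qed

lemma Ck_on_bounded_linear:
  assumes "open S" "bounded_linear L"
  shows "Ck_on k f S \<Longrightarrow> Ck_on k (\<lambda>x. L (f x)) S"
proof (induction k arbitrary: f)
  case 0
  then show ?case using assms(2) by (auto intro: bounded_linear.continuous_on)
next
  case (Suc k)
  have h: "((\<lambda>x. L (f x)) has_derivative (\<lambda>v. L (frechet_derivative f (at x) v))) (at x)" if "x \<in> S" for x
    using Suc.prems that
    by (intro bounded_linear.has_derivative[OF assms(2)]) (simp add: frechet_derivative_works[symmetric])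
  have "Ck_on k (\<lambda>x. frechet_derivative (\<lambda>x. L (f x)) (at x) v) S" for v
    by (rule Ck_on_cong[OF assms(1), of "\<lambda>x. L (frechet_derivative f (at x) v)"])
      (use Suc frechet_derivative_at[OF h] in \<open>auto dest: fun_cong\<close>)
  then show ?case using h by (auto simp: differentiable_def)
qed

lemma Ck_on_inverse:
  fixes f :: "_ \<Rightarrow> real"
  assumes "open S" "\<And>x. x \<in> S \<Longrightarrow> f x \<noteq> 0"
  shows "Ck_on k f S \<Longrightarrow> Ck_on k (\<lambda>x. inverse (f x)) S"
proof (induction k)
  case 0
  then show ?case using assms(2) by (auto intro!: continuous_intros)
next
  case (Suc k)
  have h: "((\<lambda>x. inverse (f x)) has_derivative
      (\<lambda>v. - (inverse (f x) * frechet_derivative f (at x) v * inverse (f x)))) (at x)" if "x \<in> S" for x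
    using Suc.prems that assms(2) by (intro Deriv.has_derivative_inverse) (auto simp: frechet_derivative_works[symmetric])
  have I: "Ck_on k (\<lambda>x. inverse (f x)) S" using Suc Ck_on_SucD by blast
  have "Ck_on k (\<lambda>x. frechet_derivative (\<lambda>x. inverse (f x)) (at x) v) S" for v
  proof (rule Ck_on_cong[OF assms(1)])
    show "- (inverse (f x) * frechet_derivative f (at x) v * inverse (f x))
        = frechet_derivative (\<lambda>x. inverse (f x)) (at x) v" if "x \<in> S" for x
      using frechet_derivative_at[OF h[OF that]] by (auto dest: fun_cong)
    show "Ck_on k (\<lambda>x. - (inverse (f x) * frechet_derivative f (at x) v * inverse (f x))) S"
      using Suc.prems
      by (intro Ck_on_bounded_linear[OF assms(1) bounded_linear_minus[OF bounded_linear_ident]]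
          bounded_bilinear.Ck_on[OF bounded_bilinear_mult assms(1)] I) auto
  qed
  then show ?case using h by (auto simp: differentiable_def)
qed

lemma smooth_on_cong:
  "open S \<Longrightarrow> (\<And>x. x \<in> S \<Longrightarrow> f x = g x) \<Longrightarrow> smooth_on f S \<Longrightarrow> smooth_on g S"
  unfolding smooth_on_def by (metis Ck_on_cong)

lemma smooth_on_const: "smooth_on (\<lambda>x. c) S"
  by (simp add: smooth_on_def Ck_on_const)

lemma smooth_on_add: "open S \<Longrightarrow> smooth_on f S \<Longrightarrow> smooth_on g S \<Longrightarrow> smooth_on (\<lambda>x. f x + g x) S"
  by (simp add: smooth_on_def Ck_on_add)

lemma (in bounded_bilinear) smooth_on:
  "open S \<Longrightarrow> smooth_on f S \<Longrightarrow> smooth_on g S \<Longrightarrow> smooth_on (\<lambda>x. prod (f x) (g x)) S"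
  by (simp add: smooth_on_def Ck_on)

lemmas smooth_on_mult = bounded_bilinear.smooth_on[OF bounded_bilinear_mult]
lemmas smooth_on_scaleR = bounded_bilinear.smooth_on[OF bounded_bilinear_scaleR]

lemma smooth_on_bounded_linear:
  "open S \<Longrightarrow> bounded_linear L \<Longrightarrow> smooth_on f S \<Longrightarrow> smooth_on (\<lambda>x. L (f x)) S"
  by (simp add: smooth_on_def Ck_on_bounded_linear)

lemmas smooth_on_nth = smooth_on_bounded_linear[OF _ bounded_linear_vec_nth]

lemma smooth_on_inverse:
  fixes f :: "_ \<Rightarrow> real"
  shows "open S \<Longrightarrow> (\<And>x. x \<in> S \<Longrightarrow> f x \<noteq> 0) \<Longrightarrow> smooth_on f S \<Longrightarrow> smooth_on (\<lambda>x. inverse (f x)) S"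
  by (simp add: smooth_on_def Ck_on_inverse)

lemma smooth_on_sum:
  assumes "open S"
  shows "(\<And>i. i \<in> I \<Longrightarrow> smooth_on (f i) S) \<Longrightarrow> smooth_on (\<lambda>x. \<Sum>i\<in>I. f i x) S"
  by (induction I rule: infinite_finite_induct) (auto intro: smooth_on_const smooth_on_add[OF assms])

lemma smooth_on_prod:
  fixes f :: "_ \<Rightarrow> _ \<Rightarrow> real"
  assumes "open S"
  shows "(\<And>i. i \<in> I \<Longrightarrow> smooth_on (f i) S) \<Longrightarrow> smooth_on (\<lambda>x. \<Prod>i\<in>I. f i x) S"
  by (induction I rule: infinite_finite_induct) (auto intro: smooth_on_const smooth_on_mult[OF assms])

lemma smooth_on_ident: "open S \<Longrightarrow> smooth_on (\<lambda>x. x) S"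
  unfolding smooth_on_def
proof
  fix k show "Ck_on k (\<lambda>x. x) S" by (cases k) (auto simp: Ck_on_const)
qed

lemma smooth_on_vec_lambda:
  fixes f :: "'n::finite \<Rightarrow> _ \<Rightarrow> real"
  assumes "open S" "\<And>i. smooth_on (f i) S"
  shows "smooth_on (\<lambda>x. \<chi> i. f i x) S"
proof -
  have "(\<chi> i. f i x) = (\<Sum>i\<in>UNIV. f i x *\<^sub>R axis i 1)" for x
    by (simp add: vec_eq_iff axis_def if_distrib cong: if_cong)
  then show ?thesis using assms by (auto intro!: smooth_on_sum smooth_on_scaleR smooth_on_const)
qed

lemma smooth_on_det:
  fixes A :: "_ \<Rightarrow> real^'n^'n"
  assumes "open S" "\<And>i j. smooth_on (\<lambda>x. A x $ i $ j) S"
  shows "smooth_on (\<lambda>x. det (A x)) S"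
  unfolding det_def using assms by (auto intro!: smooth_on_sum smooth_on_mult smooth_on_const smooth_on_prod)

lemma smooth_on_imp_differentiable: "smooth_on f S \<Longrightarrow> x \<in> S \<Longrightarrow> f differentiable at x"
  unfolding smooth_on_def by (drule spec[of _ "Suc 0"]) simp

lemma smooth_on_imp_continuous_on: "smooth_on f S \<Longrightarrow> continuous_on S f"
  unfolding smooth_on_def by (drule spec[of _ 0]) simp

text \<open>The direction comes first and the point last, so that \<open>der v f\<close> is again a
  function and derivatives can be iterated.\<close>

definition der :: "'x \<Rightarrow> ('x::real_normed_vector \<Rightarrow> 'y::real_normed_vector) \<Rightarrow> 'x \<Rightarrow> 'y" where
  "der v f x = frechet_derivative f (at x) v"

lemma smooth_on_der: "smooth_on f S \<Longrightarrow> smooth_on (der v f) S"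
  unfolding smooth_on_def der_def[abs_def]
  by (rule allI, drule_tac x = "Suc k" in spec) simp

lemma der_cong:
  assumes "f differentiable at x" "open S" "x \<in> S" "\<And>y. y \<in> S \<Longrightarrow> f y = g y"
  shows "der v f x = der v g x"
  unfolding der_def using frechet_derivative_transform_within_open[OF assms] by simp

lemma der_eqI: "(f has_derivative f') (at x) \<Longrightarrow> der v f x = f' v"
  unfolding der_def using frechet_derivative_at by metis

lemma der_const [simp]: "der v (\<lambda>x. c) x = 0"
  by (simp add: der_def)

lemma der_add:
  "f differentiable at x \<Longrightarrow> g differentiable at x \<Longrightarrow> der v (\<lambda>x. f x + g x) x = der v f x + der v g x"
  unfolding der_def by (rule der_eqI[unfolded der_def], rule has_derivative_add)
    (simp_all add: frechet_derivative_works[symmetric])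

lemma der_diff:
  "f differentiable at x \<Longrightarrow> g differentiable at x \<Longrightarrow> der v (\<lambda>x. f x - g x) x = der v f x - der v g x"
  unfolding der_def by (rule der_eqI[unfolded der_def], rule has_derivative_diff)
    (simp_all add: frechet_derivative_works[symmetric])

lemma der_mult:
  fixes f g :: "_ \<Rightarrow> real"
  shows "f differentiable at x \<Longrightarrow> g differentiable at x \<Longrightarrow>
    der v (\<lambda>x. f x * g x) x = f x * der v g x + der v f x * g x"
  unfolding der_def by (rule bounded_bilinear.frechet_derivative[OF bounded_bilinear_mult])

lemma der_scaleR:
  shows "f differentiable at x \<Longrightarrow> g differentiable at x \<Longrightarrow>
    der v (\<lambda>x. f x *\<^sub>R g x) x = f x *\<^sub>R der v g x + der v f x *\<^sub>R g x"
  unfolding der_def by (rule bounded_bilinear.frechet_derivative[OF bounded_bilinear_scaleR])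

lemma der_sum:
  "(\<And>i. i \<in> I \<Longrightarrow> f i differentiable at x) \<Longrightarrow> der v (\<lambda>x. \<Sum>i\<in>I. f i x) x = (\<Sum>i\<in>I. der v (f i) x)"
  unfolding der_def by (rule der_eqI[unfolded der_def], rule has_derivative_sum)
    (simp add: frechet_derivative_works[symmetric])

lemma der_linear: "f differentiable at x \<Longrightarrow> linear (\<lambda>v. der v f x)"
  unfolding der_def by (rule linear_frechet_derivative)

section \<open>Symmetry of second derivatives\<close>

lemma has_real_derivative_along_line:
  fixes f :: "'x::real_normed_vector \<Rightarrow> real"
  assumes "f differentiable at (y + s *\<^sub>R u)"
  shows "((\<lambda>s. f (y + s *\<^sub>R u)) has_real_derivative der u f (y + s *\<^sub>R u)) (at s)"
proof -
  have "((\<lambda>s. y + s *\<^sub>R u) has_derivative (\<lambda>t. t *\<^sub>R u)) (at s)"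
    by (auto intro!: derivative_eq_intros)
  moreover have "(f has_derivative (\<lambda>v. der v f (y + s *\<^sub>R u))) (at (y + s *\<^sub>R u))"
    using assms by (simp add: der_def frechet_derivative_works)
  ultimately have "((\<lambda>s. f (y + s *\<^sub>R u)) has_derivative (\<lambda>t. der (t *\<^sub>R u) f (y + s *\<^sub>R u))) (at s)"
    by (rule has_derivative_compose)
  moreover have "der (t *\<^sub>R u) f (y + s *\<^sub>R u) = der u f (y + s *\<^sub>R u) * t" for t
    using linear_cmul[OF der_linear[OF assms]] by simp
  ultimately show ?thesis by (simp add: has_field_derivative_def)
qed

text \<open>The mean value theorem is applied along \<open>u\<close> to the increment in
  \<open>v\<close>, then along \<open>v\<close> to the derivative so obtained. The second difference
  is unchanged when \<open>u\<close> and \<open>v\<close> are swapped, whereas the derivative on the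
  right has a fixed order; this asymmetry is what the next lemma exploits.\<close>

lemma second_difference_mvt:
  fixes f :: "'x::real_normed_vector \<Rightarrow> real"
  assumes S: "\<forall>a\<in>{0..h}. \<forall>b\<in>{0..h}. x + a *\<^sub>R u + b *\<^sub>R v \<in> S"
    and f: "smooth_on f S" and h: "0 < h"
  shows "\<exists>a b. 0 < a \<and> a < h \<and> 0 < b \<and> b < h \<and>
    f (x + h *\<^sub>R u + h *\<^sub>R v) - f (x + h *\<^sub>R u) - f (x + h *\<^sub>R v) + f x
      = h * h * der v (der u f) (x + a *\<^sub>R u + b *\<^sub>R v)"
proof -
  have d: "((\<lambda>s. f (x + b *\<^sub>R v + s *\<^sub>R u)) has_real_derivative der u f (x + b *\<^sub>R v + s *\<^sub>R u)) (at s)"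
    if "0 \<le> s" "s \<le> h" "0 \<le> b" "b \<le> h" for s b
    using S[THEN bspec, THEN bspec, of s b] that
    by (intro has_real_derivative_along_line smooth_on_imp_differentiable[OF f]) (simp add: algebra_simps)
  have "\<exists>a>0. a < h \<and> (f (x + h *\<^sub>R v + h *\<^sub>R u) - f (x + h *\<^sub>R u)) - (f (x + h *\<^sub>R v + 0 *\<^sub>R u) - f (x + 0 *\<^sub>R u))
      = (h - 0) * (der u f (x + h *\<^sub>R v + a *\<^sub>R u) - der u f (x + a *\<^sub>R u))"
    using d[of _ h] d[of _ 0] h by (intro MVT2 DERIV_diff) auto
  then obtain a where a: "0 < a" "a < h"
    "f (x + h *\<^sub>R v + h *\<^sub>R u) - f (x + h *\<^sub>R u) - f (x + h *\<^sub>R v) + f x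
      = h * (der u f (x + h *\<^sub>R v + a *\<^sub>R u) - der u f (x + a *\<^sub>R u))"
    by (auto simp: algebra_simps)
  have "\<exists>b>0. b < h \<and> der u f (x + a *\<^sub>R u + h *\<^sub>R v) - der u f (x + a *\<^sub>R u + 0 *\<^sub>R v)
      = (h - 0) * der v (der u f) (x + a *\<^sub>R u + b *\<^sub>R v)"
    using a S h by (intro MVT2 has_real_derivative_along_line
        smooth_on_imp_differentiable[OF smooth_on_der[OF f]]) auto
  then obtain b where "0 < b" "b < h"
    "der u f (x + a *\<^sub>R u + h *\<^sub>R v) - der u f (x + a *\<^sub>R u) = h * der v (der u f) (x + a *\<^sub>R u + b *\<^sub>R v)"
    by auto
  with a show ?thesis by (intro exI[of _ a] exI[of _ b]) (auto simp: algebra_simps)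
qed

text \<open>The second difference over a small parallelogram is \<open>h * h\<close> times a value
  near \<open>x\<close> of either mixed derivative. If these differed at \<open>x\<close>,
  continuity would keep the two values apart.\<close>

lemma der_commute:
  fixes f :: "'x::real_normed_vector \<Rightarrow> real"
  assumes "open S" "smooth_on f S" "x \<in> S"
  shows "der v (der u f) x = der u (der v f) x"
proof (rule ccontr)
  define F where "F = der v (der u f)"
  define G where "G = der u (der v f)"
  assume "der v (der u f) x \<noteq> der u (der v f) x"
  then have e: "0 < dist (F x) (G x) / 2" (is "0 < ?e") by (simp add: F_def G_def)
  have "continuous_on S F" "continuous_on S G"
    unfolding F_def G_def using assms(2) smooth_on_der smooth_on_imp_continuous_on by blast+
  then have "isCont F x" "isCont G x" using assms(1,3) continuous_on_eq_continuous_at by blast+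
  then obtain d1 d2 where d: "0 < d1" "\<And>y. dist y x < d1 \<Longrightarrow> dist (F y) (F x) < ?e"
    "0 < d2" "\<And>y. dist y x < d2 \<Longrightarrow> dist (G y) (G x) < ?e"
    using e unfolding continuous_at_eps_delta by metis
  obtain r where r: "0 < r" "ball x r \<subseteq> S" using assms openE by blast
  define m where "m = min r (min d1 d2)"
  \<comment> \<open>The parallelogram must stay within distance \<open>m\<close> of
    \<open>x\<close>; the summand 1 keeps the denominator positive when both vectors are
    zero.\<close>
  define h where "h = m / (2 * (norm u + norm v + 1))"
  have m: "0 < m" using d r by (simp add: m_def)
  have h: "0 < h" unfolding h_def using m by (intro divide_pos_pos) (auto intro: add_nonneg_pos)
  have hb: "h * (norm u + norm v) < m"
  proof -
    have "h * (2 * (norm u + norm v + 1)) = m"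
      unfolding h_def using norm_ge_zero[of u] norm_ge_zero[of v]
      by (subst times_divide_eq_left, subst nonzero_mult_div_cancel_right)
        (auto simp: add_nonneg_eq_0_iff)
    moreover have "0 \<le> h * norm u" "0 \<le> h * norm v" using h by simp_all
    ultimately show ?thesis using h unfolding distrib_left by linarith
  qed
  have near: "dist (x + a *\<^sub>R u + b *\<^sub>R v) x < m" if "0 \<le> a" "a \<le> h" "0 \<le> b" "b \<le> h" for a b
  proof -
    have "dist (x + a *\<^sub>R u + b *\<^sub>R v) x = norm (a *\<^sub>R u + b *\<^sub>R v)" by (simp add: dist_norm algebra_simps)
    also have "\<dots> \<le> a * norm u + b * norm v" using norm_triangle_ineq[of "a *\<^sub>R u" "b *\<^sub>R v"] that by simp
    also have "\<dots> \<le> h * norm u + h * norm v" using that by (intro add_mono mult_right_mono) auto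
    finally show ?thesis using hb by (simp add: algebra_simps)
  qed
  have S1: "\<forall>a\<in>{0..h}. \<forall>b\<in>{0..h}. x + a *\<^sub>R u + b *\<^sub>R v \<in> S"
    using near r by (fastforce simp: m_def dist_commute)
  have S2: "\<forall>a\<in>{0..h}. \<forall>b\<in>{0..h}. x + a *\<^sub>R v + b *\<^sub>R u \<in> S"
    using S1 by (simp add: add.assoc add.commute[of "_ *\<^sub>R v"])
  obtain a b where 1: "0 < a" "a < h" "0 < b" "b < h"
    "f (x + h *\<^sub>R u + h *\<^sub>R v) - f (x + h *\<^sub>R u) - f (x + h *\<^sub>R v) + f x = h * h * F (x + a *\<^sub>R u + b *\<^sub>R v)"
    using second_difference_mvt[of h x u v S f, OF S1 assms(2) h] unfolding F_def by metis
  obtain a' b' where 2: "0 < a'" "a' < h" "0 < b'" "b' < h"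
    "f (x + h *\<^sub>R v + h *\<^sub>R u) - f (x + h *\<^sub>R v) - f (x + h *\<^sub>R u) + f x = h * h * G (x + a' *\<^sub>R v + b' *\<^sub>R u)"
    using second_difference_mvt[of h x v u S f, OF S2 assms(2) h] unfolding G_def by metis
  have "h * h * F (x + a *\<^sub>R u + b *\<^sub>R v) = h * h * G (x + a' *\<^sub>R v + b' *\<^sub>R u)"
    using 1(5) 2(5) by (simp add: algebra_simps)
  then have "F (x + a *\<^sub>R u + b *\<^sub>R v) = G (x + b' *\<^sub>R u + a' *\<^sub>R v)"
    using h by (simp add: algebra_simps)
  moreover have "dist (F (x + a *\<^sub>R u + b *\<^sub>R v)) (F x) < ?e"
    using near[of a b] 1 by (intro d(2)) (auto simp: m_def)
  moreover have "dist (G (x + b' *\<^sub>R u + a' *\<^sub>R v)) (G x) < ?e"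
    using near[of b' a'] 2 by (intro d(4)) (auto simp: m_def)
  ultimately show False
    using dist_triangle3[of "F x" "G x" "F (x + a *\<^sub>R u + b *\<^sub>R v)"] by simp
qed


section \<open>Moving frames\<close>

text \<open>Cartan's d\<omega> + \<omega> \<and> \<omega> on the constant fields \<open>v\<close>
  and \<open>w\<close>; these commute, so the exterior derivative has no bracket term.\<close>

definition curvature ::
  "('n::finite \<Rightarrow> 'n \<Rightarrow> real^'n \<Rightarrow> real^'n \<Rightarrow> real) \<Rightarrow> 'n \<Rightarrow> 'n \<Rightarrow> real^'n \<Rightarrow> real^'n \<Rightarrow> real^'n \<Rightarrow> real" where
  "curvature \<omega> a b v w x = der v (\<omega> a b w) x - der w (\<omega> a b v) x
     + (\<Sum>c\<in>UNIV. \<omega> a c v x * \<omega> c b w x - \<omega> a c w x * \<omega> c b v x)"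

lemma sum_delta_mult [simp]:
  fixes f :: "'n::finite \<Rightarrow> real"
  shows "(\<Sum>c\<in>UNIV. delta a c * f c) = f a" "(\<Sum>c\<in>UNIV. delta c a * f c) = f a"
    "(\<Sum>c\<in>UNIV. f c * delta a c) = f a" "(\<Sum>c\<in>UNIV. f c * delta c a) = f a"
  by (simp_all add: delta_def if_distrib[of "\<lambda>x. x * _"] if_distrib[of "\<lambda>x. _ * x"] cong: if_cong)

text \<open>A local frame of a torsion-free connection in coordinates: \<open>\<theta> a u\<close> and \<open>\<omega> a b u\<close> are the values
  of the coframe and of the connection forms on the constant field \<open>u\<close>; the argument \<open>x\<close> comes last.\<close>

locale moving_frame =
  fixes V :: "(real^'n) set"
    and \<theta> :: "'n::finite \<Rightarrow> real^'n \<Rightarrow> real^'n \<Rightarrow> real"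
    and \<omega> :: "'n \<Rightarrow> 'n \<Rightarrow> real^'n \<Rightarrow> real^'n \<Rightarrow> real"
  assumes open_V: "open V"
    and smooth_theta: "smooth_on (\<theta> a u) V"
    and smooth_omega: "smooth_on (\<omega> a b u) V"
    and structure_eq: "x \<in> V \<Longrightarrow> der v (\<theta> a w) x - der w (\<theta> a v) x
      = - (\<Sum>b\<in>UNIV. \<omega> a b v x * \<theta> b w x - \<omega> a b w x * \<theta> b v x)"
begin

lemma differentiable_theta: "x \<in> V \<Longrightarrow> \<theta> a u differentiable at x"
  and differentiable_omega: "x \<in> V \<Longrightarrow> \<omega> a b u differentiable at x"
  using smooth_theta smooth_omega smooth_on_imp_differentiable by blast+

text \<open>The structure equation holds on the whole open set \<open>V\<close> and may be
  differentiated; this is the form in which dd\<theta> = 0 is used.\<close>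

lemma der_structure:
  assumes "x \<in> V"
  shows "der u (der v (\<theta> a w)) x - der u (der w (\<theta> a v)) x
    = - (\<Sum>b\<in>UNIV. \<omega> a b v x * der u (\<theta> b w) x + der u (\<omega> a b v) x * \<theta> b w x
      - \<omega> a b w x * der u (\<theta> b v) x - der u (\<omega> a b w) x * \<theta> b v x)"
proof -
  have d: "der v (\<theta> a w) differentiable at x" for v w
    using smooth_on_der[OF smooth_theta] smooth_on_imp_differentiable assms by blast
  have "der u (der v (\<theta> a w)) x - der u (der w (\<theta> a v)) x
      = der u (\<lambda>x. der v (\<theta> a w) x - der w (\<theta> a v) x) x"
    by (rule der_diff[symmetric]) (rule d)+
  also have "\<dots> = der u (\<lambda>x. \<Sum>b\<in>UNIV. \<omega> a b w x * \<theta> b v x - \<omega> a b v x * \<theta> b w x) x"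
    using structure_eq
    by (intro der_cong[OF _ open_V assms] differentiable_diff d)
      (simp add: sum_negf[symmetric] del: sum_subtractf)
  also have "\<dots> = (\<Sum>b\<in>UNIV. der u (\<lambda>x. \<omega> a b w x * \<theta> b v x - \<omega> a b v x * \<theta> b w x) x)"
    using assms by (intro der_sum differentiable_diff differentiable_mult differentiable_theta differentiable_omega)
  also have "\<dots> = (\<Sum>b\<in>UNIV. - (\<omega> a b v x * der u (\<theta> b w) x + der u (\<omega> a b v) x * \<theta> b w x
      - \<omega> a b w x * der u (\<theta> b v) x - der u (\<omega> a b w) x * \<theta> b v x))"
    using assms
    by (intro sum.cong refl) (simp add: der_diff der_mult differentiable_mult differentiable_theta
        differentiable_omega algebra_simps)
  finally show ?thesis by (simp only: sum_negf)
qed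

text \<open>In the cyclic sum of \<open>der_structure\<close> the second derivatives cancel in
  pairs. This leaves d\<omega> \<and> \<theta> = \<omega> \<and> d\<theta>, where d\<theta> is -
  \<omega> \<and> \<theta>.\<close>

lemma first_bianchi:
  assumes x: "x \<in> V"
  shows "(\<Sum>b\<in>UNIV. curvature \<omega> a b u v x * \<theta> b w x + curvature \<omega> a b v w x * \<theta> b u x
    + curvature \<omega> a b w u x * \<theta> b v x) = 0"
proof -
  have comm: "der u (der v (\<theta> a w)) x = der v (der u (\<theta> a w)) x" for u v w
    by (rule der_commute[OF open_V smooth_theta x])
  define D where "D u v b w = (der u (\<omega> a b v) x - der v (\<omega> a b u) x) * \<theta> b w x" for u v b w
  define E where "E u v b w = (der u (\<theta> b v) x - der v (\<theta> b u) x) * \<omega> a b w x" for u v b w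
  define P where "P u v b c w = \<omega> a b u x * \<omega> b c v x * \<theta> c w x" for u v b c w
  have "(\<Sum>b\<in>UNIV. D u v b w + D v w b u + D w u b v - (E u v b w + E v w b u + E w u b v)) = 0"
    using der_structure[OF x, of u v a w] der_structure[OF x, of v w a u] der_structure[OF x, of w u a v]
      comm[of u v w] comm[of v w u] comm[of w u v]
    unfolding D_def E_def by (simp add: sum.distrib sum_subtractf algebra_simps)
  then have DE: "(\<Sum>b\<in>UNIV. D u v b w + D v w b u + D w u b v) = (\<Sum>b\<in>UNIV. E u v b w + E v w b u + E w u b v)"
    by (simp add: sum_subtractf)
  \<comment> \<open>Substituting the structure equation turns \<open>E\<close> into the cubic terms
    \<open>P\<close> that the quadratic part of the curvature also contributes; over the cyclic sum
    they occur with opposite signs.\<close>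
  have E: "E u v b w = (\<Sum>c\<in>UNIV. P w v b c u - P w u b c v)" for u v b w
    unfolding E_def P_def structure_eq[OF x]
    by (simp add: sum_distrib_left sum_distrib_right sum_subtractf algebra_simps sum_negf)
  have W: "(\<Sum>b\<in>UNIV. (\<Sum>c\<in>UNIV. \<omega> a c u x * \<omega> c b v x - \<omega> a c v x * \<omega> c b u x) * \<theta> b w x)
      = (\<Sum>b\<in>UNIV. \<Sum>c\<in>UNIV. P u v b c w - P v u b c w)" for u v w
    unfolding sum_distrib_right by (subst sum.swap) (simp add: P_def algebra_simps)
  have "(\<Sum>b\<in>UNIV. curvature \<omega> a b u v x * \<theta> b w x + curvature \<omega> a b v w x * \<theta> b u x
      + curvature \<omega> a b w u x * \<theta> b v x)
    = (\<Sum>b\<in>UNIV. D u v b w + D v w b u + D w u b v)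
      + (\<Sum>b\<in>UNIV. \<Sum>c\<in>UNIV. P u v b c w - P v u b c w) + (\<Sum>b\<in>UNIV. \<Sum>c\<in>UNIV. P v w b c u - P w v b c u)
      + (\<Sum>b\<in>UNIV. \<Sum>c\<in>UNIV. P w u b c v - P u w b c v)"
    unfolding W[symmetric] by (simp add: curvature_def D_def distrib_right sum.distrib)
  also have "\<dots> = 0"
    unfolding DE E by (simp add: sum.distrib sum_subtractf)
  finally show ?thesis .
qed

text \<open>Second derivatives of \<open>G\<close> commute. After the compatibility condition is
  inserted twice, the terms \<open>Q\<close> with one connection form on either slot of
  \<open>G\<close> occur in both orders of \<open>v\<close> and \<open>w\<close> and cancel; what
  remains is the curvature acting on each slot.\<close>

lemma curvature_metric_skew:
  assumes G: "\<And>b c. smooth_on (G b c) V"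
    and compat: "\<And>b c v x. x \<in> V \<Longrightarrow>
      der v (G b c) x = (\<Sum>f\<in>UNIV. \<omega> f b v x * G f c x + \<omega> f c v x * G b f x)"
    and x: "x \<in> V"
  shows "(\<Sum>f\<in>UNIV. curvature \<omega> f b v w x * G f c x + curvature \<omega> f c v w x * G b f x) = 0"
proof -
  have dG: "G b c differentiable at x" for b c
    using G x smooth_on_imp_differentiable by blast
  have dd: "der v (der w (G b c)) x = (\<Sum>f\<in>UNIV. \<omega> f b w x * der v (G f c) x + der v (\<omega> f b w) x * G f c x
      + \<omega> f c w x * der v (G b f) x + der v (\<omega> f c w) x * G b f x)" for v w
  proof -
    have "der v (der w (G b c)) x = der v (\<lambda>x. \<Sum>f\<in>UNIV. \<omega> f b w x * G f c x + \<omega> f c w x * G b f x) x"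
      using compat smooth_on_imp_differentiable[OF smooth_on_der[OF G] x] by (intro der_cong[OF _ open_V x])
    also have "\<dots> = (\<Sum>f\<in>UNIV. der v (\<lambda>x. \<omega> f b w x * G f c x + \<omega> f c w x * G b f x) x)"
      using x by (intro der_sum differentiable_add differentiable_mult dG differentiable_omega)
    finally show ?thesis
      using x by (simp add: der_add der_mult dG differentiable_mult differentiable_omega add.assoc)
  qed
  define P where "P b c v w f h = \<omega> f b v x * \<omega> h f w x * G h c x" for b c v w f h
  define Q where "Q v w f h = \<omega> f b v x * \<omega> h c w x * G f h x" for v w f h
  define P' where "P' v w f h = \<omega> f c v x * \<omega> h f w x * G b h x" for v w f h
  have 1: "(\<Sum>f\<in>UNIV. \<omega> f b w x * der v (G f c) x) = (\<Sum>f\<in>UNIV. \<Sum>h\<in>UNIV. P b c w v f h + Q w v f h)" for v w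
    unfolding compat[OF x] P_def Q_def by (simp add: sum_distrib_left algebra_simps)
  have 2: "(\<Sum>f\<in>UNIV. \<omega> f c w x * der v (G b f) x) = (\<Sum>f\<in>UNIV. \<Sum>h\<in>UNIV. Q v w f h + P' w v f h)" for v w
  proof -
    have "(\<Sum>f\<in>UNIV. \<omega> f c w x * der v (G b f) x)
        = (\<Sum>f\<in>UNIV. \<Sum>h\<in>UNIV. Q v w h f) + (\<Sum>f\<in>UNIV. \<Sum>h\<in>UNIV. P' w v f h)"
      unfolding compat[OF x] P'_def Q_def by (simp add: sum_distrib_left algebra_simps sum.distrib)
    also have "(\<Sum>f\<in>UNIV. \<Sum>h\<in>UNIV. Q v w h f) = (\<Sum>f\<in>UNIV. \<Sum>h\<in>UNIV. Q v w f h)" by (rule sum.swap)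
    finally show ?thesis by (simp add: sum.distrib)
  qed
  have 3: "(\<Sum>f\<in>UNIV. (\<Sum>h\<in>UNIV. \<omega> f h v x * \<omega> h b w x - \<omega> f h w x * \<omega> h b v x) * G f c x)
      = (\<Sum>f\<in>UNIV. \<Sum>h\<in>UNIV. P b c w v f h - P b c v w f h)"
    unfolding sum_distrib_right by (subst sum.swap) (simp add: P_def algebra_simps)
  have 4: "(\<Sum>f\<in>UNIV. (\<Sum>h\<in>UNIV. \<omega> f h v x * \<omega> h c w x - \<omega> f h w x * \<omega> h c v x) * G b f x)
      = (\<Sum>f\<in>UNIV. \<Sum>h\<in>UNIV. P' w v f h - P' v w f h)"
    unfolding sum_distrib_right by (subst sum.swap) (simp add: P'_def algebra_simps)
  have "0 = der v (der w (G b c)) x - der w (der v (G b c)) x"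
    using der_commute[OF open_V G x] by simp
  also have "\<dots> = (\<Sum>f\<in>UNIV. (der v (\<omega> f b w) x - der w (\<omega> f b v) x) * G f c x)
      + (\<Sum>f\<in>UNIV. (der v (\<omega> f c w) x - der w (\<omega> f c v) x) * G b f x)
      + (\<Sum>f\<in>UNIV. \<omega> f b w x * der v (G f c) x) - (\<Sum>f\<in>UNIV. \<omega> f b v x * der w (G f c) x)
      + (\<Sum>f\<in>UNIV. \<omega> f c w x * der v (G b f) x) - (\<Sum>f\<in>UNIV. \<omega> f c v x * der w (G b f) x)"
    unfolding dd by (simp add: sum.distrib sum_subtractf left_diff_distrib)
  also have "\<dots> = (\<Sum>f\<in>UNIV. curvature \<omega> f b v w x * G f c x + curvature \<omega> f c v w x * G b f x)"
    unfolding 1 2 curvature_def distrib_right sum.distrib 3 4 by (simp add: sum.distrib sum_subtractf)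
  finally show ?thesis by simp
qed

text \<open>\<open>Q\<close> is \<nabla>A - A \<otimes> A. Derivatives of \<theta> are eliminated by
  the structure equation, which is where torsion-freeness enters.\<close>

lemma curvature_projective_change:
  fixes A :: "'n \<Rightarrow> real^'n \<Rightarrow> real"
  assumes A: "\<And>b. smooth_on (A b) V"
    and omega': "\<And>a b u x. x \<in> V \<Longrightarrow>
      \<omega>' a b u x = \<omega> a b u x + delta a b * (\<Sum>c\<in>UNIV. A c x * \<theta> c u x) + A b x * \<theta> a u x"
    and x: "x \<in> V"
    and Q: "\<And>b v. Q b v = der v (A b) x - (\<Sum>c\<in>UNIV. A c x * \<omega> c b v x) - A b x * (\<Sum>c\<in>UNIV. A c x * \<theta> c v x)"
  shows "curvature \<omega>' a b v w x = curvature \<omega> a b v w x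
    + delta a b * (\<Sum>c\<in>UNIV. Q c v * \<theta> c w x - Q c w * \<theta> c v x) + Q b v * \<theta> a w x - Q b w * \<theta> a v x"
proof -
  define \<alpha> where "\<alpha> u = (\<Sum>c\<in>UNIV. A c x * \<theta> c u x)" for u
  define B where "B b u = (\<Sum>c\<in>UNIV. A c x * \<omega> c b u x)" for b u
  define T where "T a v w = (\<Sum>c\<in>UNIV. \<omega> a c v x * \<theta> c w x)" for a v w
  note dA = smooth_on_imp_differentiable[OF A x]
  note diff = dA differentiable_theta[OF x] differentiable_omega[OF x]
  have d: "der v (\<omega>' a b w) x = der v (\<omega> a b w) x
      + delta a b * (\<Sum>c\<in>UNIV. A c x * der v (\<theta> c w) x + der v (A c) x * \<theta> c w x)
      + A b x * der v (\<theta> a w) x + der v (A b) x * \<theta> a w x" for v w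
  proof -
    have "der v (\<omega>' a b w) x
        = der v (\<lambda>x. \<omega> a b w x + delta a b * (\<Sum>c\<in>UNIV. A c x * \<theta> c w x) + A b x * \<theta> a w x) x"
      using omega' by (intro der_cong[OF _ open_V x, symmetric] differentiable_add differentiable_mult
          differentiable_sum ballI diff) auto
    also have "\<dots> = der v (\<omega> a b w) x + delta a b * der v (\<lambda>x. \<Sum>c\<in>UNIV. A c x * \<theta> c w x) x
        + der v (\<lambda>x. A b x * \<theta> a w x) x"
      by (simp add: der_add der_mult differentiable_add differentiable_mult differentiable_sum diff)
    also have "der v (\<lambda>x. \<Sum>c\<in>UNIV. A c x * \<theta> c w x) x = (\<Sum>c\<in>UNIV. der v (\<lambda>x. A c x * \<theta> c w x) x)"
      by (intro der_sum differentiable_mult diff)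
    finally show ?thesis by (simp add: der_mult diff)
  qed
  have struct: "der v (\<theta> c w) x = der w (\<theta> c v) x - T c v w + T c w v" for c
    using structure_eq[OF x, of v c w] by (simp add: T_def sum_subtractf)
  have AT: "(\<Sum>c\<in>UNIV. A c x * T c v w) = (\<Sum>c\<in>UNIV. B c v * \<theta> c w x)" for v w
    unfolding T_def B_def sum_distrib_left sum_distrib_right by (subst sum.swap) (simp add: mult.assoc)
  have omega'': "\<omega>' a b u x = \<omega> a b u x + delta a b * \<alpha> u + A b x * \<theta> a u x" for a b u
    unfolding \<alpha>_def by (rule omega'[OF x])
  \<comment> \<open>Only one order of the arguments is expanded. Terms symmetric in \<open>v\<close>
    and \<open>w\<close> disappear when the exchanged sum is subtracted at the end.\<close>
  have wedge: "(\<Sum>c\<in>UNIV. \<omega>' a c v x * \<omega>' c b w x) = (\<Sum>c\<in>UNIV. \<omega> a c v x * \<omega> c b w x)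
      + \<omega> a b v x * \<alpha> w + A b x * T a v w + \<alpha> v * \<omega> a b w x + delta a b * \<alpha> v * \<alpha> w
      + \<alpha> v * A b x * \<theta> a w x + \<theta> a v x * B b w + 2 * A b x * \<theta> a v x * \<alpha> w" for v w
  proof -
    have "(\<Sum>c\<in>UNIV. \<omega>' a c v x * \<omega>' c b w x) = (\<Sum>c\<in>UNIV. \<omega> a c v x * \<omega> c b w x)
        + (\<Sum>c\<in>UNIV. delta c b * (\<omega> a c v x * \<alpha> w)) + A b x * (\<Sum>c\<in>UNIV. \<omega> a c v x * \<theta> c w x)
        + (\<Sum>c\<in>UNIV. delta a c * (\<alpha> v * \<omega> c b w x)) + (\<Sum>c\<in>UNIV. delta a c * (delta c b * \<alpha> v * \<alpha> w))
        + (\<Sum>c\<in>UNIV. delta a c * (\<alpha> v * A b x * \<theta> c w x))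
        + \<theta> a v x * (\<Sum>c\<in>UNIV. A c x * \<omega> c b w x) + (\<Sum>c\<in>UNIV. delta c b * (\<theta> a v x * A c x * \<alpha> w))
        + A b x * \<theta> a v x * (\<Sum>c\<in>UNIV. A c x * \<theta> c w x)"
      unfolding omega'' sum_distrib_left sum.distrib[symmetric]
      by (rule sum.cong) (simp_all add: algebra_simps)
    then show ?thesis
      unfolding sum_delta_mult \<alpha>_def[symmetric] B_def[symmetric] T_def[symmetric]
      by (simp add: algebra_simps)
  qed
  have Q': "Q c v = der v (A c) x - B c v - A c x * \<alpha> v" for c v
    by (simp add: Q B_def \<alpha>_def)
  have sum_Q: "(\<Sum>c\<in>UNIV. Q c v * \<theta> c w x) = (\<Sum>c\<in>UNIV. der v (A c) x * \<theta> c w x)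
      - (\<Sum>c\<in>UNIV. B c v * \<theta> c w x) - \<alpha> v * \<alpha> w" for v w
  proof -
    have "(\<Sum>c\<in>UNIV. A c x * \<alpha> v * \<theta> c w x) = \<alpha> v * \<alpha> w"
      by (simp add: \<alpha>_def[of w] sum_distrib_left mult_ac)
    then show ?thesis unfolding Q' by (simp add: left_diff_distrib sum_subtractf)
  qed
  have sumd: "(\<Sum>c\<in>UNIV. A c x * der v (\<theta> c w) x) = (\<Sum>c\<in>UNIV. A c x * der w (\<theta> c v) x)
      - (\<Sum>c\<in>UNIV. B c v * \<theta> c w x) + (\<Sum>c\<in>UNIV. B c w * \<theta> c v x)"
    unfolding struct AT[symmetric] by (simp add: algebra_simps sum.distrib sum_subtractf)
  show ?thesis
    unfolding curvature_def d sum_subtractf wedge sum.distrib sum_Q sumd struct[of a] Q'[of b]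
    by (simp add: algebra_simps)
qed

end


section \<open>Local frames on a manifold\<close>

context
  fixes \<A> :: "('a::{t2_space, second_countable_topology}, 'n::finite) chart set"
  assumes atlas: "smooth_atlas \<A>"
begin

lemma is_chart: "c \<in> \<A> \<Longrightarrow> is_chart c"
  using atlas by (simp add: smooth_atlas_def)

lemma inv_coord_coord: "c \<in> \<A> \<Longrightarrow> p \<in> chart_dom c \<Longrightarrow> inv_coord c (coord c p) = p"
  using is_chart unfolding is_chart_def homeomorphism_def by blast

lemma open_coord_image:
  assumes "c \<in> \<A>" "open U"
  shows "open (coord c ` (chart_dom c \<inter> U))"
proof -
  have h: "homeomorphism (chart_dom c) (coord c ` chart_dom c) (coord c) (inv_coord c)"
    and o: "open (coord c ` chart_dom c)"
    using is_chart[OF assms(1)] by (auto simp: is_chart_def)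
  have "openin (top_of_set (coord c ` chart_dom c)) (coord c ` (chart_dom c \<inter> U))"
    by (rule homeomorphism_imp_open_map[OF h]) (use assms(2) in \<open>auto simp: openin_open\<close>)
  then show ?thesis using o by (simp add: openin_open_eq)
qed

lemma open_chart_dom: "c \<in> \<A> \<Longrightarrow> open (chart_dom c)"
  using is_chart by (simp add: is_chart_def)

lemma transition_has_derivative:
  assumes "c \<in> \<A>" "d \<in> \<A>" "p \<in> chart_dom c" "p \<in> chart_dom d"
  shows "((coord d \<circ> inv_coord c) has_derivative
    frechet_derivative (coord d \<circ> inv_coord c) (at (coord c p))) (at (coord c p))"
proof -
  have "smooth_on (coord d \<circ> inv_coord c) (coord c ` (chart_dom c \<inter> chart_dom d))"
    using atlas assms by (simp add: smooth_atlas_def)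
  then have "(coord d \<circ> inv_coord c) differentiable at (coord c p)"
    using assms by (intro smooth_on_imp_differentiable) auto
  then show ?thesis by (simp add: frechet_derivative_works)
qed

lemma transition_self:
  assumes "c \<in> \<A>" "p \<in> chart_dom c"
  shows "frechet_derivative (coord c \<circ> inv_coord c) (at (coord c p)) u = u"
proof -
  have "((coord c \<circ> inv_coord c) has_derivative (\<lambda>u. u)) (at (coord c p))"
  proof (rule has_derivative_transform_within_open[OF has_derivative_ident open_coord_image[OF assms(1) open_UNIV]])
    show "coord c p \<in> coord c ` (chart_dom c \<inter> UNIV)" using assms by auto
    show "x = (coord c \<circ> inv_coord c) x" if "x \<in> coord c ` (chart_dom c \<inter> UNIV)" for x
      using that inv_coord_coord[OF assms(1)] by auto
  qed
  from frechet_derivative_at[OF this] show ?thesis by metis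
qed

text \<open>The chain rule through the transition map. For a real function \<open>f\<close> it makes
  \<open>dir_deriv\<close> independent of the chart; for a coordinate map \<open>f\<close> it is the
  cocycle rule for Jacobians.\<close>

lemma chart_change_has_derivative:
  assumes "c \<in> \<A>" "d \<in> \<A>" "p \<in> chart_dom c" "p \<in> chart_dom d"
    and f: "((f \<circ> inv_coord d) has_derivative f') (at (coord d p))"
  shows "((f \<circ> inv_coord c) has_derivative
    (\<lambda>u. f' (frechet_derivative (coord d \<circ> inv_coord c) (at (coord c p)) u))) (at (coord c p))"
proof -
  have f': "((f \<circ> inv_coord d) has_derivative f') (at ((coord d \<circ> inv_coord c) (coord c p)))"
    using f inv_coord_coord assms by simp
  have "((\<lambda>x. (f \<circ> inv_coord d) ((coord d \<circ> inv_coord c) x)) has_derivative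
    (\<lambda>u. f' (frechet_derivative (coord d \<circ> inv_coord c) (at (coord c p)) u))) (at (coord c p))"
    by (rule has_derivative_compose[OF transition_has_derivative[OF assms(1-4)] f'])
  then show ?thesis
  proof (rule has_derivative_transform_within_open)
    show "open (coord c ` (chart_dom c \<inter> chart_dom d))"
      by (rule open_coord_image[OF assms(1) open_chart_dom[OF assms(2)]])
    show "coord c p \<in> coord c ` (chart_dom c \<inter> chart_dom d)" using assms by blast
    show "(f \<circ> inv_coord d) ((coord d \<circ> inv_coord c) x) = (f \<circ> inv_coord c) x"
      if "x \<in> coord c ` (chart_dom c \<inter> chart_dom d)" for x
      using that assms(1,2) by (elim imageE) (simp add: inv_coord_coord)
  qed
qed

lemma transition_compose:
  assumes "c \<in> \<A>" "d \<in> \<A>" "e \<in> \<A>" "p \<in> chart_dom c" "p \<in> chart_dom d" "p \<in> chart_dom e"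
  shows "frechet_derivative (coord e \<circ> inv_coord d) (at (coord d p))
      (frechet_derivative (coord d \<circ> inv_coord c) (at (coord c p)) u)
    = frechet_derivative (coord e \<circ> inv_coord c) (at (coord c p)) u"
  using frechet_derivative_at[OF chart_change_has_derivative[OF assms(1,2,4,5)
        transition_has_derivative[OF assms(2,3,5,6)]]]
  by (auto dest: fun_cong)

lemma tangent_transition:
  "v \<in> tangent_space \<A> p \<Longrightarrow> c \<in> \<A> \<Longrightarrow> d \<in> \<A> \<Longrightarrow> p \<in> chart_dom c \<Longrightarrow> p \<in> chart_dom d \<Longrightarrow>
    v d = frechet_derivative (coord d \<circ> inv_coord c) (at (coord c p)) (v c)"
  unfolding tangent_space_def by blast

lemma tangent_outside: "v \<in> tangent_space \<A> p \<Longrightarrow> \<not> (c \<in> \<A> \<and> p \<in> chart_dom c) \<Longrightarrow> v c = 0"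
  unfolding tangent_space_def by blast

text \<open>The Jacobians recover all components from a single one, and at the remaining charts both
  vectors are zero. Equations between tangent vectors can thus be checked in one chart.\<close>

lemma tangent_eqI:
  assumes "v \<in> tangent_space \<A> p" "w \<in> tangent_space \<A> p" "c \<in> \<A>" "p \<in> chart_dom c" "v c = w c"
  shows "v = w"
proof
  fix d
  show "v d = w d"
  proof (cases "d \<in> \<A> \<and> p \<in> chart_dom d")
    case True
    then show ?thesis using assms tangent_transition by metis
  next
    case False
    then show ?thesis using assms tangent_outside by metis
  qed
qed

lemma const_field_apply: "c \<in> \<A> \<Longrightarrow> p \<in> chart_dom c \<Longrightarrow> const_field \<A> c u p c = u"
  by (simp add: const_field_def transition_self)

lemma const_field_tangent:
  assumes "c \<in> \<A>" "p \<in> chart_dom c"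
  shows "const_field \<A> c u p \<in> tangent_space \<A> p"
  unfolding tangent_space_def
proof (intro CollectI conjI allI impI ballI)
  fix d e assume "d \<in> \<A>" "e \<in> \<A>" "p \<in> chart_dom d \<inter> chart_dom e"
  then show "const_field \<A> c u p e
      = frechet_derivative (coord e \<circ> inv_coord d) (at (coord d p)) (const_field \<A> c u p d)"
    using transition_compose[OF assms(1) _ _ assms(2)] by (simp add: const_field_def)
qed (auto simp: const_field_def)

lemma const_field_eq:
  assumes "c \<in> \<A>" "p \<in> chart_dom c" "v \<in> tangent_space \<A> p"
  shows "const_field \<A> c (v c) p = v"
  using tangent_eqI[OF const_field_tangent assms(3)] const_field_apply assms by blast

lemma tangent_sum:
  fixes I :: "'i set"
  assumes "\<And>i. i \<in> I \<Longrightarrow> Y i \<in> tangent_space \<A> p"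
  shows "(\<lambda>c. \<Sum>i\<in>I. k i *\<^sub>R Y i c) \<in> tangent_space \<A> p"
  unfolding tangent_space_def
proof (intro CollectI conjI allI impI ballI)
  fix c assume "\<not> (c \<in> \<A> \<and> p \<in> chart_dom c)"
  then have "Y i c = 0" if "i \<in> I" for i
    using tangent_outside[OF assms[OF that]] by blast
  then show "(\<Sum>i\<in>I. k i *\<^sub>R Y i c) = 0" by simp
next
  fix c d assume cd: "c \<in> \<A>" "d \<in> \<A>" "p \<in> chart_dom c \<inter> chart_dom d"
  let ?J = "frechet_derivative (coord d \<circ> inv_coord c) (at (coord c p))"
  have "linear ?J"
    using transition_has_derivative[of c d p] cd has_derivative_linear by blast
  moreover have "Y i d = ?J (Y i c)" if "i \<in> I" for i
    using tangent_transition[OF assms[OF that]] cd by blast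
  ultimately show "(\<Sum>i\<in>I. k i *\<^sub>R Y i d) = ?J (\<Sum>i\<in>I. k i *\<^sub>R Y i c)"
    by (simp add: linear_sum linear_cmul)
qed

lemma tangent_linear_sum:
  fixes I :: "'i set"
  assumes L: "tangent_linear \<A> p L" and "finite I" "\<And>i. i \<in> I \<Longrightarrow> Y i \<in> tangent_space \<A> p"
  shows "L (\<lambda>c. \<Sum>i\<in>I. k i *\<^sub>R Y i c) = (\<Sum>i\<in>I. k i * L (Y i))"
proof -
  have add: "L (\<lambda>c. v c + w c) = L v + L w"
    if "v \<in> tangent_space \<A> p" "w \<in> tangent_space \<A> p" for v w
    using L that unfolding tangent_linear_def by blast
  have scale: "L (\<lambda>c. r *\<^sub>R v c) = r * L v" if "v \<in> tangent_space \<A> p" for r v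
    using L that unfolding tangent_linear_def by blast
  show ?thesis using assms(2,3)
  proof (induction I rule: finite_induct)
    case empty
    have "(\<lambda>c. 0) \<in> tangent_space \<A> p" using tangent_sum[of "{}"] by simp
    from scale[OF this, of 0] show ?case by simp
  next
    case (insert i I)
    have "(\<lambda>c. k i *\<^sub>R Y i c) \<in> tangent_space \<A> p" using tangent_sum[of "{i}" Y p k] insert.prems by simp
    moreover have "(\<lambda>c. \<Sum>i\<in>I. k i *\<^sub>R Y i c) \<in> tangent_space \<A> p"
      by (rule tangent_sum) (simp add: insert.prems)
    ultimately show ?case using insert by (simp add: add scale)
  qed
qed

lemma dir_deriv_eq_der:
  assumes c: "c \<in> \<A>" "p \<in> chart_dom c" and v: "v \<in> tangent_space \<A> p"
    and f: "(f \<circ> inv_coord c) differentiable at (coord c p)"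
  shows "dir_deriv \<A> p v f = der (v c) (f \<circ> inv_coord c) (coord c p)"
proof -
  let ?d = "chart_at \<A> p"
  have d: "?d \<in> \<A>" "p \<in> chart_dom ?d"
    using c someI[of "\<lambda>c. c \<in> \<A> \<and> p \<in> chart_dom c"] unfolding chart_at_def by blast+
  have "((f \<circ> inv_coord c) has_derivative frechet_derivative (f \<circ> inv_coord c) (at (coord c p))) (at (coord c p))"
    using f by (simp add: frechet_derivative_works)
  from frechet_derivative_at[OF chart_change_has_derivative[OF d(1) c(1) d(2) c(2) this]]
  have "dir_deriv \<A> p v f = frechet_derivative (f \<circ> inv_coord c) (at (coord c p))
      (frechet_derivative (coord c \<circ> inv_coord ?d) (at (coord ?d p)) (v ?d))"
    unfolding dir_deriv_def Let_def by (rule fun_cong[symmetric])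
  moreover have "frechet_derivative (coord c \<circ> inv_coord ?d) (at (coord ?d p)) (v ?d) = v c"
    by (rule tangent_transition[OF v d(1) c(1) d(2) c(2), symmetric])
  ultimately show ?thesis by (simp add: der_def)
qed

end

text \<open>The frame is read in the chart \<open>c\<close>: over the open set \<open>V\<close> of
  coordinates its coframe and connection forms become functions of a constant vector and a point,
  the setting of \<open>moving_frame\<close>. The locale is later instantiated with the chart that
  \<open>chart_at\<close> picks at the point of interest.\<close>

locale chart_frame =
  fixes \<A> :: "('a::{t2_space, second_countable_topology}, 'n::finite) chart set"
    and c :: "('a, 'n) chart" and U :: "'a set" and X :: "'n \<Rightarrow> ('a, 'n) vfield"
  assumes atlas: "smooth_atlas \<A>" and chart: "c \<in> \<A>" and frame: "local_frame \<A> U X"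
begin

definition V :: "(real^'n) set" where "V = coord c ` (chart_dom c \<inter> U)"
definition pt :: "real^'n \<Rightarrow> 'a" where "pt x = inv_coord c x"
definition \<xi> :: "'n \<Rightarrow> real^'n \<Rightarrow> real^'n" where "\<xi> a x = X a (pt x) c"
definition \<theta> :: "'n \<Rightarrow> real^'n \<Rightarrow> real^'n \<Rightarrow> real" where
  "\<theta> a u x = coframe X a (pt x) (const_field \<A> c u (pt x))"
definition \<omega> :: "('a, 'n) connection \<Rightarrow> 'n \<Rightarrow> 'n \<Rightarrow> real^'n \<Rightarrow> real^'n \<Rightarrow> real" where
  "\<omega> D a b u x = conn_form D X a b (pt x) (const_field \<A> c u (pt x))"

lemma open_in_U: "open_in \<A> U" and field_X: "vector_field \<A> U (X a)"
  using frame by (auto simp: local_frame_def)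

lemma open_V: "open V"
  unfolding V_def using open_coord_image[OF atlas chart] open_in_U by (simp add: open_in_def)

lemma pt_V:
  assumes "x \<in> V"
  shows "pt x \<in> U" "pt x \<in> chart_dom c" "coord c (pt x) = x"
  using assms inv_coord_coord[OF atlas chart] by (auto simp: V_def pt_def)

lemma pt_coord: "p \<in> chart_dom c \<Longrightarrow> pt (coord c p) = p"
  unfolding pt_def by (rule inv_coord_coord[OF atlas chart])

lemma field_tangent: "vector_field \<A> U Y \<Longrightarrow> p \<in> U \<Longrightarrow> Y p \<in> tangent_space \<A> p"
  by (simp add: vector_field_def)

lemma frame_unique:
  assumes "p \<in> U" "v \<in> tangent_space \<A> p"
  shows "\<exists>!k::real^'n. v = (\<lambda>c. \<Sum>a\<in>UNIV. (k $ a) *\<^sub>R X a p c)"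
  using frame assms unfolding local_frame_def by blast

lemma coframe_expansion:
  assumes "p \<in> U" "v \<in> tangent_space \<A> p"
  shows "v = (\<lambda>c. \<Sum>a\<in>UNIV. coframe X a p v *\<^sub>R X a p c)"
  unfolding coframe_def by (rule theI'[OF frame_unique[OF assms]])

text \<open>The expansion behind \<open>coframe\<close> is an equation in all charts at once;
  \<open>tangent_eqI\<close> reduces it to the chart \<open>c\<close>, where it can be
  computed.\<close>

lemma coframe_eqI:
  assumes "p \<in> U" "v \<in> tangent_space \<A> p" "p \<in> chart_dom c" "v c = (\<Sum>a\<in>UNIV. k a *\<^sub>R X a p c)"
  shows "coframe X a p v = k a"
proof -
  have "v = (\<lambda>c. \<Sum>a\<in>UNIV. k a *\<^sub>R X a p c)"
    using assms by (intro tangent_eqI[OF atlas _ _ chart]) (auto intro!: tangent_sum[OF atlas] field_tangent field_X)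
  then have v: "v = (\<lambda>c. \<Sum>a\<in>UNIV. ((\<chi> a. k a) $ a) *\<^sub>R X a p c)" by simp
  have "(THE k::real^'n. v = (\<lambda>c. \<Sum>a\<in>UNIV. (k $ a) *\<^sub>R X a p c)) = (\<chi> a. k a)"
    by (rule the1_equality[OF frame_unique[OF assms(1,2)] v])
  then show ?thesis by (simp add: coframe_def)
qed

lemma theta_tangent:
  assumes "x \<in> V" "v \<in> tangent_space \<A> (pt x)"
  shows "coframe X a (pt x) v = \<theta> a (v c) x"
  unfolding \<theta>_def using const_field_eq[OF atlas chart pt_V(2)[OF assms(1)] assms(2)] by simp

lemma theta_expansion:
  assumes "x \<in> V"
  shows "u = (\<Sum>a\<in>UNIV. \<theta> a u x *\<^sub>R \<xi> a x)"
proof -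
  note t = const_field_tangent[OF atlas chart pt_V(2)[OF assms], of u]
  have "u = const_field \<A> c u (pt x) c" using const_field_apply[OF atlas chart pt_V(2)[OF assms]] by simp
  also have "\<dots> = (\<Sum>a\<in>UNIV. \<theta> a u x *\<^sub>R \<xi> a x)"
    unfolding \<theta>_def \<xi>_def by (rule fun_cong[OF coframe_expansion[OF pt_V(1)[OF assms] t]])
  finally show ?thesis .
qed

lemma theta_eqI:
  assumes "x \<in> V" "u = (\<Sum>a\<in>UNIV. k a *\<^sub>R \<xi> a x)"
  shows "\<theta> a u x = k a"
  unfolding \<theta>_def using assms pt_V[OF assms(1)] const_field_apply[OF atlas chart] const_field_tangent[OF atlas chart]
  by (intro coframe_eqI) (auto simp: \<xi>_def)

lemma linear_theta:
  assumes "x \<in> V"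
  shows "linear (\<lambda>u. \<theta> a u x)"
proof
  show "\<theta> a (u + w) x = \<theta> a u x + \<theta> a w x" for u w
    by (rule theta_eqI[OF assms, of _ "\<lambda>a. \<theta> a u x + \<theta> a w x"])
      (use theta_expansion[OF assms, of u] theta_expansion[OF assms, of w] in
        \<open>simp add: scaleR_left_distrib sum.distrib\<close>)
  show "\<theta> a (r *\<^sub>R u) x = r *\<^sub>R \<theta> a u x" for r u
    by (rule theta_eqI[OF assms, of _ "\<lambda>a. r *\<^sub>R \<theta> a u x"])
      (use arg_cong[OF theta_expansion[OF assms, of u], of "(*\<^sub>R) r"] in \<open>simp add: scaleR_sum_right\<close>)
qed

lemma theta_xi: "x \<in> V \<Longrightarrow> \<theta> a (\<xi> b x) x = delta a b"
  by (rule theta_eqI[where k = "\<lambda>a. delta a b"])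
    (simp_all add: delta_def if_distrib[of "\<lambda>r. r *\<^sub>R _"] cong: if_cong)

lemma smooth_field: "vector_field \<A> U Y \<Longrightarrow> smooth_on (\<lambda>x. Y (pt x) c) V"
  using chart by (simp add: vector_field_def V_def pt_def)

lemma smooth_xi: "smooth_on (\<xi> a) V"
  unfolding \<xi>_def[abs_def] by (rule smooth_field[OF field_X])

text \<open>By Cramer's rule.\<close>

lemma smooth_theta_field:
  assumes y: "smooth_on y V"
  shows "smooth_on (\<lambda>x. \<theta> a (y x) x) V"
proof -
  define E :: "real^'n \<Rightarrow> real^'n^'n" where "E x = (\<chi> i b. \<xi> b x $ i)" for x
  define F :: "real^'n \<Rightarrow> real^'n^'n" where "F x = (\<chi> i j. if j = a then y x $ i else E x $ i $ j)" for x
  have E: "E x *v (\<chi> b. \<theta> b u x) = u" if "x \<in> V" for x u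
    by (subst (2) theta_expansion[OF that, of u]) (simp add: vec_eq_iff E_def matrix_vector_mult_def mult.commute)
  have detE: "det (E x) \<noteq> 0" if "x \<in> V" for x
  proof -
    have "surj ((*v) (E x))" using E[OF that] by (metis surj_def)
    then show ?thesis
      using matrix_right_invertible_surjective invertible_det_nz invertible_right_inverse by blast
  qed
  have xi: "smooth_on (\<lambda>x. \<xi> b x $ i) V" for b i
    by (rule smooth_on_nth[OF open_V smooth_xi])
  have smE: "smooth_on (\<lambda>x. det (E x)) V"
    by (rule smooth_on_det[OF open_V]) (simp add: E_def xi)
  have smF: "smooth_on (\<lambda>x. det (F x)) V"
  proof (rule smooth_on_det[OF open_V])
    show "smooth_on (\<lambda>x. F x $ i $ j) V" for i j
      using smooth_on_nth[OF open_V y] xi by (cases "j = a") (simp_all add: F_def E_def)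
  qed
  have eq: "det (F x) * inverse (det (E x)) = \<theta> a (y x) x" if "x \<in> V" for x
  proof -
    have "(\<chi> b. \<theta> b (y x) x)
        = (\<chi> k. det (\<chi> i j. if j = k then y x $ i else E x $ i $ j) / det (E x))"
      using cramer[OF detE[OF that], of "\<chi> b. \<theta> b (y x) x" "y x"] E[OF that] by blast
    then have "(\<chi> b. \<theta> b (y x) x) $ a
        = (\<chi> k. det (\<chi> i j. if j = k then y x $ i else E x $ i $ j) / det (E x)) $ a"
      by (rule arg_cong)
    then show ?thesis by (simp add: F_def divide_inverse)
  qed
  show ?thesis
    by (rule smooth_on_cong[OF open_V eq smooth_on_mult[OF open_V smF smooth_on_inverse[OF open_V detE smE]]])
qed

lemma smooth_theta: "smooth_on (\<theta> a u) V"
  using smooth_theta_field[OF smooth_on_const] by simp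

lemma omega_eq: "\<omega> D a b u x = (\<Sum>e\<in>UNIV. conn_coeff D X a b e (pt x) * \<theta> e u x)"
  by (simp add: \<omega>_def conn_form_def \<theta>_def)

lemma omega_tangent:
  assumes "x \<in> V" "v \<in> tangent_space \<A> (pt x)"
  shows "conn_form D X a b (pt x) v = \<omega> D a b (v c) x"
  unfolding \<omega>_def using const_field_eq[OF atlas chart pt_V(2)[OF assms(1)] assms(2)] by simp

section \<open>Connection forms and the structure equation\<close>

context
  fixes D assumes D: "torsion_free_connection \<A> D"
begin

lemma field_D: "vector_field \<A> U (D (X a) (X b))"
proof -
  have "affine_connection \<A> D" using D unfolding torsion_free_connection_def by blast
  from this[unfolded affine_connection_def, THEN spec, THEN mp, OF open_in_U, THEN conjunct1]
  show ?thesis using field_X by blast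
qed

lemma conn_coeff_eq: "x \<in> V \<Longrightarrow> conn_coeff D X a b e (pt x) = \<theta> a (D (X e) (X b) (pt x) c) x"
  unfolding conn_coeff_def using theta_tangent field_tangent[OF field_D] pt_V by blast

lemma smooth_omega: "smooth_on (\<omega> D a b u) V"
proof (rule smooth_on_cong[OF open_V])
  show "(\<Sum>e\<in>UNIV. \<theta> a (D (X e) (X b) (pt x) c) x * \<theta> e u x) = \<omega> D a b u x" if "x \<in> V" for x
    unfolding omega_eq using conn_coeff_eq[OF that] by simp
  show "smooth_on (\<lambda>x. \<Sum>e\<in>UNIV. \<theta> a (D (X e) (X b) (pt x) c) x * \<theta> e u x) V"
    by (intro smooth_on_sum[OF open_V] smooth_on_mult[OF open_V] smooth_theta smooth_theta_field
        smooth_field field_D)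
qed

lemma torsion_xi:
  assumes "x \<in> V"
  shows "der (\<xi> e x) (\<xi> f) x - der (\<xi> f x) (\<xi> e) x = D (X e) (X f) (pt x) c - D (X f) (X e) (pt x) c"
proof -
  have "(\<lambda>c. D (X e) (X f) (pt x) c - D (X f) (X e) (pt x) c) = lie_bracket \<A> (X e) (X f) (pt x)"
    using D open_in_U field_X pt_V[OF assms] unfolding torsion_free_connection_def by blast
  then have "D (X e) (X f) (pt x) c - D (X f) (X e) (pt x) c = lie_bracket \<A> (X e) (X f) (pt x) c"
    by (rule fun_cong)
  then show ?thesis
    using pt_V[OF assms] chart by (simp add: lie_bracket_def \<xi>_def[abs_def] der_def pt_def)
qed

lemma der_theta_linear:
  assumes "x \<in> V"
  shows "linear (\<lambda>u. der v (\<theta> a u) x)"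
proof
  have d: "\<theta> a u differentiable at x" for u
    using smooth_theta smooth_on_imp_differentiable assms by blast
  show "der v (\<theta> a (u + w)) x = der v (\<theta> a u) x + der v (\<theta> a w) x" for u w
    using linear_add[OF linear_theta]
    by (subst der_add[OF d d, symmetric]) (intro der_cong[OF d open_V assms])
  show "der v (\<theta> a (r *\<^sub>R u)) x = r *\<^sub>R der v (\<theta> a u) x" for r u
  proof -
    have "der v (\<theta> a (r *\<^sub>R u)) x = der v (\<lambda>x. r * \<theta> a u x) x"
      using linear_cmul[OF linear_theta] by (intro der_cong[OF d open_V assms]) simp
    also have "\<dots> = r * der v (\<theta> a u) x" by (subst der_mult) (simp_all add: d)
    finally show ?thesis by simp
  qed
qed

text \<open>The pairing of coframe and frame is constant, so the product rule relates the derivative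
  of the form, its argument frozen at \<open>\<xi> b x\<close>, to the derivative of the
  vector.\<close>

lemma der_theta_xi:
  assumes x: "x \<in> V"
  shows "der v (\<theta> a (\<xi> b x)) x = - \<theta> a (der v (\<xi> b) x) x"
proof -
  let ?e = "\<lambda>i. axis i 1 :: real^'n"
  have dt: "\<theta> a u differentiable at x" for u
    using smooth_theta smooth_on_imp_differentiable x by blast
  have dx: "\<xi> b differentiable at x" using smooth_xi smooth_on_imp_differentiable x by blast
  have dxi: "(\<lambda>x. \<xi> b x $ i) differentiable at x" for i
    using smooth_on_nth[OF open_V smooth_xi] smooth_on_imp_differentiable x by blast
  have di: "der v (\<lambda>x. \<xi> b x $ i) x = der v (\<xi> b) x $ i" for i
    using dx by (intro der_eqI bounded_linear.has_derivative[OF bounded_linear_vec_nth])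
      (simp add: der_def frechet_derivative_works)
  have exp: "u = (\<Sum>i\<in>UNIV. (u $ i) *\<^sub>R ?e i)" for u :: "real^'n"
    by (simp add: vec_eq_iff axis_def if_distrib cong: if_cong)
  have lin: "L u = (\<Sum>i\<in>UNIV. (u $ i) * L (?e i))" if "linear L" for L :: "real^'n \<Rightarrow> real" and u
    by (subst exp) (simp add: linear_sum[OF that] linear_cmul[OF that])
  \<comment> \<open>The point enters both the form and its argument. Expanding the argument in the
    standard basis gives a sum of products, in which the forms have constant arguments.\<close>
  have "der v (\<lambda>x. \<Sum>i\<in>UNIV. \<xi> b x $ i * \<theta> a (?e i) x) x = der v (\<lambda>x. delta a b) x"
    by (rule der_cong[OF _ open_V x])
      (auto simp: theta_xi[symmetric] lin[OF linear_theta, of _ _ "\<xi> b _"]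
        intro!: differentiable_sum differentiable_mult dt dxi)
  then have "(\<Sum>i\<in>UNIV. \<xi> b x $ i * der v (\<theta> a (?e i)) x + der v (\<xi> b) x $ i * \<theta> a (?e i) x) = 0"
    by (simp add: der_sum der_mult differentiable_mult dt dxi di)
  then show ?thesis
    unfolding lin[OF der_theta_linear[OF x], of _ _ "\<xi> b x"] lin[OF linear_theta[OF x], of _ "der v (\<xi> b) x"]
    by (simp add: sum.distrib)
qed

lemma bilinear_frame_expansion:
  fixes F :: "real^'n \<Rightarrow> real^'n \<Rightarrow> real"
  assumes x: "x \<in> V" and "\<And>w. linear (\<lambda>v. F v w)" "\<And>v. linear (F v)"
  shows "F v w = (\<Sum>e\<in>UNIV. \<Sum>f\<in>UNIV. \<theta> e v x * \<theta> f w x * F (\<xi> e x) (\<xi> f x))"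
proof -
  have "F v w = (\<Sum>e\<in>UNIV. \<theta> e v x * F (\<xi> e x) w)"
    by (subst theta_expansion[OF x, of v]) (simp add: linear_sum[OF assms(2)] linear_cmul[OF assms(2)])
  also have "\<dots> = (\<Sum>e\<in>UNIV. \<theta> e v x * (\<Sum>f\<in>UNIV. \<theta> f w x * F (\<xi> e x) (\<xi> f x)))"
    by (subst theta_expansion[OF x, of w]) (simp add: linear_sum[OF assms(3)] linear_cmul[OF assms(3)])
  finally show ?thesis by (simp add: sum_distrib_left mult.assoc)
qed

text \<open>By bilinearity in \<open>v\<close> and \<open>w\<close> the frame vectors suffice. On
  them d\<theta> is minus \<theta> of the bracket, as the pairings are constant, and
  torsion-freeness makes the bracket a difference of covariant derivatives.\<close>

lemma structure_equation:
  assumes x: "x \<in> V"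
  shows "der v (\<theta> a w) x - der w (\<theta> a v) x
    = - (\<Sum>b\<in>UNIV. \<omega> D a b v x * \<theta> b w x - \<omega> D a b w x * \<theta> b v x)"
proof -
  define F where "F v w = der v (\<theta> a w) x - der w (\<theta> a v) x" for v w
  have dt: "\<theta> a u differentiable at x" for u
    using smooth_theta smooth_on_imp_differentiable x by blast
  have lin: "linear (\<lambda>v. F v w)" "linear (F v)" for v w
    unfolding F_def by (intro linear_compose_sub der_linear der_theta_linear x dt)+
  have F: "F (\<xi> e x) (\<xi> f x) = conn_coeff D X a e f (pt x) - conn_coeff D X a f e (pt x)" for e f
  proof -
    have "F (\<xi> e x) (\<xi> f x) = - \<theta> a (der (\<xi> e x) (\<xi> f) x - der (\<xi> f x) (\<xi> e) x) x"
      unfolding F_def der_theta_xi[OF x] linear_diff[OF linear_theta[OF x]] by simp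
    then show ?thesis
      unfolding torsion_xi[OF x] linear_diff[OF linear_theta[OF x]] conn_coeff_eq[OF x] by simp
  qed
  have om: "(\<Sum>b\<in>UNIV. \<omega> D a b v x * \<theta> b w x)
      = (\<Sum>f\<in>UNIV. \<Sum>e\<in>UNIV. \<theta> e v x * \<theta> f w x * conn_coeff D X a f e (pt x))" for v w
    by (simp add: omega_eq sum_distrib_left sum_distrib_right mult_ac)
  have "F v w = (\<Sum>e\<in>UNIV. \<Sum>f\<in>UNIV. \<theta> e v x * \<theta> f w x * conn_coeff D X a e f (pt x))
      - (\<Sum>e\<in>UNIV. \<Sum>f\<in>UNIV. \<theta> e v x * \<theta> f w x * conn_coeff D X a f e (pt x))"
    by (subst bilinear_frame_expansion[of x F, OF x lin]) (simp add: F right_diff_distrib sum_subtractf)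
  also have "(\<Sum>e\<in>UNIV. \<Sum>f\<in>UNIV. \<theta> e v x * \<theta> f w x * conn_coeff D X a f e (pt x))
      = (\<Sum>b\<in>UNIV. \<omega> D a b v x * \<theta> b w x)"
    unfolding om by (rule sum.swap)
  also have "(\<Sum>e\<in>UNIV. \<Sum>f\<in>UNIV. \<theta> e v x * \<theta> f w x * conn_coeff D X a e f (pt x))
      = (\<Sum>b\<in>UNIV. \<omega> D a b w x * \<theta> b v x)"
    unfolding om by (simp add: mult_ac)
  finally show ?thesis by (simp add: F_def sum_subtractf)
qed

lemma moving_frame: "moving_frame V \<theta> (\<omega> D)"
  by unfold_locales (rule open_V smooth_theta smooth_omega structure_equation, assumption?)+

end

text \<open>The last hypothesis aligns the chart in which \<open>ext_deriv\<close> differentiates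
  with \<open>c\<close>, so that both sides differentiate the same functions of the
  coordinates.\<close>

lemma riemann_eq_curvature:
  assumes "p \<in> U" "p \<in> chart_dom c" "chart_at \<A> p = c"
  shows "riemann \<A> D X p a b e f
    = curvature (\<omega> D) a b (\<xi> e (coord c p)) (\<xi> f (coord c p)) (coord c p)"
proof -
  have x: "coord c p \<in> V" using assms by (auto simp: V_def)
  have om: "conn_form D X a b p (X e p) = \<omega> D a b (X e p c) (coord c p)" for a b e
    using omega_tangent[OF x, of "X e p"] assms field_tangent[OF field_X] by (simp add: pt_coord)
  have "(\<lambda>q. conn_form D X a b q (const_field \<A> c u q)) \<circ> inv_coord c = \<omega> D a b u" for u
    by (simp add: fun_eq_iff \<omega>_def pt_def)
  then show ?thesis
    using assms by (simp add: riemann_def curv_form_def ext_deriv_def dir_deriv_def wedge_def curvature_def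
        om der_def \<xi>_def pt_coord)
qed

end


section \<open>Projective invariance and the Levi-Civita case\<close>

lemma delta_same [simp]: "delta a a = 1"
  by (simp add: delta_def)

text \<open>In the change of the Ricci tensor the symmetric part of \<open>Q\<close> appears with
  the factor - (n - 1), the skew part with - (n + 1). The two coefficients in
  \<open>schouten\<close> invert these factors, so the Schouten tensor changes by minus the
  transpose of \<open>Q\<close>, which absorbs the change of curvature.\<close>

lemma weyl_of_projective_change:
  fixes R R' :: "'n::finite \<Rightarrow> 'n \<Rightarrow> 'n \<Rightarrow> 'n \<Rightarrow> real"
  assumes n: "CARD('n) \<ge> 2"
    and R': "\<And>a b c d. R' a b c d = R a b c d + delta a b * (Q d c - Q c d) + Q b c * delta a d - Q b d * delta a c"
  shows "weyl_of R' = weyl_of R"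
proof -
  have ric: "ricci R' b d = ricci R b d + Q d b - real CARD('n) * Q b d" for b d
    unfolding ricci_def R' by (simp add: sum.distrib sum_subtractf delta_def if_distrib[of "\<lambda>x. _ * x"]
        if_distrib[of "\<lambda>x. x * _"] cong: if_cong)
  have n': "real CARD('n) - 1 \<noteq> 0" "real CARD('n) + 1 \<noteq> 0" using n by linarith+
  have "symm (ricci R') a b = symm (ricci R) a b - (real CARD('n) - 1) * symm Q a b"
    "alt (ricci R') a b = alt (ricci R) a b - (real CARD('n) + 1) * alt Q a b" for a b
    unfolding symm_def alt_def ric by (simp_all add: field_simps)
  then have P: "schouten R' a b = schouten R a b - Q b a" for a b
    using n' unfolding schouten_def by (simp add: right_diff_distrib) (simp add: symm_def alt_def field_simps)
  have two: "2 * x * ((y - z) / 2) = x * (y - z)" for x y z :: real by simp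
  show ?thesis
    unfolding weyl_of_def alt_def P two unfolding R' by (intro ext) (simp add: algebra_simps)
qed

text \<open>A symmetric tensor absorbs the symmetrisation over \<open>a\<close> and
  \<open>f\<close>. What is left is the action of \<open>W\<close> for the pair \<open>e\<close>,
  \<open>d\<close> on each slot of \<open>\<kappa>\<close>, and the contraction
  \<open>u\<close>.\<close>

lemma T_endo_apply:
  fixes W :: "'n::finite \<Rightarrow> 'n \<Rightarrow> 'n \<Rightarrow> 'n \<Rightarrow> real"
  assumes "\<kappa> \<in> sym_tensors"
    and u: "\<And>c e. u c e = (\<Sum>a\<in>UNIV. \<Sum>f\<in>UNIV. W c a f e * \<kappa> $ a $ f)"
  shows "T_endo W e d \<kappa> $ c $ b
    = ((\<Sum>f\<in>UNIV. W b f e d * \<kappa> $ c $ f) + (\<Sum>f\<in>UNIV. W c f e d * \<kappa> $ b $ f)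
      + (u c e * delta b d - u c d * delta b e + u b e * delta c d - u b d * delta c e) / real CARD('n)) / 2"
proof -
  have sym: "\<kappa> $ a $ f = \<kappa> $ f $ a" for a f using assms by (auto simp: sym_tensors_def)
  have symm_sum: "(\<Sum>a\<in>UNIV. \<Sum>f\<in>UNIV. symm F a f * \<kappa> $ a $ f) = (\<Sum>a\<in>UNIV. \<Sum>f\<in>UNIV. F a f * \<kappa> $ a $ f)" for F
  proof -
    have "(\<Sum>a\<in>UNIV. \<Sum>f\<in>UNIV. F f a * \<kappa> $ a $ f) = (\<Sum>a\<in>UNIV. \<Sum>f\<in>UNIV. F a f * \<kappa> $ a $ f)"
      by (subst sum.swap) (simp add: sym)
    then show ?thesis
      by (simp add: symm_def add_divide_distrib distrib_right sum.distrib sum_divide_distrib[symmetric])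
  qed
  have 1: "(\<Sum>a\<in>UNIV. \<Sum>f\<in>UNIV. symm (\<lambda>a f. delta c a * W b f e d) a f * \<kappa> $ a $ f)
      = (\<Sum>f\<in>UNIV. W b f e d * \<kappa> $ c $ f)" for c b
    unfolding symm_sum mult.assoc sum_distrib_left[symmetric] sum_delta_mult ..
  have arith: "(1 / 2 * s1 + 1 / 2 * s2 + 1 / N * ((p * x - q * y) / 2) + 1 / N * ((r * z - t * w) / 2)) * k
      = (s1 * k + s2 * k + (p * k * x - q * k * y + r * k * z - t * k * w) / N) / 2"
    for s1 s2 N p q r t x y z w k :: real
    by (simp add: add_divide_distrib diff_divide_distrib algebra_simps)
  have T: "T_comp W e d c b a f * \<kappa> $ a $ f
      = (symm (\<lambda>a f. delta c a * W b f e d) a f * \<kappa> $ a $ f + symm (\<lambda>a f. delta b a * W c f e d) a f * \<kappa> $ a $ f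
        + (symm (\<lambda>a f. W c a f e) a f * \<kappa> $ a $ f * delta b d - symm (\<lambda>a f. W c a f d) a f * \<kappa> $ a $ f * delta b e
          + symm (\<lambda>a f. W b a f e) a f * \<kappa> $ a $ f * delta c d - symm (\<lambda>a f. W b a f d) a f * \<kappa> $ a $ f * delta c e)
          / real CARD('n)) / 2" for a f
    unfolding T_comp_def alt_def by (rule arith)
  show ?thesis
    unfolding T_endo_def vec_lambda_beta T
    by (simp add: sum_divide_distrib[symmetric] sum.distrib sum_subtractf sum_distrib_right[symmetric] 1 symm_sum u)
qed

lemma matrix_add_rdistrib: "(B + C) ** A = B ** A + C ** (A :: 'a::semiring_1^'n^'m)"
  by (simp add: vec_eq_iff matrix_matrix_mult_def distrib_right sum.distrib)

text \<open>Algebra at one point: \<open>G\<close> is the Gram matrix of the metric in the frame,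
  and the kernel element is its inverse \<open>H\<close>. Skewness moved to upper indices yields in
  turn the vanishing trace, the symmetry of Ricci and the contraction \<open>u\<close>.\<close>

lemma levi_civita_kernel:
  fixes R :: "'n::finite \<Rightarrow> 'n \<Rightarrow> 'n \<Rightarrow> 'n \<Rightarrow> real" and G :: "'n \<Rightarrow> 'n \<Rightarrow> real"
  assumes n: "CARD('n) \<ge> 2"
    and antisym: "\<And>a b c d. R a b c d = - R a b d c"
    and bianchi: "\<And>a b c d. R a b c d + R a c d b + R a d b c = 0"
    and skew: "\<And>b c e d. (\<Sum>f\<in>UNIV. R f b e d * G f c + R f c e d * G b f) = 0"
    and G_sym: "\<And>b c. G b c = G c b"
    and nondeg: "\<And>k::real^'n. (\<And>b. (\<Sum>f\<in>UNIV. G b f * k $ f) = 0) \<Longrightarrow> k = 0"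
  shows "\<exists>\<kappa>\<in>sym_tensors. \<kappa> \<noteq> 0 \<and> (\<forall>e d. T_endo (weyl_of R) e d \<kappa> = 0)"
proof -
  define M :: "real^'n^'n" where "M = (\<chi> b c. G b c)"
  have "M *v k = 0 \<Longrightarrow> k = 0" for k
    by (rule nondeg) (simp add: M_def vec_eq_iff matrix_vector_mult_def)
  then have "invertible M"
    by (simp add: invertible_left_inverse matrix_left_invertible_ker)
  then obtain H where H: "M ** H = mat 1" "H ** M = mat 1" unfolding invertible_def by blast
  have Mt: "transpose M = M" by (simp add: M_def transpose_def vec_eq_iff G_sym)
  have Ht: "transpose H = H"
  proof -
    have "transpose H = transpose H ** (M ** H)" by (simp add: H)
    also have "\<dots> = transpose (transpose M ** H) ** H" by (simp add: matrix_transpose_mul matrix_mul_assoc)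
    also have "\<dots> = H" by (simp add: Mt H)
    finally show ?thesis .
  qed
  have H_sym: "H $ a $ f = H $ f $ a" for a f
    by (subst Ht[symmetric]) (simp only: transpose_def vec_lambda_beta)
  \<comment> \<open>The skewness hypothesis, as a matrix identity, is multiplied by \<open>H\<close>
    on both sides to raise its indices.\<close>
  have raise: "(\<Sum>f\<in>UNIV. R b f e d * H $ f $ c) = - (\<Sum>f\<in>UNIV. R c f e d * H $ f $ b)" for b c e d
  proof -
    define N :: "real^'n^'n" where "N = (\<chi> b f. R b f e d)"
    have "transpose N ** M + M ** N = 0"
      using skew[of _ e d]
      by (simp add: vec_eq_iff matrix_matrix_mult_def transpose_def N_def M_def sum.distrib mult.commute)
    then have "H ** (transpose N ** M + M ** N) ** H = 0" by simp
    then have "H ** transpose N ** (M ** H) + (H ** M) ** N ** H = 0"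
      by (simp add: matrix_add_ldistrib matrix_add_rdistrib matrix_mul_assoc)
    then have "(H ** transpose N + N ** H) $ c $ b = 0" by (simp add: H)
    then show ?thesis
      by (simp add: matrix_matrix_mult_def transpose_def N_def H_sym[of c] mult.commute)
  qed
  \<comment> \<open>Contracting with the symmetric \<open>M\<close> what \<open>raise\<close> shows
    to be skew makes the trace equal to its own negative.\<close>
  have tr: "(\<Sum>a\<in>UNIV. R a a c d) = 0" for c d
  proof -
    have 1: "(\<Sum>a\<in>UNIV. R a a c d) = (\<Sum>a\<in>UNIV. \<Sum>b\<in>UNIV. (\<Sum>f\<in>UNIV. R a f c d * H $ f $ b) * M $ b $ a)"
    proof (rule sum.cong)
      fix a
      have "(\<Sum>b\<in>UNIV. (\<Sum>f\<in>UNIV. R a f c d * H $ f $ b) * M $ b $ a)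
          = (\<Sum>f\<in>UNIV. R a f c d * (\<Sum>b\<in>UNIV. H $ f $ b * M $ b $ a))"
        unfolding sum_distrib_right sum_distrib_left by (subst sum.swap) (simp add: mult.assoc)
      also have "\<dots> = (\<Sum>f\<in>UNIV. R a f c d * (H ** M) $ f $ a)" by (simp add: matrix_matrix_mult_def)
      also have "\<dots> = R a a c d" by (simp add: H mat_def if_distrib[of "\<lambda>x. _ * x"] cong: if_cong)
      finally show "R a a c d = (\<Sum>b\<in>UNIV. (\<Sum>f\<in>UNIV. R a f c d * H $ f $ b) * M $ b $ a)" by simp
    qed simp
    also have "\<dots> = - (\<Sum>a\<in>UNIV. \<Sum>b\<in>UNIV. (\<Sum>f\<in>UNIV. R b f c d * H $ f $ a) * M $ b $ a)"
      by (subst raise) (simp add: sum_negf)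
    also have "\<dots> = - (\<Sum>a\<in>UNIV. \<Sum>b\<in>UNIV. (\<Sum>f\<in>UNIV. R a f c d * H $ f $ b) * M $ b $ a)"
      by (subst sum.swap) (simp add: M_def G_sym)
    also have "\<dots> = - (\<Sum>a\<in>UNIV. R a a c d)" unfolding 1 ..
    finally show ?thesis by simp
  qed
  have ric_sym: "ricci R b d = ricci R d b" for b d
  proof -
    have "(\<Sum>a\<in>UNIV. R a b a d + R a a d b + R a d b a) = 0" using bianchi by simp
    then have "ricci R b d + (\<Sum>a\<in>UNIV. R a d b a) = 0" by (simp add: sum.distrib tr ricci_def)
    then show ?thesis using antisym[of _ d b] by (simp add: ricci_def sum_negf)
  qed
  define P where "P = schouten R"
  have P: "P a b = ricci R a b / (real CARD('n) - 1)" for a b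
    by (simp add: P_def schouten_def symm_def alt_def ric_sym[of b a])
  have ricP: "ricci R a b = (real CARD('n) - 1) * P a b" for a b
    using n by (simp add: P)
  have P_sym: "P a b = P b a" for a b by (simp add: P ric_sym)
  have W: "weyl_of R a b c d = R a b c d - delta a c * P d b + delta a d * P c b" for a b c d
    using P_sym[of c d] by (simp add: weyl_of_def alt_def P_def)
  define Pu where "Pu d c = (\<Sum>f\<in>UNIV. P d f * H $ f $ c)" for d c
  have w: "(\<Sum>f\<in>UNIV. weyl_of R b f e d * H $ c $ f)
      = (\<Sum>f\<in>UNIV. R b f e d * H $ f $ c) - delta b e * Pu d c + delta b d * Pu e c" for b c e d
    unfolding W Pu_def H_sym[of c]
    by (simp add: distrib_right left_diff_distrib sum.distrib sum_subtractf sum_distrib_left mult.assoc)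
  define u where "u c e = (\<Sum>a\<in>UNIV. \<Sum>f\<in>UNIV. weyl_of R c a f e * H $ a $ f)" for c e
  define t where "t = (\<Sum>a\<in>UNIV. Pu a a)"
  \<comment> \<open>Ricci accounts for n - 1 copies of the raised Schouten tensor and the term with
    \<open>delta c f\<close> for one more, together the n that cancels 1/n.\<close>
  have u_eq: "u c e = - real CARD('n) * Pu e c + delta c e * t" for c e
  proof -
    have "(\<Sum>a\<in>UNIV. \<Sum>f\<in>UNIV. R c a f e * H $ a $ f) = (\<Sum>f\<in>UNIV. \<Sum>a\<in>UNIV. R c a f e * H $ a $ f)"
      by (rule sum.swap)
    also have "\<dots> = - (\<Sum>f\<in>UNIV. \<Sum>a\<in>UNIV. R f a f e * H $ a $ c)"
      by (subst raise) (simp add: sum_negf)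
    also have "\<dots> = - (\<Sum>a\<in>UNIV. ricci R a e * H $ a $ c)"
      unfolding ricci_def sum_distrib_right by (subst sum.swap) simp
    also have "\<dots> = - ((real CARD('n) - 1) * Pu e c)"
      unfolding Pu_def ricP by (simp add: P_sym[of e] sum_distrib_left mult.assoc)
    finally have r: "(\<Sum>a\<in>UNIV. \<Sum>f\<in>UNIV. R c a f e * H $ a $ f) = - ((real CARD('n) - 1) * Pu e c)" .
    have "(\<Sum>a\<in>UNIV. \<Sum>f\<in>UNIV. delta c f * P e a * H $ a $ f) = Pu e c"
      by (simp add: mult.assoc Pu_def)
    moreover have "(\<Sum>a\<in>UNIV. \<Sum>f\<in>UNIV. delta c e * P f a * H $ a $ f) = delta c e * t"
      unfolding t_def Pu_def by (subst sum.swap) (simp add: sum_distrib_left mult.assoc)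
    moreover have "u c e = (\<Sum>a\<in>UNIV. \<Sum>f\<in>UNIV. R c a f e * H $ a $ f)
      - (\<Sum>a\<in>UNIV. \<Sum>f\<in>UNIV. delta c f * P e a * H $ a $ f)
      + (\<Sum>a\<in>UNIV. \<Sum>f\<in>UNIV. delta c e * P f a * H $ a $ f)"
      unfolding u_def W by (simp add: distrib_right left_diff_distrib sum.distrib sum_subtractf)
    ultimately show ?thesis unfolding r by (simp add: algebra_simps)
  qed
  have "H \<in> sym_tensors" using H_sym by (simp add: sym_tensors_def)
  moreover have "T_endo (weyl_of R) e d H = 0" for e d
  proof -
    have "T_endo (weyl_of R) e d H $ c $ b = 0" for c b
      unfolding T_endo_apply[of H u "weyl_of R", OF \<open>H \<in> sym_tensors\<close> u_def] w raise[of c e d b] u_eq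
      by (simp add: field_simps delta_def)
    then show ?thesis by (simp add: vec_eq_iff)
  qed
  moreover have "H \<noteq> 0"
  proof
    assume "H = 0"
    then have "(mat 1 :: real^'n^'n) = 0" using H by simp
    then have "(mat 1 :: real^'n^'n) $ i $ i = 0" for i by simp
    then show False by (simp add: mat_def)
  qed
  ultimately show ?thesis by blast
qed

lemma linear_T_endo: "linear (T_endo W e d)"
  by (rule linearI) (simp_all add: T_endo_def vec_eq_iff sum.distrib distrib_left sum_distrib_left mult_ac)

text \<open>The coordinates determine a symmetric tensor, so a nonzero kernel element of
  \<open>L\<close> gives a nonzero kernel vector of its matrix.\<close>

lemma sym_det_eq_0:
  fixes \<kappa> :: "real^('n::{finite, linorder})^('n::{finite, linorder})"
  assumes "linear L" "\<kappa> \<in> sym_tensors" "\<kappa> \<noteq> 0" "L \<kappa> = 0"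
  shows "sym_det L = 0"
proof (rule ccontr)
  assume "sym_det L \<noteq> 0"
  then have "invertible (sym_matrix L)" by (simp add: sym_det_def invertible_det_nz)
  moreover have "sym_matrix L *v sym_coords \<kappa> = 0"
    using sym_matrix_works[OF assms(1,2)] assms(4) by (simp add: sym_coords_def vec_eq_iff case_prod_beta)
  ultimately have "sym_coords \<kappa> = 0"
    using invertible_left_inverse matrix_left_invertible_ker by blast
  then show False using sym_tensor_expansion[OF assms(2)] assms(3) by simp
qed

lemma riemann_antisym: "riemann \<A> D X p a b c d = - riemann \<A> D X p a b d c"
  by (simp add: riemann_def curv_form_def ext_deriv_def wedge_def Let_def sum_negf[symmetric])

lemma chart_at:
  assumes "local_frame \<A> U X" "p \<in> U"
  shows "chart_at \<A> p \<in> \<A>" "p \<in> chart_dom (chart_at \<A> p)"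
proof -
  have "\<exists>c. c \<in> \<A> \<and> p \<in> chart_dom c" using assms unfolding local_frame_def open_in_def carrier_def by blast
  then show "chart_at \<A> p \<in> \<A>" "p \<in> chart_dom (chart_at \<A> p)"
    unfolding chart_at_def by (metis (mono_tags, lifting) someI_ex)+
qed

text \<open>Near \<open>p\<close> the frame components \<open>A\<close> of the one-form are smooth
  functions of the coordinates, and they change the connection coefficients by
  \<open>A e * delta a b + A b * delta a e\<close>. Evaluated on the frame,
  \<open>curvature_projective_change\<close> becomes the hypothesis of
  \<open>weyl_of_projective_change\<close>.\<close>

lemma weyl_projective_invariant:
  fixes \<A> :: "('a::{t2_space, second_countable_topology}, 'n::finite) chart set"
  assumes n: "CARD('n) \<ge> 2" and atlas: "smooth_atlas \<A>" and frame: "local_frame \<A> U X" and p: "p \<in> U"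
    and D: "torsion_free_connection \<A> D" and D': "torsion_free_connection \<A> D'"
    and equiv: "projectively_equivalent \<A> D D'"
  shows "weyl \<A> D' X p = weyl \<A> D X p"
proof -
  interpret chart_frame \<A> "chart_at \<A> p" U X
    using atlas frame chart_at[OF frame p] by unfold_locales
  interpret moving_frame V \<theta> "\<omega> D" by (rule moving_frame[OF D])
  let ?x = "coord (chart_at \<A> p) p"
  have x: "?x \<in> V" using chart_at[OF frame p] p by (auto simp: V_def)
  obtain \<alpha> where \<alpha>: "one_form \<A> \<alpha>" and ch: "\<And>Y Z q. vector_field \<A> U Y \<Longrightarrow> vector_field \<A> U Z \<Longrightarrow> q \<in> U \<Longrightarrow>
      D' Y Z q = (\<lambda>c. D Y Z q c + \<alpha> q (Y q) *\<^sub>R Z q c + \<alpha> q (Z q) *\<^sub>R Y q c)"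
    using equiv open_in_U unfolding projectively_equivalent_def by blast
  define A where "A b x = \<alpha> (pt x) (X b (pt x))" for b x
  have "smooth_fun \<A> U (\<lambda>p. \<alpha> p (X b p))" for b
    using \<alpha> open_in_U field_X unfolding one_form_def by blast
  then have "smooth_on ((\<lambda>p. \<alpha> p (X b p)) \<circ> inv_coord (chart_at \<A> p)) V" for b
    using chart unfolding smooth_fun_def V_def by blast
  then have A: "smooth_on (A b) V" for b by (simp add: A_def[abs_def] comp_def pt_def)
  have coeff: "conn_coeff D' X a b e (pt y)
      = conn_coeff D X a b e (pt y) + A e y * delta a b + A b y * delta a e" if y: "y \<in> V" for a b e y
    unfolding conn_coeff_eq[OF D' y] conn_coeff_eq[OF D y] ch[OF field_X field_X pt_V(1)[OF y]]
    by (simp add: linear_add[OF linear_theta[OF y]] linear_cmul[OF linear_theta[OF y]] \<xi>_def[symmetric]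
        theta_xi[OF y] A_def)
  have om: "\<omega> D' a b u y = \<omega> D a b u y + delta a b * (\<Sum>c\<in>UNIV. A c y * \<theta> c u y) + A b y * \<theta> a u y"
    if y: "y \<in> V" for a b u y
  proof -
    have "(\<Sum>e\<in>UNIV. A e y * delta a b * \<theta> e u y) = delta a b * (\<Sum>c\<in>UNIV. A c y * \<theta> c u y)"
      by (simp add: sum_distrib_left mult_ac)
    moreover have "(\<Sum>e\<in>UNIV. A b y * delta a e * \<theta> e u y) = A b y * \<theta> a u y"
      unfolding mult.assoc sum_distrib_left[symmetric] sum_delta_mult ..
    ultimately show ?thesis unfolding omega_eq coeff[OF y] distrib_right sum.distrib by simp
  qed
  define Q where "Q b v = der v (A b) ?x - (\<Sum>c\<in>UNIV. A c ?x * \<omega> D c b v ?x) - A b ?x * (\<Sum>c\<in>UNIV. A c ?x * \<theta> c v ?x)" for b v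
  have curv: "curvature (\<omega> D') a b v w ?x = curvature (\<omega> D) a b v w ?x
      + delta a b * (\<Sum>c\<in>UNIV. Q c v * \<theta> c w ?x - Q c w * \<theta> c v ?x) + Q b v * \<theta> a w ?x - Q b w * \<theta> a v ?x"
    for a b v w
    by (rule curvature_projective_change[OF A om x Q_def])
  define Q' where "Q' b e = Q b (\<xi> e ?x)" for b e
  show ?thesis
    unfolding weyl_def
  proof (rule weyl_of_projective_change[OF n])
    fix a b e f
    show "riemann \<A> D' X p a b e f = riemann \<A> D X p a b e f + delta a b * (Q' f e - Q' e f)
        + Q' b e * delta a f - Q' b f * delta a e"
      unfolding riemann_eq_curvature[OF p chart_at(2)[OF frame p] refl]
        curv theta_xi[OF x] Q'_def
      by (simp add: sum_subtractf)
  qed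
qed

text \<open>The Gram matrix of the metric in the frame solves the compatibility equation of
  \<open>curvature_metric_skew\<close>. That lemma and \<open>first_bianchi\<close>, taken on frame
  vectors at \<open>p\<close>, feed \<open>levi_civita_kernel\<close>.\<close>

lemma levi_civita_sym_det:
  fixes \<A> :: "('a::{t2_space, second_countable_topology}, 'n::{finite, linorder}) chart set"
  assumes n: "CARD('n) \<ge> 2" and atlas: "smooth_atlas \<A>" and frame: "local_frame \<A> U X" and p: "p \<in> U"
    and g: "pseudo_riemannian_metric \<A> g" and lc: "levi_civita \<A> g D"
  shows "sym_det (T_endo (weyl \<A> D X p) e d) = 0"
proof -
  interpret chart_frame \<A> "chart_at \<A> p" U X
    using atlas frame chart_at[OF frame p] by unfold_locales
  have D: "torsion_free_connection \<A> D" using lc unfolding levi_civita_def by blast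
  interpret moving_frame V \<theta> "\<omega> D" by (rule moving_frame[OF D])
  let ?x = "coord (chart_at \<A> p) p"
  have x: "?x \<in> V" using chart_at[OF frame p] p by (auto simp: V_def)
  have ptx: "pt ?x = p" by (rule pt_coord[OF chart_at(2)[OF frame p]])
  have U: "q \<in> carrier \<A>" if "q \<in> U" for q using open_in_U that by (auto simp: open_in_def)
  have lin: "tangent_linear \<A> q (g q v)" and sym: "w \<in> tangent_space \<A> q \<Longrightarrow> g q v w = g q w v"
    and nondeg: "(\<forall>w\<in>tangent_space \<A> q. g q v w = 0) \<Longrightarrow> v = (\<lambda>c. 0)"
    if "q \<in> U" "v \<in> tangent_space \<A> q" for q v w
    using g U[OF that(1)] that(2) unfolding pseudo_riemannian_metric_def by blast+
  have XT: "X a q \<in> tangent_space \<A> q" if "q \<in> U" for a q using field_tangent[OF field_X that] .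
  define G where "G b e y = g (pt y) (X b (pt y)) (X e (pt y))" for b e y
  have "smooth_fun \<A> U (\<lambda>p. g p (X b p) (X e p))" for b e
    using g open_in_U field_X unfolding pseudo_riemannian_metric_def by blast
  then have "smooth_on ((\<lambda>p. g p (X b p) (X e p)) \<circ> inv_coord (chart_at \<A> p)) V" for b e
    using chart unfolding smooth_fun_def V_def by blast
  then have G: "smooth_on (G b e) V" for b e by (simp add: G_def[abs_def] comp_def pt_def)
  have gsum: "g q v w = (\<Sum>f\<in>UNIV. coframe X f q w * g q v (X f q))"
    if "q \<in> U" "v \<in> tangent_space \<A> q" "w \<in> tangent_space \<A> q" for q v w
    by (subst coframe_expansion[OF that(1,3)])
      (rule tangent_linear_sum[OF atlas lin[OF that(1,2)]], simp_all add: XT that)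
  have Gs: "G b e y = G e b y" if "y \<in> V" for b e y
    unfolding G_def using sym[OF pt_V(1)[OF that] XT XT] pt_V(1)[OF that] by blast
  have compat: "der v (G b e) y = (\<Sum>f\<in>UNIV. \<omega> D f b v y * G f e y + \<omega> D f e v y * G b f y)"
    if y: "y \<in> V" for b e v y
  proof -
    let ?q = "pt y"
    note q = pt_V(1)[OF y]
    have dG: "G b e differentiable at y" using G y smooth_on_imp_differentiable by blast
    have DT: "D (X h) (X b) ?q \<in> tangent_space \<A> ?q" for h b by (rule field_tangent[OF field_D[OF D] q])
    \<comment> \<open>Metric compatibility speaks of vector fields, so it is applied along the frame
      first; linearity in the direction then gives every constant \<open>v\<close>.\<close>
    have xi: "der (\<xi> h y) (G b e) y
        = (\<Sum>f\<in>UNIV. conn_coeff D X f b h ?q * G f e y + conn_coeff D X f e h ?q * G b f y)" for h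
    proof -
      have comp: "(\<lambda>q. g q (X b q) (X e q)) \<circ> inv_coord (chart_at \<A> p) = G b e"
        by (simp add: fun_eq_iff G_def pt_def)
      have "der (\<xi> h y) (G b e) y = dir_deriv \<A> ?q (X h ?q) (\<lambda>q. g q (X b q) (X e q))"
        using dir_deriv_eq_der[OF atlas chart pt_V(2)[OF y] XT[OF q], of "\<lambda>q. g q (X b q) (X e q)" h] dG
        unfolding comp pt_V(3)[OF y] \<xi>_def by simp
      also have "\<dots> = g ?q (D (X h) (X b) ?q) (X e ?q) + g ?q (X b ?q) (D (X h) (X e) ?q)"
        using lc open_in_U field_X q unfolding levi_civita_def by blast
      also have "g ?q (D (X h) (X b) ?q) (X e ?q) = g ?q (X e ?q) (D (X h) (X b) ?q)"
        by (rule sym[OF q DT XT[OF q]])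
      finally show ?thesis
        unfolding gsum[OF q XT[OF q] DT]
        by (simp add: conn_coeff_def G_def[symmetric] sum.distrib Gs[OF y, of e])
    qed
    have "der v (G b e) y = der (\<Sum>h\<in>UNIV. \<theta> h v y *\<^sub>R \<xi> h y) (G b e) y"
      using theta_expansion[OF y, of v] by simp
    also have "\<dots> = (\<Sum>h\<in>UNIV. \<theta> h v y * der (\<xi> h y) (G b e) y)"
      by (simp add: linear_sum[OF der_linear[OF dG]] linear_cmul[OF der_linear[OF dG]])
    also have "\<dots> = (\<Sum>h\<in>UNIV. \<Sum>f\<in>UNIV. \<theta> h v y * (conn_coeff D X f b h ?q * G f e y + conn_coeff D X f e h ?q * G b f y))"
      unfolding xi sum_distrib_left ..
    also have "\<dots> = (\<Sum>f\<in>UNIV. \<Sum>h\<in>UNIV. \<theta> h v y * (conn_coeff D X f b h ?q * G f e y + conn_coeff D X f e h ?q * G b f y))"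
      by (rule sum.swap)
    finally show ?thesis
      by (simp add: omega_eq sum_distrib_left sum_distrib_right sum.distrib algebra_simps)
  qed
  note R = riemann_eq_curvature[OF p chart_at(2)[OF frame p] refl, of D]
  have "\<exists>\<kappa>\<in>sym_tensors. \<kappa> \<noteq> 0 \<and> (\<forall>e d. T_endo (weyl_of (riemann \<A> D X p)) e d \<kappa> = 0)"
  proof (rule levi_civita_kernel[OF n])
    show "riemann \<A> D X p a b e f = - riemann \<A> D X p a b f e" for a b e f
      by (rule riemann_antisym)
    show "riemann \<A> D X p a b e f + riemann \<A> D X p a e f b + riemann \<A> D X p a f b e = 0" for a b e f
    proof -
      have "(\<Sum>h\<in>UNIV. riemann \<A> D X p a h e f * delta h b + riemann \<A> D X p a h f b * delta h e
          + riemann \<A> D X p a h b e * delta h f) = 0"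
        using first_bianchi[OF x, of a "\<xi> e ?x" "\<xi> f ?x" "\<xi> b ?x"] unfolding theta_xi[OF x] R by simp
      then show ?thesis by (simp add: sum.distrib)
    qed
    show "(\<Sum>f\<in>UNIV. riemann \<A> D X p f b e d * G f c ?x + riemann \<A> D X p f c e d * G b f ?x) = 0" for b c e d
      unfolding R by (rule curvature_metric_skew[OF G compat x])
    show "G b c ?x = G c b ?x" for b c
      by (rule Gs[OF x])
    fix k :: "real^('n::{finite, linorder})" assume k: "\<And>b. (\<Sum>f\<in>UNIV. G b f ?x * k $ f) = 0"
    let ?v = "\<lambda>c. \<Sum>f\<in>UNIV. k $ f *\<^sub>R X f p c"
    have v: "?v \<in> tangent_space \<A> p" by (rule tangent_sum[OF atlas XT[OF p]])
    have Xv: "g p ?v (X b p) = 0" for b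
    proof -
      have "g p ?v (X b p) = g p (X b p) ?v" by (rule sym[OF p v XT[OF p]])
      also have "\<dots> = (\<Sum>f\<in>UNIV. k $ f * g p (X b p) (X f p))"
        by (rule tangent_linear_sum[OF atlas lin[OF p XT[OF p]]]) (simp_all add: XT p)
      finally show ?thesis using k[of b] by (simp add: G_def ptx mult.commute)
    qed
    have "?v = (\<lambda>c. 0)"
      by (rule nondeg[OF p v]) (simp add: gsum[OF p v] Xv)
    then have v0: "?v c = 0" for c by (rule fun_cong)
    have "k $ f = 0" for f
    proof -
      have "coframe X f p ?v = k $ f"
        by (rule coframe_eqI[OF p v chart_at(2)[OF frame p]]) (rule refl)
      moreover have "coframe X f p ?v = 0"
        by (rule coframe_eqI[OF p v chart_at(2)[OF frame p], of "\<lambda>_. 0"]) (simp add: v0)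
      ultimately show ?thesis by simp
    qed
    then show "k = 0" by (simp add: vec_eq_iff)
  qed
  then show ?thesis
    unfolding weyl_def using sym_det_eq_0[OF linear_T_endo] by blast
qed


section \<open>Weyl tensors without kernel\<close>

lemma sym_unit_index:
  "sym_unit j $ fst (Rep_index_pair i) $ snd (Rep_index_pair i) = (if i = j then 1 else 0)"
  using Rep_index_pair[of i] Rep_index_pair[of j] Rep_index_pair_inject[of i j]
  by (cases "Rep_index_pair i"; cases "Rep_index_pair j") (auto simp: sym_unit_def)

text \<open>Each \<open>sym_unit\<close> is an eigenvector, with the value of \<open>\<rho>\<close>
  at its index pair as eigenvalue.\<close>

lemma sym_det_diagonal:
  fixes L :: "real^('n::{finite, linorder})^('n::{finite, linorder}) \<Rightarrow> real^('n::{finite, linorder})^('n::{finite, linorder})"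
  assumes "\<And>\<kappa> c b. \<kappa> \<in> sym_tensors \<Longrightarrow> L \<kappa> $ c $ b = \<rho> c b * \<kappa> $ c $ b" "\<And>c b. \<rho> c b \<noteq> 0"
  shows "sym_det L \<noteq> 0"
proof -
  have "sym_unit j \<in> sym_tensors" for j :: "'n index_pair"
    by (auto simp: sym_unit_def sym_tensors_def)
  then have M: "sym_matrix L $ i $ j
      = (if i = j then \<rho> (fst (Rep_index_pair i)) (snd (Rep_index_pair i)) else 0)" for i j
    using assms(1) by (simp add: sym_matrix_def sym_coords_def case_prod_beta sym_unit_index)
  have "sym_det L = (\<Prod>i\<in>UNIV. sym_matrix L $ i $ i)"
    unfolding sym_det_def by (rule det_diagonal) (simp add: M)
  then show ?thesis using assms(2) by (simp add: M)
qed

text \<open>The algebraic symmetries of a projective Weyl tensor. Contracting the cyclic identity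
  shows that the trace over the first two indices vanishes as well.\<close>

definition weyl_symmetries :: "('n::finite \<Rightarrow> 'n \<Rightarrow> 'n \<Rightarrow> 'n \<Rightarrow> real) \<Rightarrow> bool" where
  "weyl_symmetries W \<longleftrightarrow> (\<forall>a b c d. W a b c d = - W a b d c) \<and>
     (\<forall>a b c d. W a b c d + W a c d b + W a d b c = 0) \<and> (\<forall>b d. ricci W b d = 0)"

lemma weyl_of_weyl_symmetries: "weyl_symmetries W \<Longrightarrow> weyl_of W = W"
proof (intro ext)
  fix a b c d assume "weyl_symmetries W"
  then have "ricci W b d = 0" for b d unfolding weyl_symmetries_def by blast
  then show "weyl_of W a b c d = W a b c d" by (simp add: weyl_of_def schouten_def symm_def alt_def)
qed

text \<open>The nonzero components, up to antisymmetry in the last two indices, are (for \<open>i \<noteq> p, q\<close>)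
  \<open>W\<^sup>i\<^sub>i\<^sub>p\<^sub>q = W\<^sup>i\<^sub>p\<^sub>q\<^sub>i = 1\<close>, \<open>W\<^sup>i\<^sub>q\<^sub>p\<^sub>i = 2\<close>, \<open>W\<^sup>p\<^sub>p\<^sub>p\<^sub>q = n - 2\<close> and \<open>W\<^sup>q\<^sub>q\<^sub>p\<^sub>q = - 2(n - 2)\<close>: a solution of the
  trace-free and Bianchi conditions that makes \<open>\<T>\<^bsub>[pq]\<^esub>\<close> diagonal.\<close>

definition diagonal_weyl :: "'n::finite \<Rightarrow> 'n \<Rightarrow> 'n \<Rightarrow> 'n \<Rightarrow> 'n \<Rightarrow> 'n \<Rightarrow> real" where
  "diagonal_weyl p q a b c d =
     (1 + (real CARD('n) - 2) * delta a p - (2 * real CARD('n) - 1) * delta a q) * delta a b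
       * (delta c p * delta d q - delta c q * delta d p)
     + delta b p * (delta a d * delta c q - delta a c * delta d q)
     + 2 * delta b q * (delta a d * delta c p - delta a c * delta d p)"

lemma delta_commute: "delta a b = delta b a"
  by (simp add: delta_def)

lemma diagonal_weyl_symmetries:
  fixes p q :: "'n::finite"
  assumes "p \<noteq> q"
  shows "weyl_symmetries (diagonal_weyl p q)"
  unfolding weyl_symmetries_def
proof (intro conjI allI)
  fix a b c d :: 'n
  show "diagonal_weyl p q a b c d = - diagonal_weyl p q a b d c"
    by (simp add: diagonal_weyl_def algebra_simps)
  \<comment> \<open>In the rewritten form each of \<open>b\<close>, \<open>c\<close>,
    \<open>d\<close> occurs once in every monomial. In the cyclic sum the coefficients of
    \<open>delta a b\<close> carry the weights 1, 1 and -2 from the three summands, and the terms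
    with n cancel among themselves.\<close>
  have "(1 + x * delta a p - y * delta a q) * delta a b
      = delta a b + x * (delta a p * delta b p) - y * (delta a q * delta b q)" for b and x y :: real
    by (simp add: delta_def)
  then have *: "diagonal_weyl p q a b c d
      = (delta a b + (real CARD('n) - 2) * (delta a p * delta b p) - (2 * real CARD('n) - 1) * (delta a q * delta b q))
       * (delta c p * delta d q - delta c q * delta d p)
     + delta b p * (delta a d * delta c q - delta a c * delta d q)
     + 2 * delta b q * (delta a d * delta c p - delta a c * delta d p)" for b c d
    by (simp add: diagonal_weyl_def)
  show "diagonal_weyl p q a b c d + diagonal_weyl p q a c d b + diagonal_weyl p q a d b c = 0"
    unfolding * by (simp add: algebra_simps)
  have "ricci (diagonal_weyl p q) b d
      = (1 + (real CARD('n) - 2) * delta b p - (2 * real CARD('n) - 1) * delta b q)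
         * (delta b p * delta d q - delta b q * delta d p)
       + delta b p * (delta d q - real CARD('n) * delta d q)
       + 2 * delta b q * (delta d p - real CARD('n) * delta d p)"
  proof -
    have 1: "(\<Sum>a\<in>UNIV. f a * delta a b * (delta a p * x - delta a q * y)) = f b * (delta b p * x - delta b q * y)"
      for f :: "'n \<Rightarrow> real" and x y
      using sum_delta_mult(2)[of b "\<lambda>a. f a * (delta a p * x - delta a q * y)"] by (simp add: mult_ac)
    have 2: "(\<Sum>a\<in>UNIV. x * (delta a d * delta a r - delta a a * y)) = x * (delta d r - real CARD('n) * y)" for r x y
      by (simp add: sum_distrib_left[symmetric] sum_subtractf)
    show ?thesis
      unfolding ricci_def diagonal_weyl_def sum.distrib 2
      using 1[of "\<lambda>a. 1 + (real CARD('n) - 2) * delta a p - (2 * real CARD('n) - 1) * delta a q"] by simp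
  qed
  \<comment> \<open>Only two components need an argument: 1 + (n - 2) = n - 1 for
    \<open>b = p\<close>, \<open>d = q\<close>, and (2n - 1) - 1 = 2(n - 1) for
    \<open>b = q\<close>, \<open>d = p\<close>. This is the origin of both constants.\<close>
  then show "ricci (diagonal_weyl p q) b d = 0"
    using assms by (auto simp: delta_def)
qed

text \<open>The endomorphism multiplies each component by a number \<open>\<rho> c b\<close>. The
  values at the index pairs formed from \<open>p\<close> and \<open>q\<close> contain the factor N -
  2, which is where dimension at least 3 enters.\<close>

lemma diagonal_weyl_sym_det:
  fixes p q :: "'n::{finite, linorder}"
  assumes pq: "p \<noteq> q" and n: "CARD('n) \<ge> 3"
  shows "sym_det (T_endo (diagonal_weyl p q) p q) \<noteq> 0"
proof -
  define N where "N = real CARD('n)"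
  have N: "N \<ge> 3" using n by (simp add: N_def)
  define \<mu> where "\<mu> a = 1 + (N - 2) * delta a p - (2 * N - 1) * delta a q" for a
  \<comment> \<open>\<open>l\<close> is the diagonal of the matrix \<open>W b f p q\<close> in
    \<open>b\<close> and \<open>f\<close>; \<open>v\<close> and \<open>w\<close> will be the factors
    in \<open>u c p = v c * \<kappa> $ c $ q\<close> and
    \<open>u c q = w c * \<kappa> $ c $ p\<close>.\<close>
  define l where "l b = \<mu> b - delta b p + 2 * delta b q" for b
  define v where "v c = 3 * delta c p - (\<mu> c + 2)" for c
  define w where "w c = \<mu> c - 1 + 3 * delta c q" for c
  define \<rho> where "\<rho> c b = (l b + l c
      + (v c * delta b q - w c * delta b p + v b * delta c q - w b * delta c p) / N) / 2" for c b
  have [simp]: "delta p q = 0" "delta q p = 0" using pq by (auto simp: delta_def)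
  have W: "diagonal_weyl p q a b c d = \<mu> a * delta a b * (delta c p * delta d q - delta c q * delta d p)
     + delta b p * (delta a d * delta c q - delta a c * delta d q)
     + 2 * delta b q * (delta a d * delta c p - delta a c * delta d p)" for a b c d
    by (simp add: diagonal_weyl_def \<mu>_def N_def)
  show ?thesis
  proof (rule sym_det_diagonal)
    fix \<kappa> :: "real^('n::{finite, linorder})^('n::{finite, linorder})" and c b
    assume \<kappa>: "\<kappa> \<in> sym_tensors"
    then have sym: "\<kappa> $ a $ f = \<kappa> $ f $ a" for a f by (auto simp: sym_tensors_def)
    define u where "u c e = (\<Sum>a\<in>UNIV. \<Sum>f\<in>UNIV. diagonal_weyl p q c a f e * \<kappa> $ a $ f)" for c e
    have contr: "(\<Sum>a\<in>UNIV. \<Sum>f\<in>UNIV. x * delta a r * delta f s * \<kappa> $ a $ f) = x * \<kappa> $ r $ s" for x r s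
    proof -
      have "(\<Sum>a\<in>UNIV. \<Sum>f\<in>UNIV. x * delta a r * delta f s * \<kappa> $ a $ f)
          = x * (\<Sum>a\<in>UNIV. delta a r * (\<Sum>f\<in>UNIV. delta f s * \<kappa> $ a $ f))"
        by (simp only: sum_distrib_left mult.assoc)
      then show ?thesis unfolding sum_delta_mult .
    qed
    have "u c p = (\<Sum>a\<in>UNIV. \<Sum>f\<in>UNIV. - \<mu> c * delta a c * delta f q * \<kappa> $ a $ f
        + delta c p * delta a p * delta f q * \<kappa> $ a $ f + 2 * delta c p * delta a q * delta f p * \<kappa> $ a $ f
        - 2 * delta a q * delta f c * \<kappa> $ a $ f)" for c
      unfolding u_def W by (simp add: algebra_simps delta_commute[of c])
    then have up: "u c p = v c * \<kappa> $ c $ q" for c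
      unfolding sum.distrib sum_subtractf contr v_def
      by (auto simp: delta_def sym algebra_simps)
    have "u c q = (\<Sum>a\<in>UNIV. \<Sum>f\<in>UNIV. \<mu> c * delta a c * delta f p * \<kappa> $ a $ f
        + delta c q * delta a p * delta f q * \<kappa> $ a $ f - 1 * delta a p * delta f c * \<kappa> $ a $ f
        + 2 * delta c q * delta a q * delta f p * \<kappa> $ a $ f)" for c
      unfolding u_def W by (simp add: algebra_simps delta_commute[of c])
    then have uq: "u c q = w c * \<kappa> $ c $ p" for c
      unfolding sum.distrib sum_subtractf contr w_def
      by (auto simp: delta_def sym algebra_simps)
    have first: "(\<Sum>f\<in>UNIV. diagonal_weyl p q b f p q * \<kappa> $ c $ f) = l b * \<kappa> $ c $ b" for b c
    proof -
      have "(\<Sum>f\<in>UNIV. diagonal_weyl p q b f p q * \<kappa> $ c $ f)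
          = \<mu> b * (\<Sum>f\<in>UNIV. delta b f * \<kappa> $ c $ f) - delta b p * (\<Sum>f\<in>UNIV. delta f p * \<kappa> $ c $ f)
            + 2 * delta b q * (\<Sum>f\<in>UNIV. delta f q * \<kappa> $ c $ f)"
        unfolding W sum_distrib_left sum_subtractf[symmetric] sum.distrib[symmetric]
        by (simp add: algebra_simps)
      then show ?thesis unfolding sum_delta_mult by (auto simp: l_def delta_def algebra_simps)
    qed
    have "T_endo (diagonal_weyl p q) p q \<kappa> $ c $ b = (l b * \<kappa> $ c $ b + l c * \<kappa> $ c $ b
      + (v c * \<kappa> $ c $ q * delta b q - w c * \<kappa> $ c $ p * delta b p
         + v b * \<kappa> $ b $ q * delta c q - w b * \<kappa> $ b $ p * delta c p) / N) / 2"
      unfolding T_endo_apply[of \<kappa> u "diagonal_weyl p q", OF \<kappa> u_def] first up uq N_def sym[of b c] ..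
    \<comment> \<open>The delta allows the index \<open>r\<close> to be renamed, so the contraction
      terms act diagonally too.\<close>
    moreover have "x * \<kappa> $ c $ r * delta b r = x * delta b r * \<kappa> $ c $ b"
      "x * \<kappa> $ b $ r * delta c r = x * delta c r * \<kappa> $ c $ b" for x r
      by (auto simp: delta_def sym)
    ultimately show "T_endo (diagonal_weyl p q) p q \<kappa> $ c $ b = \<rho> c b * \<kappa> $ c $ b"
      by (simp add: \<rho>_def distrib_right left_diff_distrib add_divide_distrib diff_divide_distrib)
  next
    fix c b :: 'n
    have \<mu>: "\<mu> p = N - 1" "\<mu> q = 2 - 2 * N" by (simp_all add: \<mu>_def)
    have \<mu>': "\<mu> i = 1" if "i \<noteq> p" "i \<noteq> q" for i using that by (simp add: \<mu>_def delta_def)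
    have vals: "l p = N - 2" "l q = 4 - 2 * N" "v p = 2 - N" "v q = 2 * N - 4" "w p = N - 2" "w q = 4 - 2 * N"
      by (simp_all add: l_def v_def w_def \<mu>)
    have vals': "l i = 1" "v i = - 3" "w i = 0" "delta i p = 0" "delta i q = 0" if "i \<noteq> p" "i \<noteq> q" for i
      using that \<mu>'[OF that] by (simp_all add: l_def v_def w_def delta_def)
    have pp: "\<rho> p p = (N - 2) * (N - 1) / N" and qq: "\<rho> q q = - 2 * (N - 2) * (N - 1) / N"
      and pq: "\<rho> p q = - (N - 2) * (N - 1) / (2 * N)"
      using N by (simp_all add: \<rho>_def vals field_simps)
    have ii: "\<rho> i j = 1" if "i \<noteq> p" "i \<noteq> q" "j \<noteq> p" "j \<noteq> q" for i j
      using that by (simp add: \<rho>_def vals')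
    have ip: "\<rho> i p = (N - 1) / 2" and iq: "\<rho> i q = (5 - 2 * N - 3 / N) / 2" if "i \<noteq> p" "i \<noteq> q" for i
      using that by (simp_all add: \<rho>_def vals' vals)
    have \<rho>_sym: "\<rho> c b = \<rho> b c" for b c by (simp add: \<rho>_def algebra_simps)
    have ne: "\<rho> p p \<noteq> 0" "\<rho> q q \<noteq> 0" "\<rho> p q \<noteq> 0" using N by (simp_all add: pp qq pq)
    have ne': "\<rho> i p \<noteq> 0" "\<rho> i q \<noteq> 0" if "i \<noteq> p" "i \<noteq> q" for i
    proof -
      show "\<rho> i p \<noteq> 0" using N by (simp add: ip[OF that])
      have "3 / N > 0" using N by simp
      then have "5 - 2 * N - 3 / N < 0" using N by linarith
      then show "\<rho> i q \<noteq> 0" by (simp add: iq[OF that])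
    qed
    show "\<rho> c b \<noteq> 0"
      using ne ne' ii \<rho>_sym by (metis zero_neq_one)
  qed
qed

section \<open>Determinants along a line of tensors\<close>

lemma det_affine_poly:
  fixes A B :: "real^'m::finite^'m::finite"
  shows "\<exists>p. \<forall>t. poly p t = det (\<chi> i j. (1 - t) * A $ i $ j + t * B $ i $ j)"
proof
  show "\<forall>t. poly (\<Sum>\<pi> | \<pi> permutes UNIV. of_int (sign \<pi>) * (\<Prod>i\<in>UNIV. [:A $ i $ \<pi> i, B $ i $ \<pi> i - A $ i $ \<pi> i:])) t
      = det (\<chi> i j. (1 - t) * A $ i $ j + t * B $ i $ j)"
    by (simp add: det_def poly_sum poly_prod algebra_simps)
qed

text \<open>\<open>T_comp\<close> is linear in the Weyl tensor, so the matrix entries are affine in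
  \<open>t\<close> and the Leibniz formula gives a polynomial.\<close>

lemma sym_det_affine_poly:
  fixes W W' :: "'n::{finite, linorder} \<Rightarrow> 'n \<Rightarrow> 'n \<Rightarrow> 'n \<Rightarrow> real"
  shows "\<exists>P. \<forall>t. poly P t = sym_det (T_endo (\<lambda>a b c d. (1 - t) * W a b c d + t * W' a b c d) e d)"
proof -
  have T: "T_comp (\<lambda>a b c d. (1 - t) * W a b c d + t * W' a b c d) e d c b a f
      = (1 - t) * T_comp W e d c b a f + t * T_comp W' e d c b a f" for t c b a f
    by (simp add: T_comp_def symm_def alt_def add_divide_distrib diff_divide_distrib algebra_simps)
  have "sym_matrix (T_endo (\<lambda>a b c d. (1 - t) * W a b c d + t * W' a b c d) e d)
      = (\<chi> i j. (1 - t) * sym_matrix (T_endo W e d) $ i $ j + t * sym_matrix (T_endo W' e d) $ i $ j)" for t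
    by (simp add: vec_eq_iff sym_matrix_def sym_coords_def case_prod_beta T_endo_def T distrib_right
        sum.distrib sum_distrib_left mult.assoc)
  then show ?thesis
    using det_affine_poly[of "sym_matrix (T_endo W e d)" "sym_matrix (T_endo W' e d)"]
    by (simp add: sym_det_def)
qed

lemma weyl_symmetries_affine:
  assumes "weyl_symmetries W" "weyl_symmetries W'"
  shows "weyl_symmetries (\<lambda>a b c d. (1 - t) * W a b c d + t * W' a b c d)"
proof -
  have anti: "W a b c d = - W a b d c" "W' a b c d = - W' a b d c"
    and cyc: "W a b c d + W a c d b + W a d b c = 0" "W' a b c d + W' a c d b + W' a d b c = 0"
    and ric: "ricci W b d = 0" "ricci W' b d = 0" for a b c d
    using assms unfolding weyl_symmetries_def by blast+
  show ?thesis
    unfolding weyl_symmetries_def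
  proof (intro conjI allI)
    fix a b c d
    show "(1 - t) * W a b c d + t * W' a b c d = - ((1 - t) * W a b d c + t * W' a b d c)"
      by (subst anti(1), subst anti(2)) simp
    have "(1 - t) * W a b c d + t * W' a b c d + ((1 - t) * W a c d b + t * W' a c d b)
        + ((1 - t) * W a d b c + t * W' a d b c)
      = (1 - t) * (W a b c d + W a c d b + W a d b c) + t * (W' a b c d + W' a c d b + W' a d b c)"
      by (simp add: algebra_simps)
    then show "(1 - t) * W a b c d + t * W' a b c d + ((1 - t) * W a c d b + t * W' a c d b)
        + ((1 - t) * W a d b c + t * W' a d b c) = 0"
      by (simp add: cyc)
    have "ricci (\<lambda>a b c d. (1 - t) * W a b c d + t * W' a b c d) b d = (1 - t) * ricci W b d + t * ricci W' b d"
      by (simp add: ricci_def sum.distrib sum_distrib_left)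
    then show "ricci (\<lambda>a b c d. (1 - t) * W a b c d + t * W' a b c d) b d = 0"
      by (simp add: ric)
  qed
qed

text \<open>A polynomial that vanishes neither at \<open>W\<close> nor at \<open>W'\<close> has finitely many zeros on the line through
  them, so that tensors that are good for single pairs can be joined to one that is good for all.\<close>

lemma generic_weyl:
  fixes F :: "('n::{finite, linorder} \<times> 'n) set"
  assumes n: "CARD('n) \<ge> 3" and F: "finite F" "\<And>e d. (e, d) \<in> F \<Longrightarrow> e \<noteq> d"
  shows "\<exists>W :: 'n \<Rightarrow> 'n \<Rightarrow> 'n \<Rightarrow> 'n \<Rightarrow> real. weyl_symmetries W \<and> (\<forall>(e, d)\<in>F. sym_det (T_endo W e d) \<noteq> 0)"
  using F
proof (induction F rule: finite_induct)
  case empty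
  have "weyl_symmetries (\<lambda>a b c d. 0)" by (simp add: weyl_symmetries_def ricci_def)
  then show ?case by blast
next
  case (insert x F)
  obtain p q where x: "x = (p, q)" by (cases x)
  have pq: "p \<noteq> q" using insert.prems x by blast
  obtain W :: "'n \<Rightarrow> 'n \<Rightarrow> 'n \<Rightarrow> 'n \<Rightarrow> real" where W: "weyl_symmetries W" "\<forall>(e, d)\<in>F. sym_det (T_endo W e d) \<noteq> 0"
    using insert by auto
  define L where "L t a b c d = (1 - t) * W a b c d + t * diagonal_weyl p q a b c d" for t :: real and a b c d
  have L0: "L 0 = W" and L1: "L 1 = diagonal_weyl p q" by (simp_all add: L_def fun_eq_iff)
  have fin: "finite {t. sym_det (T_endo (L t) e d) = 0}" if "(e, d) \<in> insert x F" for e d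
  proof -
    obtain P where P: "poly P t = sym_det (T_endo (L t) e d)" for t
      using sym_det_affine_poly[of W "diagonal_weyl p q" e d] unfolding L_def[abs_def] by blast
    \<comment> \<open>For a pair in \<open>F\<close> the tensor at parameter 0 is good, for the new
      pair the one at parameter 1; either way \<open>P\<close> is not the zero polynomial.\<close>
    have "poly P 0 \<noteq> 0 \<or> poly P 1 \<noteq> 0"
      using that W(2) diagonal_weyl_sym_det[OF pq n] by (auto simp: P L0 L1 x)
    then have "P \<noteq> 0" by auto
    then show ?thesis using poly_roots_finite[of P] by (simp add: P)
  qed
  have "finite (case z of (e, d) \<Rightarrow> {t. sym_det (T_endo (L t) e d) = 0})" if "z \<in> insert x F" for z
    using fin[of "fst z" "snd z"] that by (simp add: case_prod_beta)
  with finite.insertI[OF insert.hyps(1), of x]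
  have "finite (\<Union>(e, d)\<in>insert x F. {t. sym_det (T_endo (L t) e d) = 0})"
    by (rule finite_UN_I)
  from ex_new_if_finite[OF infinite_UNIV_char_0 this]
  obtain t where "t \<notin> (\<Union>(e, d)\<in>insert x F. {t. sym_det (T_endo (L t) e d) = 0})" ..
  moreover have "weyl_symmetries (L t)"
    unfolding L_def[abs_def] by (rule weyl_symmetries_affine[OF W(1) diagonal_weyl_symmetries[OF pq]])
  ultimately show ?case by blast
qed


section \<open>Linear connections on Euclidean space\<close>

definition std_chart :: "(real^'n, 'n::finite) chart" where
  "std_chart = (UNIV, \<lambda>x. x)"

lemma std_chart_simps [simp]:
  "chart_dom std_chart = UNIV" "coord std_chart = (\<lambda>x. x)" "inv_coord std_chart = (\<lambda>x. x)"
  using inv_id by (simp_all add: std_chart_def chart_dom_def coord_def inv_coord_def id_def)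

lemma euclidean_atlas_eq: "euclidean_atlas = {std_chart}"
  by (simp add: euclidean_atlas_def std_chart_def)

lemma open_in_euclidean: "open_in euclidean_atlas U \<longleftrightarrow> open U"
  by (simp add: open_in_def carrier_def euclidean_atlas_eq)

lemma chart_at_euclidean [simp]: "chart_at euclidean_atlas p = std_chart"
  by (simp add: chart_at_def euclidean_atlas_eq cong: conj_cong)

lemma tangent_space_euclidean: "v \<in> tangent_space euclidean_atlas p \<longleftrightarrow> (\<forall>c. c \<noteq> std_chart \<longrightarrow> v c = 0)"
  by (simp add: tangent_space_def euclidean_atlas_eq comp_def)

lemma vector_field_euclidean: "vector_field euclidean_atlas U X \<longleftrightarrow>
    (\<forall>p\<in>U. \<forall>c. c \<noteq> std_chart \<longrightarrow> X p c = 0) \<and> smooth_on (\<lambda>x. X x std_chart) U"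
  unfolding vector_field_def tangent_space_euclidean by (simp add: euclidean_atlas_eq)

lemma smooth_fun_euclidean: "smooth_fun euclidean_atlas U f \<longleftrightarrow> smooth_on f U"
  by (simp add: smooth_fun_def euclidean_atlas_eq comp_def)

lemma dir_deriv_euclidean: "dir_deriv euclidean_atlas p v f = der (v std_chart) f p"
  by (simp add: dir_deriv_def der_def comp_def)

lemma const_field_euclidean: "const_field euclidean_atlas std_chart u p std_chart = u"
  by (simp add: const_field_def euclidean_atlas_eq comp_def)

text \<open>\<open>\<Gamma>\<^sup>a\<^sub>b\<^sub>d(x) = S\<^sup>a\<^sub>b\<^sub>c\<^sub>d x\<^sup>c\<close>, contracted with the direction \<open>u\<close> of differentiation in \<open>d\<close> and with \<open>v\<close> in \<open>b\<close>.\<close>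

definition christoffel_term ::
  "('n::finite \<Rightarrow> 'n \<Rightarrow> 'n \<Rightarrow> 'n \<Rightarrow> real) \<Rightarrow> real^'n \<Rightarrow> real^'n \<Rightarrow> real^'n \<Rightarrow> real^'n" where
  "christoffel_term S x u v = (\<chi> a. \<Sum>b\<in>UNIV. \<Sum>c\<in>UNIV. \<Sum>d\<in>UNIV. S a b c d * x $ c * v $ b * u $ d)"

text \<open>The flat derivative plus a term whose coefficients vanish at the origin. The value 0 at
  all other charts is what \<open>tangent_space\<close> demands.\<close>

definition linear_connection ::
  "('n::finite \<Rightarrow> 'n \<Rightarrow> 'n \<Rightarrow> 'n \<Rightarrow> real) \<Rightarrow> (real^'n, 'n) connection" where
  "linear_connection S X Y p = (\<lambda>c. if c = std_chart
     then der (X p std_chart) (\<lambda>x. Y x std_chart) p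
       + christoffel_term S p (X p std_chart) (Y p std_chart)
     else 0)"

lemma christoffel_term_linear:
  "christoffel_term S x (u + u') v = christoffel_term S x u v + christoffel_term S x u' v"
  "christoffel_term S x u (v + v') = christoffel_term S x u v + christoffel_term S x u v'"
  "christoffel_term S x (r *\<^sub>R u) v = r *\<^sub>R christoffel_term S x u v"
  "christoffel_term S x u (r *\<^sub>R v) = r *\<^sub>R christoffel_term S x u v"
  by (simp_all add: christoffel_term_def vec_eq_iff sum.distrib distrib_left distrib_right sum_distrib_left mult_ac)

lemma smooth_on_christoffel_term:
  assumes "open U" "smooth_on X U" "smooth_on Y U"
  shows "smooth_on (\<lambda>x. christoffel_term S x (X x) (Y x)) U"
  unfolding christoffel_term_def
  using assms by (intro smooth_on_vec_lambda smooth_on_sum smooth_on_mult smooth_on_const smooth_on_nth smooth_on_ident)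

text \<open>\<open>smooth_on_der\<close> treats a fixed direction; a varying one is expanded in the
  standard basis.\<close>

lemma smooth_on_der_field:
  fixes X :: "real^'n::finite \<Rightarrow> real^'n" and Y :: "real^'n \<Rightarrow> real^'n"
  assumes U: "open U" and X: "smooth_on X U" and Y: "smooth_on Y U"
  shows "smooth_on (\<lambda>x. der (X x) Y x) U"
proof (rule smooth_on_cong[OF U])
  show "(\<Sum>i\<in>UNIV. X x $ i *\<^sub>R der (axis i 1) Y x) = der (X x) Y x" if "x \<in> U" for x
  proof -
    have lin: "linear (\<lambda>v. der v Y x)"
      by (rule der_linear[OF smooth_on_imp_differentiable[OF Y that]])
    have "der (X x) Y x = der (\<Sum>i\<in>UNIV. X x $ i *\<^sub>R axis i 1) Y x"
      by (rule arg_cong[of _ _ "\<lambda>v. der v Y x"])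
        (simp add: vec_eq_iff axis_def if_distrib cong: if_cong)
    then show ?thesis by (simp add: linear_sum[OF lin] linear_cmul[OF lin])
  qed
  show "smooth_on (\<lambda>x. \<Sum>i\<in>UNIV. X x $ i *\<^sub>R der (axis i 1) Y x) U"
    by (intro smooth_on_sum smooth_on_scaleR smooth_on_nth smooth_on_der U X Y)
qed

lemma affine_linear_connection:
  fixes S :: "'n::finite \<Rightarrow> 'n \<Rightarrow> 'n \<Rightarrow> 'n \<Rightarrow> real"
  shows "affine_connection euclidean_atlas (linear_connection S)"
proof -
  have diff: "(\<lambda>x. Y x std_chart) differentiable at p"
    if "vector_field euclidean_atlas U Y" "p \<in> U" for U Y and p :: "real^'n"
    using that smooth_on_imp_differentiable unfolding vector_field_euclidean by blast
  note lin = der_linear[OF diff]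
  show ?thesis
    unfolding affine_connection_def open_in_euclidean
  proof (intro allI impI conjI ballI)
    fix U X and Y :: "(real^'n, 'n) vfield"
    assume "open U" "vector_field euclidean_atlas U X \<and> vector_field euclidean_atlas U Y"
    then show "vector_field euclidean_atlas U (linear_connection S X Y)"
      unfolding vector_field_euclidean linear_connection_def
      by (simp add: smooth_on_add smooth_on_der_field smooth_on_christoffel_term)
  next
    fix U X Y X' Y' and p :: "real^'n"
    assume U: "open U" and h: "vector_field euclidean_atlas U X \<and> vector_field euclidean_atlas U Y \<and>
      (\<forall>p\<in>U. X' p = X p) \<and> (\<forall>p\<in>U. Y' p = Y p)" and p: "p \<in> U"
    have "der v (\<lambda>x. Y x std_chart) p = der v (\<lambda>x. Y' x std_chart) p" for v
      using h p by (intro der_cong[OF diff U]) auto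
    moreover have "X' p = X p" "Y' p = Y p" using h p by blast+
    ultimately show "linear_connection S X' Y' p = linear_connection S X Y p"
      unfolding linear_connection_def by metis
  next
    fix U X X' Y and p :: "real^'n"
    assume h: "vector_field euclidean_atlas U X \<and> vector_field euclidean_atlas U X' \<and>
      vector_field euclidean_atlas U Y" and p: "p \<in> U"
    then show "linear_connection S (\<lambda>q c. X q c + X' q c) Y p
        = (\<lambda>c. linear_connection S X Y p c + linear_connection S X' Y p c)"
      by (intro ext) (simp add: linear_connection_def christoffel_term_linear linear_add[OF lin[of U Y]])
  next
    fix U f X Y and p :: "real^'n"
    assume h: "smooth_fun euclidean_atlas U f \<and> vector_field euclidean_atlas U X \<and>
      vector_field euclidean_atlas U Y" and p: "p \<in> U"
    then show "linear_connection S (\<lambda>q c. f q *\<^sub>R X q c) Y p = (\<lambda>c. f p *\<^sub>R linear_connection S X Y p c)"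
      by (intro ext) (simp add: linear_connection_def christoffel_term_linear linear_cmul[OF lin[of U Y]]
          scaleR_add_right)
  next
    fix U X Y Y' and p :: "real^'n"
    assume h: "vector_field euclidean_atlas U X \<and> vector_field euclidean_atlas U Y \<and>
      vector_field euclidean_atlas U Y'" and p: "p \<in> U"
    then show "linear_connection S X (\<lambda>q c. Y q c + Y' q c) p
        = (\<lambda>c. linear_connection S X Y p c + linear_connection S X Y' p c)"
      by (intro ext) (simp add: linear_connection_def christoffel_term_linear
          der_add[OF diff[of U Y] diff[of U Y']])
  next
    fix U f X Y and p :: "real^'n"
    assume h: "smooth_fun euclidean_atlas U f \<and> vector_field euclidean_atlas U X \<and>
      vector_field euclidean_atlas U Y" and p: "p \<in> U"
    have "f differentiable at p" "\<And>c. c \<noteq> std_chart \<Longrightarrow> Y p c = 0"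
      using h p smooth_on_imp_differentiable unfolding smooth_fun_euclidean vector_field_euclidean by blast+
    with h p show "linear_connection S X (\<lambda>q c. f q *\<^sub>R Y q c) p
        = (\<lambda>c. dir_deriv euclidean_atlas p (X p) f *\<^sub>R Y p c + f p *\<^sub>R linear_connection S X Y p c)"
      by (intro ext) (simp add: linear_connection_def christoffel_term_linear der_scaleR diff[of U Y]
          dir_deriv_euclidean scaleR_add_right)
  qed
qed

lemma torsion_free_linear_connection:
  fixes S :: "'n::finite \<Rightarrow> 'n \<Rightarrow> 'n \<Rightarrow> 'n \<Rightarrow> real"
  assumes "\<And>a b c d. S a b c d = S a d c b"
  shows "torsion_free_connection euclidean_atlas (linear_connection S)"
proof -
  have sym: "christoffel_term S x u v = christoffel_term S x v u" for x u v
  proof -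
    have "(\<Sum>b\<in>UNIV. \<Sum>c\<in>UNIV. \<Sum>d\<in>UNIV. S a b c d * x $ c * v $ b * u $ d)
        = (\<Sum>c\<in>UNIV. \<Sum>b\<in>UNIV. \<Sum>d\<in>UNIV. S a b c d * x $ c * v $ b * u $ d)" for a and u v :: "real^'n"
      by (rule sum.swap)
    moreover have "(\<Sum>c\<in>UNIV. \<Sum>b\<in>UNIV. \<Sum>d\<in>UNIV. S a b c d * x $ c * v $ b * u $ d)
        = (\<Sum>c\<in>UNIV. \<Sum>b\<in>UNIV. \<Sum>d\<in>UNIV. S a b c d * x $ c * u $ b * v $ d)" for a
    proof (rule sum.cong)
      fix c
      have "(\<Sum>b\<in>UNIV. \<Sum>d\<in>UNIV. S a b c d * x $ c * v $ b * u $ d)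
          = (\<Sum>b\<in>UNIV. \<Sum>d\<in>UNIV. S a d c b * x $ c * v $ d * u $ b)"
        by (rule sum.swap)
      then show "(\<Sum>b\<in>UNIV. \<Sum>d\<in>UNIV. S a b c d * x $ c * v $ b * u $ d)
          = (\<Sum>b\<in>UNIV. \<Sum>d\<in>UNIV. S a b c d * x $ c * u $ b * v $ d)"
        by (subst (2) assms) (simp add: mult_ac)
    qed simp
    ultimately show ?thesis by (simp add: christoffel_term_def)
  qed
  have "(\<lambda>c. linear_connection S X Y p c - linear_connection S Y X p c) = lie_bracket euclidean_atlas X Y p" for X Y p
    by (rule ext) (simp add: linear_connection_def lie_bracket_def euclidean_atlas_eq der_def
        sym[of _ "X p std_chart"])
  then show ?thesis
    unfolding torsion_free_connection_def using affine_linear_connection by blast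
qed

section \<open>Curvature at the origin in the standard frame\<close>

definition std_frame :: "'n::finite \<Rightarrow> (real^'n, 'n) vfield" where
  "std_frame a p = (\<lambda>c. if c = std_chart then axis a 1 else 0)"

lemma std_frame_sum: "(\<Sum>a\<in>UNIV. (k $ a) *\<^sub>R std_frame a p c) = (if c = std_chart then k else 0)"
  by (simp add: std_frame_def vec_eq_iff axis_def if_distrib cong: if_cong)

lemma local_frame_std: "local_frame euclidean_atlas UNIV std_frame"
  unfolding local_frame_def std_frame_sum
proof (intro conjI allI ballI)
  show "open_in euclidean_atlas UNIV" by (simp add: open_in_euclidean)
  show "vector_field euclidean_atlas UNIV (std_frame a)" for a
    by (simp add: vector_field_euclidean std_frame_def smooth_on_const)
  show "\<exists>!k. v = (\<lambda>c. if c = std_chart then k else 0)" if "v \<in> tangent_space euclidean_atlas p" for p v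
  proof (rule ex1I)
    show "v = (\<lambda>c. if c = std_chart then v std_chart else 0)"
      using that by (auto simp: tangent_space_euclidean)
    show "k = v std_chart" if "v = (\<lambda>c. if c = std_chart then k else 0)" for k
      by (simp add: that)
  qed
qed

lemma coframe_std:
  assumes "\<And>c. c \<noteq> std_chart \<Longrightarrow> v c = 0"
  shows "coframe std_frame a p v = v std_chart $ a"
proof -
  have "(THE k. v = (\<lambda>c. if c = std_chart then k else 0)) = v std_chart"
  proof (rule the_equality)
    show "v = (\<lambda>c. if c = std_chart then v std_chart else 0)" using assms by auto
    show "k = v std_chart" if "v = (\<lambda>c. if c = std_chart then k else 0)" for k by (simp add: that)
  qed
  then show ?thesis by (simp add: coframe_def std_frame_sum)
qed

lemma axis_nth_delta: "(axis i 1 :: real^'n::finite) $ j = delta i j"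
  by (simp add: axis_def delta_def)

lemma conn_coeff_linear_connection:
  "conn_coeff (linear_connection S) std_frame a b d p = (\<Sum>c\<in>UNIV. S a b c d * p $ c)"
proof -
  have "conn_coeff (linear_connection S) std_frame a b d p = christoffel_term S p (axis d 1) (axis b 1) $ a"
    unfolding conn_coeff_def by (subst coframe_std) (simp_all add: linear_connection_def std_frame_def)
  also have "\<dots> = (\<Sum>b'\<in>UNIV. \<Sum>c\<in>UNIV. S a b' c d * p $ c * delta b b')"
    by (simp add: christoffel_term_def axis_nth_delta)
  also have "\<dots> = (\<Sum>c\<in>UNIV. S a b c d * p $ c)"
    by (subst sum.swap) simp
  finally show ?thesis .
qed

text \<open>The connection forms vanish at the origin, so only d\<omega> survives. They are linear
  in the point, and the third index of \<open>S\<close> becomes the direction of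
  differentiation.\<close>

lemma riemann_linear_connection:
  "riemann euclidean_atlas (linear_connection S) std_frame 0 a b c d = S a b c d - S a b d c"
proof -
  have form: "conn_form (linear_connection S) std_frame a b p v
      = (\<Sum>d\<in>UNIV. (\<Sum>c\<in>UNIV. S a b c d * p $ c) * v std_chart $ d)"
    if "\<And>c. c \<noteq> std_chart \<Longrightarrow> v c = 0" for a b p v
    using coframe_std[OF that] by (simp add: conn_form_def conn_coeff_linear_connection)
  have cf: "const_field euclidean_atlas std_chart u p c = 0" if "c \<noteq> std_chart" for c u p
    using that by (simp add: const_field_def euclidean_atlas_eq)
  have lin: "((\<lambda>p. \<Sum>d\<in>UNIV. (\<Sum>c\<in>UNIV. S a b c d * p $ c) * u $ d) has_derivative
      (\<lambda>p. \<Sum>d\<in>UNIV. (\<Sum>c\<in>UNIV. S a b c d * p $ c) * u $ d)) (at 0)" for u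
    by (intro has_derivative_sum has_derivative_mult_left has_derivative_mult_right
        bounded_linear.has_derivative[OF bounded_linear_vec_nth] has_derivative_ident)
  have comp: "(\<Sum>e\<in>UNIV. (\<Sum>f\<in>UNIV. S a b f e * (axis c 1 :: real^_) $ f) * (axis d 1 :: real^_) $ e) = S a b c d" for c d
    by (simp add: axis_nth_delta)
  show ?thesis
    by (simp add: riemann_def curv_form_def ext_deriv_def dir_deriv_euclidean wedge_def form cf
        const_field_euclidean der_eqI[OF lin] std_frame_def comp)
qed

lemma riemann_realisation:
  fixes R :: "'n::finite \<Rightarrow> 'n \<Rightarrow> 'n \<Rightarrow> 'n \<Rightarrow> real"
  assumes antisym: "\<And>a b c d. R a b c d = - R a b d c"
    and bianchi: "\<And>a b c d. R a b c d + R a c d b + R a d b c = 0"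
  shows "\<exists>D. torsion_free_connection euclidean_atlas D \<and> riemann euclidean_atlas D std_frame 0 = R"
proof (intro exI conjI)
  \<comment> \<open>The first-order term of the Christoffel symbols in normal coordinates. It is
    symmetric in \<open>b\<close> and \<open>d\<close>, as torsion-freeness requires; by the cyclic
    identity the difference under exchange of \<open>c\<close> and \<open>d\<close> collects three
    copies of \<open>R\<close>, hence the divisor 3.\<close>
  let ?S = "\<lambda>a b c d. (R a b c d + R a d c b) / 3"
  show "torsion_free_connection euclidean_atlas (linear_connection ?S)"
    by (rule torsion_free_linear_connection) simp
  show "riemann euclidean_atlas (linear_connection ?S) std_frame 0 = R"
  proof (intro ext)
    fix a b c d
    show "riemann euclidean_atlas (linear_connection ?S) std_frame 0 a b c d = R a b c d"
      using antisym[of a b d c] antisym[of a d c b] bianchi[of a b c d]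
      by (simp add: riemann_linear_connection field_simps)
  qed
qed

lemma projective_structure_class:
  assumes "torsion_free_connection \<A> D"
  shows "projective_structure \<A> {D'. torsion_free_connection \<A> D' \<and> projectively_equivalent \<A> D D'}"
  unfolding projective_structure_def quotient_def using assms by auto


section \<open>The obstructions\<close>

lemma card_less_pairs:
  "real (card {(e::'n::{finite, linorder}, d). e < d}) = real CARD('n) * (real CARD('n) - 1) / 2"
proof -
  let ?L = "{(e::'n, d). e < d}" and ?G = "{(e::'n, d). d < e}" and ?E = "{(e::'n, d). e = d}"
  have "?G = prod.swap ` ?L" by force
  then have G: "card ?G = card ?L" by (simp add: card_image)
  have "?E = (\<lambda>e. (e, e)) ` UNIV" by auto
  then have E: "card ?E = CARD('n)" by (simp add: card_image inj_on_def)
  have "CARD('n) * CARD('n) = card (UNIV :: ('n \<times> 'n) set)" by simp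
  also have "(UNIV :: ('n \<times> 'n) set) = (?L \<union> ?G) \<union> ?E" by auto
  also have "card \<dots> = card (?L \<union> ?G) + card ?E" by (rule card_Un_disjoint) auto
  also have "card (?L \<union> ?G) = card ?L + card ?G" by (rule card_Un_disjoint) auto
  finally have "real CARD('n) * real CARD('n) = 2 * real (card ?L) + real CARD('n)"
    unfolding G E by (metis (no_types, lifting) mult_2 of_nat_add of_nat_mult)
  then show ?thesis by (simp add: algebra_simps)
qed

lemma weyl_antisym: "weyl \<A> D X p a b c d = - weyl \<A> D X p a b d c"
  using riemann_antisym[of \<A> D X p a b c d] by (simp add: weyl_def weyl_of_def alt_def field_simps)

lemma T_endo_swap:
  assumes "\<And>a b c d. W a b c d = - W a b d c"
  shows "T_endo W d e \<kappa> = - T_endo W e d \<kappa>"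
proof -
  have "T_comp W d e c b a f = - T_comp W e d c b a f" for c b a f
    using assms[of _ _ d e] by (simp add: T_comp_def symm_def alt_def field_simps)
  then show ?thesis by (simp add: T_endo_def vec_eq_iff sum_negf)
qed

text \<open>Negating every row multiplies the determinant by a power of -1, so its vanishing
  survives in any dimension.\<close>

lemma sym_det_uminus_eq_0:
  assumes "\<And>\<kappa>. L' \<kappa> = - L \<kappa>" "sym_det L = 0"
  shows "sym_det L' = 0"
proof -
  have "sym_matrix L' $ i = (- 1) *s sym_matrix L $ i" for i
    using assms(1) by (simp add: vec_eq_iff sym_matrix_def sym_coords_def case_prod_beta)
  then have "sym_matrix L' = (\<chi> i. (- 1) *s sym_matrix L $ i)" by (simp add: vec_eq_iff)
  with det_rows_mul[of "\<lambda>_. - 1" "\<lambda>i. sym_matrix L $ i"] assms(2) show ?thesis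
    by (simp only: sym_det_def vec_lambda_eta mult_zero_right)
qed

text \<open>Exchanging \<open>e\<close> and \<open>d\<close> negates the endomorphism, and for
  \<open>e = d\<close> it is zero.\<close>

lemma sym_det_all_iff_less:
  fixes W :: "'n::{finite, linorder} \<Rightarrow> 'n \<Rightarrow> 'n \<Rightarrow> 'n \<Rightarrow> real"
  assumes anti: "\<And>a b c d. W a b c d = - W a b d c"
  shows "(\<forall>e d. sym_det (T_endo W e d) = 0) \<longleftrightarrow> (\<forall>e d. e < d \<longrightarrow> sym_det (T_endo W e d) = 0)"
proof (intro iffI allI impI)
  fix e d :: 'n assume less: "\<forall>e d. e < d \<longrightarrow> sym_det (T_endo W e d) = 0"
  consider "e < d" | "d < e" | "e = d" using less_linear by blast
  then show "sym_det (T_endo W e d) = 0"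
  proof cases
    case 2
    then have "sym_det (T_endo W d e) = 0" using less by blast
    then show ?thesis by (rule sym_det_uminus_eq_0[OF T_endo_swap[OF anti]])
  next
    case 3
    have "T_endo W e e \<kappa> = 0" for \<kappa>
    proof -
      have "T_endo W e e \<kappa> + T_endo W e e \<kappa> = 0" using T_endo_swap[of W e e \<kappa>, OF anti] by simp
      then show ?thesis by (simp add: vec_eq_iff)
    qed
    \<comment> \<open>A nonzero symmetric tensor in the kernel of the zero endomorphism, whose
      determinant is therefore 0.\<close>
    moreover have "mat 1 \<in> sym_tensors" "(mat 1 :: real^('n::{finite, linorder})^('n::{finite, linorder})) \<noteq> 0"
      by (auto simp: sym_tensors_def mat_def vec_eq_iff)
    ultimately show ?thesis unfolding 3[symmetric] by (intro sym_det_eq_0[OF linear_T_endo])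
  qed (use less in blast)
qed blast

theorem theorem2p13:
  fixes \<A> :: "('a::{t2_space, second_countable_topology}, 'n::{finite, linorder}) chart set"
    and S :: "('a, 'n) connection set"
  assumes "smooth_atlas \<A>"
    and "CARD('n) \<ge> 2"
    and "projective_structure \<A> S"
  shows "(metrisable \<A> S \<longrightarrow>
            (\<forall>D\<in>S. \<forall>U X. local_frame \<A> U X \<longrightarrow>
               (\<forall>p\<in>U. \<forall>e d. sym_det (T_endo (weyl \<A> D X p) e d) = 0)))
       \<and> (\<forall>D\<in>S. \<forall>U X. local_frame \<A> U X \<longrightarrow>
            (\<forall>p\<in>U. (\<forall>e d. sym_det (T_endo (weyl \<A> D X p) e d) = 0) \<longleftrightarrow>
                   (\<forall>e d. e < d \<longrightarrow> sym_det (T_endo (weyl \<A> D X p) e d) = 0)))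
       \<and> real (card {(e::'n, d). e < d}) = real CARD('n) * (real CARD('n) - 1) / 2
       \<and> (CARD('n) \<ge> 3 \<longrightarrow>
            (\<exists>S' X p. projective_structure (euclidean_atlas :: (real^('n::{finite, linorder}), 'n) chart set) S' \<and>
               local_frame euclidean_atlas UNIV X \<and>
               (\<forall>D\<in>S'. \<forall>e d. e < d \<longrightarrow>
                  sym_det (T_endo (weyl euclidean_atlas D X p) e d) \<noteq> 0)))"
proof (intro conjI)
  show "metrisable \<A> S \<longrightarrow> (\<forall>D\<in>S. \<forall>U X. local_frame \<A> U X \<longrightarrow>
      (\<forall>p\<in>U. \<forall>e d. sym_det (T_endo (weyl \<A> D X p) e d) = 0))"
  proof (intro impI ballI allI)
    fix D U X p e d
    assume "metrisable \<A> S" and D: "D \<in> S" and X: "local_frame \<A> U X" and p: "p \<in> U"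
    then obtain D' g where D': "D' \<in> S" and g: "pseudo_riemannian_metric \<A> g" "levi_civita \<A> g D'"
      unfolding metrisable_def by blast
    \<comment> \<open>The structure is the class of some \<open>D0\<close>, so its members come with
      an equivalence to \<open>D0\<close> rather than to each other; Weyl tensors are compared
      through \<open>D0\<close>.\<close>
    obtain D0 where D0: "torsion_free_connection \<A> D0"
      and S: "\<And>D. D \<in> S \<Longrightarrow> torsion_free_connection \<A> D \<and> projectively_equivalent \<A> D0 D"
      using assms(3) unfolding projective_structure_def quotient_def by auto
    have "weyl \<A> D X p = weyl \<A> D0 X p" if "D \<in> S" for D
      using weyl_projective_invariant[OF assms(2,1) X p D0] S[OF that] by blast
    then have "weyl \<A> D X p = weyl \<A> D' X p" using D D' by simp
    then show "sym_det (T_endo (weyl \<A> D X p) e d) = 0"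
      using levi_civita_sym_det[OF assms(2,1) X p g] by simp
  qed
  show "\<forall>D\<in>S. \<forall>U X. local_frame \<A> U X \<longrightarrow>
      (\<forall>p\<in>U. (\<forall>e d. sym_det (T_endo (weyl \<A> D X p) e d) = 0) \<longleftrightarrow>
        (\<forall>e d. e < d \<longrightarrow> sym_det (T_endo (weyl \<A> D X p) e d) = 0))"
    by (intro ballI allI impI sym_det_all_iff_less weyl_antisym)
  show "real (card {(e::'n, d). e < d}) = real CARD('n) * (real CARD('n) - 1) / 2"
    by (rule card_less_pairs)
  show "CARD('n) \<ge> 3 \<longrightarrow>
      (\<exists>S' X p. projective_structure (euclidean_atlas :: (real^('n::{finite, linorder}), 'n) chart set) S' \<and>
         local_frame euclidean_atlas UNIV X \<and>
         (\<forall>D\<in>S'. \<forall>e d. e < d \<longrightarrow> sym_det (T_endo (weyl euclidean_atlas D X p) e d) \<noteq> 0))"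
  proof
    assume n: "CARD('n) \<ge> 3"
    have "\<exists>W :: 'n \<Rightarrow> 'n \<Rightarrow> 'n \<Rightarrow> 'n \<Rightarrow> real. weyl_symmetries W \<and>
        (\<forall>(e, d)\<in>{(e, d). e < d}. sym_det (T_endo W e d) \<noteq> 0)"
      by (rule generic_weyl[OF n]) auto
    then obtain W :: "'n \<Rightarrow> 'n \<Rightarrow> 'n \<Rightarrow> 'n \<Rightarrow> real" where W: "weyl_symmetries W"
      and det: "\<And>e d. e < d \<Longrightarrow> sym_det (T_endo W e d) \<noteq> 0" by blast
    have "\<exists>D. torsion_free_connection euclidean_atlas D \<and> riemann euclidean_atlas D std_frame 0 = W"
      by (rule riemann_realisation) (use W in \<open>unfold weyl_symmetries_def, blast+\<close>)
    then obtain D where D: "torsion_free_connection euclidean_atlas D"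
      and R: "riemann euclidean_atlas D std_frame 0 = W" by blast
    \<comment> \<open>The determinants must be nonzero for every member of the class; invariance
      transfers the prescribed tensor from \<open>D\<close> to all of them.\<close>
    have weyl: "weyl euclidean_atlas D' std_frame 0 = W"
      if "torsion_free_connection euclidean_atlas D'" "projectively_equivalent euclidean_atlas D D'" for D'
      using weyl_projective_invariant[OF assms(2) smooth_atlas_euclidean local_frame_std UNIV_I D that]
      by (simp add: weyl_def R weyl_of_weyl_symmetries[OF W])
    show "\<exists>S' X p. projective_structure (euclidean_atlas :: (real^('n::{finite, linorder}), 'n) chart set) S' \<and>
         local_frame euclidean_atlas UNIV X \<and>
         (\<forall>D\<in>S'. \<forall>e d. e < d \<longrightarrow> sym_det (T_endo (weyl euclidean_atlas D X p) e d) \<noteq> 0)"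
    proof (rule exI, rule exI, rule exI, intro conjI ballI allI impI)
      show "projective_structure euclidean_atlas
          {D'. torsion_free_connection euclidean_atlas D' \<and> projectively_equivalent euclidean_atlas D D'}"
        by (rule projective_structure_class[OF D])
      show "local_frame euclidean_atlas UNIV std_frame" by (rule local_frame_std)
      fix D' and e d :: 'n
      assume "D' \<in> {D'. torsion_free_connection euclidean_atlas D' \<and> projectively_equivalent euclidean_atlas D D'}"
        and "e < d"
      then show "sym_det (T_endo (weyl euclidean_atlas D' std_frame 0) e d) \<noteq> 0"
        by (simp add: weyl det)
    qed
  qed
qed

end
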